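(* Let $\mathfrak g$ be a finite-dimensional strongly unimodular Lie algebra, $\theta_1\in\mathfrak g^*$, $X_2,X_3,X_4\in\mathfrak g$, and let $z_1,z_2,z_3,z_4\in\mathbb C$ be pairwise distinct; put $z_{ij}=z_i-z_j$. In non-abelian $BF$ theory on $\mathbb C$ in Lorenz gauge, $$\Big\langle \langle a(z_1),\theta_1\rangle\, \langle\gamma(z_2),X_2\rangle\, \langle\bar\gamma(z_3),X_3\rangle \,\langle \gamma(z_4),X_4\rangle \Big\rangle =g^2 \Big(\langle\theta_1,[X_2,[X_3,X_4]] \rangle\, \mathbb{I}(z_1,z_2,z_3,z_4) + \langle\theta_1,[X_4,[X_3,X_2]] \rangle\,\mathbb{I}(z_1,z_4,z_3,z_2) \Big)$$ where $$\mathbb{I}(z_1,z_2,z_3,z_4)= \frac{1}{2z_{12}}\left(i\,\mathsf{D}\Big(\frac{z_{34}}{z_{14}}\Big)-i\,\mathsf{D}\Big(\frac{z_{34}}{z_{24}}\Big)+ \log\left|\frac{z_{34}}{z_{14}} \right| \log\left|\frac{z_{23}}{z_{13}} \right| + \log\left|\frac{z_{14}}{z_{24}} \right| \log\left|\frac{z_{23}}{z_{34}} \right|\right)$$ and $\mathsf D(z)=\mathrm{Im}\,\mathrm{Li}_2(z)+\arg(1-z)\log|z|$ is the Bloch-Wigner dilogarithm.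
   Context: Strongly unimodular means $\mathrm{tr}_{\mathfrak g}(\mathrm{ad}_{X_1}\cdots \mathrm{ad}_{X_k})=(-1)^k\,\mathrm{tr}_{\mathfrak g}(\mathrm{ad}_{X_k}\cdots \mathrm{ad}_{X_1})$ for all $k\ge 1$, $X_i\in\mathfrak g$. $\langle\cdot,\cdot\rangle$ is the canonical pairing between $\mathfrak g$ and $\mathfrak g^*$. Write $\partial=\partial/\partial z$, $\bar\partial=\partial/\partial\bar z$, and let $d^2u$ be the standard area form on $\mathbb C$. Fundamental fields on $\mathbb C$: $a,\bar a,c$ are $\mathfrak g$-valued, $\gamma,\bar\gamma,b$ are $\mathfrak g^*$-valued; $a,\bar a,\gamma,\bar\gamma$ are even, $b,c$ are odd. Free correlators $\langle\cdots\rangle_0$ are given by Wick's lemma (with Koszul signs) from the propagators, valued in $\mathfrak g\otimes\mathfrak g^*\simeq \mathrm{End}(\mathfrak g)$: $\langle c(w)\otimes b(z)\rangle_0=(2\log|w-z|+C)\,\mathbb 1$ ($C$ an undetermined constant), $\langle a(w)\otimes\gamma(z)\rangle_0=\frac{\mathbb 1}{w-z}$, $\langle \bar a(w)\otimes\bar\gamma(z)\rangle_0=\frac{\mathbb 1}{\bar w-\bar z}$, all other propagators being zero; derivatives of fields act by differentiating propagators. The interaction is $V=\langle\gamma-\bar\gamma,[a,\bar a]\rangle+\langle\partial b,[\bar a,c]\rangle+\langle\bar\partial b,[a,c]\rangle$, and correlators of the theory at pairwise distinct points $z_i$ are $$\langle\Phi_1(z_1)\cdots\Phi_n(z_n)\rangle=\sum_{N\ge0}\frac1{N!}\Big(\frac{g}{2\pi}\Big)^N\int_{\mathbb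 C^N}d^2u_1\cdots d^2u_N\,\langle\Phi_1(z_1)\cdots\Phi_n(z_n)V(u_1)\cdots V(u_N)\rangle_0 ,$$ with no Wick contractions inside a single $V(u_i)$. The function $\mathsf D$ is single-valued and continuous on $\mathbb{CP}^1$, with $\mathsf D(0)=\mathsf D(1)=\mathsf D(\infty)=0$. *)

theory Defs
  imports "HOL-Analysis.Analysis"
begin

section \<open>Finite-dimensional Lie algebras\<close>

locale fd_lie_algebra = finite_dimensional_vector_space scale Basis
  for scale :: "'k::field \<Rightarrow> 'g::ab_group_add \<Rightarrow> 'g" and Basis :: "'g set" +
  fixes bracket :: "'g \<Rightarrow> 'g \<Rightarrow> 'g"
  assumes bracket_linear_left: "\<And>y. Vector_Spaces.linear scale scale (\<lambda>x. bracket x y)"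
    and bracket_linear_right: "\<And>x. Vector_Spaces.linear scale scale (bracket x)"
    and bracket_alternating: "\<And>x. bracket x x = 0"
    and jacobi: "\<And>x y z. bracket x (bracket y z) + bracket y (bracket z x)
                   + bracket z (bracket x y) = 0"
begin

definition coord :: "'g \<Rightarrow> 'g \<Rightarrow> 'k" where
  "coord e = (\<lambda>x. representation Basis x e)"

definition trace :: "('g \<Rightarrow> 'g) \<Rightarrow> 'k" where
  "trace f = (\<Sum>e\<in>Basis. coord e (f e))"

definition ad_prod :: "'g list \<Rightarrow> 'g \<Rightarrow> 'g" where
  "ad_prod Xs = foldr (\<lambda>X f. bracket X \<circ> f) Xs id"

definition strongly_unimodular :: bool where
  "strongly_unimodular \<longleftrightarrow>
     (\<forall>Xs. Xs \<noteq> [] \<longrightarrow> trace (ad_prod Xs) = (- 1) ^ length Xs * trace (ad_prod (rev Xs)))"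

end

section \<open>Wirtinger derivatives\<close>

definition wirtinger :: "(complex \<Rightarrow> complex) \<Rightarrow> complex \<Rightarrow> complex" where
  "wirtinger f z =
     (frechet_derivative f (at z) 1 - \<i> * frechet_derivative f (at z) \<i>) / 2"

definition wirtinger_bar :: "(complex \<Rightarrow> complex) \<Rightarrow> complex \<Rightarrow> complex" where
  "wirtinger_bar f z =
     (frechet_derivative f (at z) 1 + \<i> * frechet_derivative f (at z) \<i>) / 2"

section \<open>Fields\<close>

text \<open>A \<open>\<gg>\<close>-valued field occurs paired with a covector \<open>\<theta>\<close>, a \<open>\<gg>\<^sup>*\<close>-valued one paired
  with a vector \<open>X\<close>: for instance \<open>Fa \<theta>\<close> stands for \<open>\<langle>a,\<theta>\<rangle>\<close> and \<open>Fgamma X\<close> for \<open>\<langle>\<gamma>,X\<rangle>\<close>.\<close>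

datatype ('k, 'g) field =
    Fa "'g \<Rightarrow> 'k" | Fabar "'g \<Rightarrow> 'k" | Fc "'g \<Rightarrow> 'k"
  | Fgamma 'g | Fgammabar 'g | Fb 'g

text \<open>\<open>Der m n \<phi>\<close> is \<open>\<partial>\<^sup>m\<partial>\<bar>\<^sup>n\<phi>\<close>.\<close>

datatype ('k, 'g) derfield = Der nat nat "('k, 'g) field"

abbreviation Fund :: "('k, 'g) field \<Rightarrow> ('k, 'g) derfield" where
  "Fund \<phi> \<equiv> Der 0 0 \<phi>"

fun odd_field :: "('k, 'g) derfield \<Rightarrow> bool" where
  "odd_field (Der _ _ (Fc _)) = True"
| "odd_field (Der _ _ (Fb _)) = True"
| "odd_field _ = False"

text \<open>An insertion is a field, its position, and the label of the local operator it is a factor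
  of; factors of the same local operator are not contracted with each other.\<close>

type_synonym ('k, 'g) insertion = "('k, 'g) derfield \<times> complex \<times> nat"

datatype vertex = V_gamma | V_gammabar | V_db | V_dbarb

section \<open>Correlators of non-abelian BF theory\<close>

text \<open>The ground field is any field \<open>'k\<close> embedded in the complex numbers by \<open>emb\<close>.\<close>

locale bf_theory = fd_lie_algebra scale Basis bracket
  for scale :: "'k::field \<Rightarrow> 'g::ab_group_add \<Rightarrow> 'g" and Basis :: "'g set"
    and bracket :: "'g \<Rightarrow> 'g \<Rightarrow> 'g" +
  fixes emb :: "'k \<Rightarrow> complex"
    and coupling :: complex
    and log_const :: complex
  assumes emb_one: "emb 1 = 1"
    and emb_add: "\<And>x y. emb (x + y) = emb x + emb y"
    and emb_mult: "\<And>x y. emb (x * y) = emb x * emb y"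
begin

text \<open>\<open>propagator \<phi> \<psi> w z\<close> is the free correlator of \<open>\<phi>(w)\<psi>(z)\<close> in this order, so that the
  ghost propagator changes sign when its factors are exchanged.\<close>

fun propagator :: "('k, 'g) field \<Rightarrow> ('k, 'g) field \<Rightarrow> complex \<Rightarrow> complex \<Rightarrow> complex" where
  "propagator (Fc \<theta>) (Fb X) w z = emb (\<theta> X) * (complex_of_real (2 * ln (cmod (w - z))) + log_const)"
| "propagator (Fb X) (Fc \<theta>) w z = - (emb (\<theta> X) * (complex_of_real (2 * ln (cmod (z - w))) + log_const))"
| "propagator (Fa \<theta>) (Fgamma X) w z = emb (\<theta> X) / (w - z)"
| "propagator (Fgamma X) (Fa \<theta>) w z = emb (\<theta> X) / (z - w)"
| "propagator (Fabar \<theta>) (Fgammabar X) w z = emb (\<theta> X) / (cnj w - cnj z)"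
| "propagator (Fgammabar X) (Fabar \<theta>) w z = emb (\<theta> X) / (cnj z - cnj w)"
| "propagator _ _ w z = 0"

fun contraction :: "('k, 'g) insertion \<Rightarrow> ('k, 'g) insertion \<Rightarrow> complex" where
  "contraction (Der m n \<phi>, w, l) (Der m' n' \<psi>, z, l') =
     (if l = l' then 0
      else (wirtinger ^^ m) ((wirtinger_bar ^^ n)
             (\<lambda>w. (wirtinger ^^ m') ((wirtinger_bar ^^ n') (\<lambda>z. propagator \<phi> \<psi> w z)) z)) w)"

text \<open>Sum over all complete pairings: the first factor is contracted with each later one in turn,
  with the Koszul sign for moving the latter leftwards past the factors in between.\<close>

fun wick :: "('k, 'g) insertion list \<Rightarrow> complex" where
  "wick [] = 1"
| "wick (x # xs) =
     (\<Sum>j<length xs.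
        (if odd_field (fst (xs ! j))
         then (- 1) ^ length (filter (\<lambda>y. odd_field (fst y)) (take j xs)) else 1)
        * contraction x (xs ! j) * wick (take j xs @ drop (Suc j) xs))"

text \<open>The interaction expanded in the basis, \<open>[a,a\<bar>] = \<Sum>\<^sub>e\<^sub>,\<^sub>f \<langle>a,e\<^sup>*\<rangle>\<langle>a\<bar>,f\<^sup>*\<rangle>[e,f]\<close> and likewise for the
  ghost terms: \<open>V\<close> is the sum of \<open>vertex_sign v\<close> times \<open>vertex_monomial v e f\<close> over all kinds \<open>v\<close>
  and all basis vectors \<open>e, f\<close>.\<close>

fun vertex_sign :: "vertex \<Rightarrow> complex" where
  "vertex_sign V_gammabar = - 1"
| "vertex_sign _ = 1"

fun vertex_monomial :: "vertex \<Rightarrow> 'g \<Rightarrow> 'g \<Rightarrow> ('k, 'g) derfield list" where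
  "vertex_monomial V_gamma e f =
     [Fund (Fgamma (bracket e f)), Fund (Fa (coord e)), Fund (Fabar (coord f))]"
| "vertex_monomial V_gammabar e f =
     [Fund (Fgammabar (bracket e f)), Fund (Fa (coord e)), Fund (Fabar (coord f))]"
| "vertex_monomial V_db e f =
     [Der 1 0 (Fb (bracket e f)), Fund (Fabar (coord e)), Fund (Fc (coord f))]"
| "vertex_monomial V_dbarb e f =
     [Der 0 1 (Fb (bracket e f)), Fund (Fa (coord e)), Fund (Fc (coord f))]"

definition vertex_indices :: "(vertex \<times> 'g \<times> 'g) set" where
  "vertex_indices = {V_gamma, V_gammabar, V_db, V_dbarb} \<times> Basis \<times> Basis"

definition field_insertions :: "(('k, 'g) derfield \<times> complex) list \<Rightarrow> ('k, 'g) insertion list" where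
  "field_insertions \<Phi> = map (\<lambda>i. (fst (\<Phi> ! i), snd (\<Phi> ! i), i)) [0..<length \<Phi>]"

definition vertex_insertions ::
  "(vertex \<times> 'g \<times> 'g) \<Rightarrow> complex \<Rightarrow> nat \<Rightarrow> ('k, 'g) insertion list" where
  "vertex_insertions I u l =
     (case I of (v, e, f) \<Rightarrow> map (\<lambda>\<phi>. (\<phi>, u, l)) (vertex_monomial v e f))"

text \<open>The free correlator of \<open>\<Phi>\<^sub>1(z\<^sub>1)\<dots>\<Phi>\<^sub>n(z\<^sub>n)V(u\<^sub>0)\<dots>V(u\<^sub>N\<^sub>-\<^sub>1)\<close>.\<close>

definition free_correlator ::
  "(('k, 'g) derfield \<times> complex) list \<Rightarrow> nat \<Rightarrow> (nat \<Rightarrow> complex) \<Rightarrow> complex" where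
  "free_correlator \<Phi> N u =
     (\<Sum>I\<in>{..<N} \<rightarrow>\<^sub>E vertex_indices.
        (\<Prod>k<N. vertex_sign (fst (I k)))
        * wick (field_insertions \<Phi>
                @ concat (map (\<lambda>k. vertex_insertions (I k) (u k) (length \<Phi> + k)) [0..<N])))"

definition correlator_term :: "(('k, 'g) derfield \<times> complex) list \<Rightarrow> nat \<Rightarrow> complex" where
  "correlator_term \<Phi> N =
     1 / fact N * (coupling / (2 * of_real pi)) ^ N
     * (LINT u | Pi\<^sub>M {..<N} (\<lambda>_. lborel). free_correlator \<Phi> N u)"

text \<open>The Bochner integral and \<open>suminf\<close> are total functions; this says that they exist.\<close>

definition correlator_exists :: "(('k, 'g) derfield \<times> complex) list \<Rightarrow> bool" where
  "correlator_exists \<Phi> \<longleftrightarrow>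
     (\<forall>N. integrable (Pi\<^sub>M {..<N} (\<lambda>_. lborel)) (free_correlator \<Phi> N))
     \<and> summable (correlator_term \<Phi>)"

definition correlator :: "(('k, 'g) derfield \<times> complex) list \<Rightarrow> complex" where
  "correlator \<Phi> = (\<Sum>N. correlator_term \<Phi> N)"

end

section \<open>The Bloch-Wigner dilogarithm\<close>

text \<open>\<open>Li\<^sub>2(z) = -\<integral>\<^sub>0\<^sup>z log(1-s)/s ds\<close> along the segment \<open>s = tz\<close>, principal branch.\<close>

definition Li2 :: "complex \<Rightarrow> complex" where
  "Li2 z = - integral {0..1} (\<lambda>t. Ln (1 - of_real t * z) / of_real t)"

text \<open>On the cut \<open>z > 1\<close>, where \<open>Arg\<close> and \<open>Im Ln\<close> of negative reals equal \<open>\<pi>\<close>, the jumps of the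
  two summands cancel and the value is 0, the one given by continuity; at 0 and 1
  the value is 0 because \<open>ln 0 = 0\<close> and \<open>Arg 0 = 0\<close>.\<close>

definition bloch_wigner :: "complex \<Rightarrow> real" where
  "bloch_wigner z = Im (Li2 z) + Arg (1 - z) * ln (cmod z)"

definition BF_I :: "complex \<Rightarrow> complex \<Rightarrow> complex \<Rightarrow> complex \<Rightarrow> complex" where
  "BF_I z1 z2 z3 z4 =
     1 / (2 * (z1 - z2)) *
       (\<i> * of_real (bloch_wigner ((z3 - z4) / (z1 - z4)))
        - \<i> * of_real (bloch_wigner ((z3 - z4) / (z2 - z4)))
        + of_real (ln (cmod ((z3 - z4) / (z1 - z4))) * ln (cmod ((z2 - z3) / (z1 - z3))))
        + of_real (ln (cmod ((z1 - z4) / (z2 - z4))) * ln (cmod ((z2 - z3) / (z3 - z4)))))"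

end

(* Charge conservation leaves only the terms with exactly two interaction vertices. In these,
   the gauge loop and the ghost loop cancel pointwise, and the two trees remain; each is
     (g/2pi)^2 times the integral over u, v of
     1/((z1-u)(u-z2)) * 1/((u-v)^bar (v-z4) (v-z3)^bar).
   The kernel 1/(u-p) - 1/(u-q) integrated against a d-bar derivative evaluates the primitive at
   p and q (Cauchy-Pompeiu). Applied to log|v-z4|, conjugated, it gives the v-integral
   2 pi log|(u-z4)/(z3-z4)| / (u-z3)^bar, whose single-valued d-bar primitive in u is built from
   log|w| log|1-w| + i D(w) with w = (u-z3)/(z4-z3); a second application gives the u-integral.
   The differential dD = log|z| d arg(1-z) - log|1-z| d arg z yields the symmetries
   D(1/z) = D(1-z) = -D(z), which bring the result to the stated form. *)
theory Submission
  imports Defs "HOL-Probability.Distributions" "HOL-Real_Asymp.Real_Asymp"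
    "HOL-Complex_Analysis.Complex_Analysis"
begin

section \<open>Integration over the complex plane\<close>

text \<open>Cauchy-Pompeiu is proved without contours or excised discs. If F vanishes at both poles,
  the partial derivatives of F times the kernel are integrable and integrate to zero line by line; a
  Gaussian correction reduces the general case to this one. A correlator is a Bochner integral over
  C^2, so the iterated evaluation presupposes absolute integrability in (u, v), for which fractional
  powers of the factors are distributed unevenly. Two default values shape the rest. Derivatives of
  log|u-v| have no meaning at u = v, so identities between integrands hold off the diagonal only,
  while measurability must be secured on it as well. The principal branches in D jump along z > 1;
  D(1/z) = -D(z) is therefore proved first away from the cut, and only then gives the differential
  of D on it.\<close>

lemma measurable_Complex_pair:
  "(\<lambda>(x, y). Complex x y) \<in> borel_measurable (lborel \<Otimes>\<^sub>M lborel)"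
  by (simp add: Complex_eq split_beta)

text \<open>Lebesgue measure on \<open>complex\<close> is that of an abstract Euclidean space. Its
  values on boxes determine it and identify it with a product of two real Lebesgue measures, which
  makes Fubini available in the real and imaginary parts.\<close>

lemma lborel_complex:
  "distr (lborel \<Otimes>\<^sub>M lborel) borel (\<lambda>(x, y). Complex x y) = (lborel :: complex measure)"
proof (rule lborel_eqI[symmetric])
  fix l u :: complex assume le: "\<And>b. b \<in> Basis \<Longrightarrow> l \<bullet> b \<le> u \<bullet> b"
  have le': "Re l \<le> Re u" "Im l \<le> Im u"
    using le[of 1] le[of \<i>] by (auto simp: Basis_complex_def)
  have "(\<lambda>(x, y). Complex x y) -` box l u \<inter> space (lborel \<Otimes>\<^sub>M lborel)
      = box (Re l) (Re u) \<times> box (Im l) (Im u)"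
    by (auto simp: box_def Basis_complex_def space_pair_measure)
  moreover have "emeasure (lborel \<Otimes>\<^sub>M lborel) (box (Re l) (Re u) \<times> box (Im l) (Im u))
      = ennreal (Re u - Re l) * ennreal (Im u - Im l)"
    using le' by (subst sigma_finite_measure.emeasure_pair_measure_Times[OF sigma_finite_lborel]) auto
  ultimately show "emeasure (distr (lborel \<Otimes>\<^sub>M lborel) borel (\<lambda>(x, y). Complex x y)) (box l u)
      = ennreal (\<Prod>b\<in>Basis. (u - l) \<bullet> b)"
    using le' measurable_Complex_pair
    by (subst emeasure_distr) (auto simp: Basis_complex_def ennreal_mult')
qed simp

lemma integrable_complex_iff:
  fixes f :: "complex \<Rightarrow> 'b::{banach, second_countable_topology}"
  assumes "f \<in> borel_measurable borel"
  shows "integrable lborel f \<longleftrightarrow> integrable (lborel \<Otimes>\<^sub>M lborel) (\<lambda>(x, y). f (Complex x y))"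
  using integrable_distr_eq[OF measurable_Complex_pair, of f] assms
  by (simp add: lborel_complex[unfolded case_prod_unfold] case_prod_unfold)

lemma integral_complex_eq:
  fixes f :: "complex \<Rightarrow> 'b::{banach, second_countable_topology}"
  assumes "f \<in> borel_measurable borel"
  shows "integral\<^sup>L lborel f = integral\<^sup>L (lborel \<Otimes>\<^sub>M lborel) (\<lambda>(x, y). f (Complex x y))"
  using integral_distr[OF measurable_Complex_pair, of f] assms
  by (simp add: lborel_complex[unfolded case_prod_unfold] case_prod_unfold)

lemma has_bochner_integral_complex_prod:
  fixes f g :: "real \<Rightarrow> real"
  assumes f: "integrable lborel f" and g: "integrable lborel g"
  shows "has_bochner_integral lborel (\<lambda>u::complex. f (Re u) * g (Im u))
           (integral\<^sup>L lborel f * integral\<^sup>L lborel g)"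
proof -
  have [measurable]: "f \<in> borel_measurable borel" "g \<in> borel_measurable borel"
    using f g by (auto dest: borel_measurable_integrable)
  have I: "integrable (lborel \<Otimes>\<^sub>M lborel) (\<lambda>(x, y). f x * g y)"
  proof (rule lborel_pair.Fubini_integrable)
    show "integrable lborel (\<lambda>x. \<integral>y. norm (case (x, y) of (x, y) \<Rightarrow> f x * g y) \<partial>lborel)"
      using f by (simp add: abs_mult)
  qed (use g in \<open>auto intro!: AE_I2\<close>)
  moreover have "(\<integral>z. (case z of (x, y) \<Rightarrow> f x * g y) \<partial>(lborel \<Otimes>\<^sub>M lborel))
      = integral\<^sup>L lborel f * integral\<^sup>L lborel g"
    using lborel_pair.integral_fst'[OF I] by simp
  ultimately show ?thesis
    by (simp add: has_bochner_integral_iff integrable_complex_iff integral_complex_eq)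
qed

section \<open>Integrable powers of the distance on the line and in the plane\<close>

lemma integrable_even:
  fixes f :: "real \<Rightarrow> real"
  assumes "set_integrable lborel {0..} f" and [measurable]: "f \<in> borel_measurable borel"
  shows "integrable lborel (\<lambda>x. f \<bar>x\<bar>)"
proof (rule Bochner_Integration.integrable_bound)
  have I: "integrable lborel (\<lambda>x. indicat_real {0..} x * f x)"
    using assms(1) by (simp add: set_integrable_def)
  from lborel_integrable_real_affine[OF this, of "-1" 0]
  have "integrable lborel (\<lambda>x. indicat_real {0..} (-x) * f (-x))" by simp
  with I show "integrable lborel
      (\<lambda>x. \<bar>indicat_real {0..} x * f x\<bar> + \<bar>indicat_real {0..} (-x) * f (-x)\<bar>)"
    by (intro Bochner_Integration.integrable_add integrable_abs)
qed (auto simp: indicator_def)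

lemma set_integrable_lborel_nonneg:
  fixes f :: "real \<Rightarrow> real"
  assumes "f integrable_on S" "\<And>x. x \<in> S \<Longrightarrow> 0 \<le> f x"
    and [measurable]: "f \<in> borel_measurable borel" "S \<in> sets borel"
  shows "set_integrable lborel S f"
proof -
  have "set_integrable lebesgue S f"
    using nonnegative_absolutely_integrable_1[OF assms(1,2)] by auto
  then show ?thesis
    unfolding set_integrable_def by (subst (asm) integrable_completion) auto
qed

lemma integrable_abs_powr_near_0:
  fixes s :: real assumes "s < 1"
  shows "integrable lborel (\<lambda>x. indicat_real {..1} \<bar>x\<bar> * \<bar>x\<bar> powr (- s))"
proof (rule integrable_even)
  have "set_integrable lborel {0..1} (\<lambda>x. x powr (- s))"
    using has_integral_powr_from_0[of "- s" 1] assms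
    by (intro set_integrable_lborel_nonneg) auto
  moreover have "indicat_real {0..1} x *\<^sub>R x powr - s
      = indicat_real {0..} x *\<^sub>R (indicat_real {..1} x * x powr - s)" for x :: real
    by (auto simp: indicator_def)
  ultimately show "set_integrable lborel {0..} (\<lambda>x. indicat_real {..1} x * x powr - s)"
    unfolding set_integrable_def by (simp only:)
qed simp

lemma integrable_powr_at_infinity:
  fixes t :: real assumes "t > 1"
  shows "integrable lborel (\<lambda>x. (1 + \<bar>x\<bar>) powr (- t))"
proof (rule integrable_even)
  have "set_integrable lborel {1..} (\<lambda>x. x powr (- t))"
    using has_integral_powr_to_inf[of "- t" 1] assms
    by (intro set_integrable_lborel_nonneg) auto
  then have "integrable lborel (\<lambda>x. indicat_real {1..} x * x powr (- t))"
    by (simp add: set_integrable_def)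
  from lborel_integrable_real_affine[OF this, of 1 1]
  have "integrable lborel (\<lambda>x. indicat_real {1..} (1 + x) * (1 + x) powr (- t))" by simp
  moreover have "indicat_real {1..} (1 + x) = indicator {0..} x" for x :: real
    by (auto simp: indicator_def)
  ultimately show "set_integrable lborel {0..} (\<lambda>x. (1 + x) powr - t)"
    by (simp add: set_integrable_def)
qed simp

lemma AE_lborel_inner_neq:
  fixes k :: "'a::euclidean_space"
  assumes "k \<in> Basis"
  shows "AE u in lborel. u \<bullet> k \<noteq> c"
proof -
  have "{u. u \<bullet> k = c} \<in> null_sets lebesgue"
    using negligible_standard_hyperplane[OF assms] by (simp add: negligible_iff_null_sets)
  moreover have "{u. u \<bullet> k = c} \<in> sets borel"
    by (intro borel_closed closed_Collect_eq continuous_intros)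
  ultimately have "{u. u \<bullet> k = c} \<in> null_sets lborel"
    by (simp add: null_sets_completion_iff)
  from AE_not_in[OF this] show ?thesis by simp
qed

text \<open>Instead of polar coordinates: |u| dominates both |Re u| and |Im u|, so the power is at
  most a product of one-dimensional powers of exponent \<alpha>/2 < 1.\<close>

lemma integrable_norm_powr_near_0:
  fixes \<alpha> :: real assumes "0 \<le> \<alpha>" "\<alpha> < 2"
  shows "integrable lborel (\<lambda>u::complex. indicat_real (cball 0 1) u * norm u powr (- \<alpha>))"
proof (rule Bochner_Integration.integrable_bound)
  let ?f = "\<lambda>x. indicat_real {..1} \<bar>x\<bar> * \<bar>x\<bar> powr (- (\<alpha>/2))"
  have "integrable lborel ?f"
    using integrable_abs_powr_near_0[of "\<alpha>/2"] assms by simp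
  from has_bochner_integral_complex_prod[OF this this]
  show "integrable lborel (\<lambda>u::complex. ?f (Re u) * ?f (Im u))"
    by (simp add: has_bochner_integral_iff)
  \<comment> \<open>On the axes the product bound fails because \<open>0 powr _ = 0\<close>; they
    form a null set.\<close>
  have "AE u::complex in lborel. Re u \<noteq> 0 \<and> Im u \<noteq> 0"
    using AE_lborel_inner_neq[of "1::complex" 0] AE_lborel_inner_neq[of \<i> 0]
    by (auto simp: Basis_complex_def)
  then show "AE u::complex in lborel. norm (indicat_real (cball 0 1) u * norm u powr (- \<alpha>))
      \<le> norm (?f (Re u) * ?f (Im u))"
  proof eventually_elim
    case (elim u)
    have "norm u powr (- \<alpha>) = norm u powr (- (\<alpha>/2)) * norm u powr (- (\<alpha>/2))"
      by (simp flip: powr_add)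
    also have "\<dots> \<le> \<bar>Re u\<bar> powr (- (\<alpha>/2)) * \<bar>Im u\<bar> powr (- (\<alpha>/2))"
      using elim assms by (intro mult_mono powr_mono2' abs_Re_le_cmod abs_Im_le_cmod) auto
    finally show ?case
      using abs_Re_le_cmod[of u] abs_Im_le_cmod[of u]
      by (auto simp: indicator_def)
  qed
qed (intro borel_measurable_times borel_measurable_indicator powr_real_measurable; simp)

lemma integrable_norm_powr_at_infinity:
  fixes \<beta> :: real assumes "\<beta> > 2"
  shows "integrable lborel (\<lambda>u::complex. (1 + norm u) powr (- \<beta>))"
proof (rule Bochner_Integration.integrable_bound)
  let ?f = "\<lambda>x. (1 + \<bar>x\<bar>) powr (- (\<beta>/2))"
  have "integrable lborel ?f"
    using integrable_powr_at_infinity[of "\<beta>/2"] assms by simp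
  from has_bochner_integral_complex_prod[OF this this]
  show "integrable lborel (\<lambda>u::complex. ?f (Re u) * ?f (Im u))"
    by (simp add: has_bochner_integral_iff)
  have "norm ((1 + norm u) powr (- \<beta>)) \<le> norm (?f (Re u) * ?f (Im u))" for u :: complex
  proof -
    have "(1 + norm u) powr (- \<beta>) = (1 + norm u) powr (- (\<beta>/2)) * (1 + norm u) powr (- (\<beta>/2))"
      by (simp flip: powr_add)
    also have "\<dots> \<le> ?f (Re u) * ?f (Im u)"
      using assms by (intro mult_mono powr_mono2' add_left_mono abs_Re_le_cmod abs_Im_le_cmod) auto
    finally show ?thesis by simp
  qed
  then show "AE u::complex in lborel. norm ((1 + norm u) powr (- \<beta>)) \<le> norm (?f (Re u) * ?f (Im u))"
    by simp
qed measurable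

lemma integrable_lborel_shift:
  fixes f :: "'a::euclidean_space \<Rightarrow> 'b::{banach, second_countable_topology}"
  assumes "integrable lborel f"
  shows "integrable lborel (\<lambda>u. f (u - s))"
    and "(\<integral>u. f (u - s) \<partial>lborel) = integral\<^sup>L lborel f"
proof -
  have [measurable]: "f \<in> borel_measurable borel"
    using assms by (auto dest: borel_measurable_integrable)
  have d: "distr lborel borel ((+) (- s)) = (lborel :: 'a measure)"
    by (rule lborel_distr_plus)
  have "integrable lborel (\<lambda>u. f (- s + u))"
    using assms integrable_distr_eq[of "(+) (- s)" lborel borel f] by (simp add: d)
  then show "integrable lborel (\<lambda>u. f (u - s))" by (simp add: algebra_simps)
  show "(\<integral>u. f (u - s) \<partial>lborel) = integral\<^sup>L lborel f"
    using integral_distr[of "(+) (- s)" lborel borel f] by (simp add: d algebra_simps)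
qed

text \<open>The comparison test in real dimension two, with critical exponent 2. Local bounds near
  S, a tail bound near infinity and boundedness on the compact remainder add up to one integrable
  majorant.\<close>

lemma integrable_complex_singularities:
  fixes f :: "complex \<Rightarrow> 'b::{banach, second_countable_topology}" and \<alpha> \<beta> :: real
  assumes fin: "finite S" and cont: "continuous_on (- S) f"
    and \<alpha>: "0 \<le> \<alpha>" "\<alpha> < 2" and \<beta>: "\<beta> > 2"
    and near: "\<And>s. s \<in> S \<Longrightarrow> (\<lambda>u. norm (f u)) \<in> O[at s](\<lambda>u. norm (u - s) powr (- \<alpha>))"
    and inf: "(\<lambda>u. norm (f u)) \<in> O[at_infinity](\<lambda>u. norm u powr (- \<beta>))"
  shows "integrable lborel f"
proof -
  let ?n = "\<lambda>u::complex. indicat_real (cball 0 1) u * norm u powr (- \<alpha>)"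
  let ?i = "\<lambda>u::complex. (1 + norm u) powr (- \<beta>)"
  have "\<exists>C r. 0 \<le> C \<and> 0 < r \<and> r \<le> 1 \<and> (\<forall>u. u \<noteq> s \<and> dist u s < r \<longrightarrow> norm (f u) \<le> C * ?n (u - s))"
    if s: "s \<in> S" for s
  proof -
    obtain C where C: "C > 0" "\<forall>\<^sub>F u in at s. norm (f u) \<le> C * norm (u - s) powr (- \<alpha>)"
      using landau_o.bigE[OF near[OF s]] by auto
    then obtain r where "r > 0" "\<And>u. u \<noteq> s \<Longrightarrow> dist u s < r \<Longrightarrow> norm (f u) \<le> C * norm (u - s) powr (- \<alpha>)"
      by (auto simp: eventually_at)
    then show ?thesis using C(1)
      by (intro exI[of _ C] exI[of _ "min r 1"]) (auto simp: dist_norm indicator_def norm_minus_commute)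
  qed
  then obtain C r where Cr: "\<And>s. s \<in> S \<Longrightarrow> 0 \<le> C s" "\<And>s. s \<in> S \<Longrightarrow> 0 < r s"
    "\<And>s u. s \<in> S \<Longrightarrow> u \<noteq> s \<Longrightarrow> dist u s < r s \<Longrightarrow> norm (f u) \<le> C s * ?n (u - s)"
    by metis
  obtain K where K: "K > 0" "\<forall>\<^sub>F u in at_infinity. norm (f u) \<le> K * norm u powr (- \<beta>)"
    using landau_o.bigE[OF inf] by auto
  then obtain R0 where R0: "\<And>u. norm u \<ge> R0 \<Longrightarrow> norm (f u) \<le> K * norm u powr (- \<beta>)"
    by (auto simp: eventually_at_infinity)
  define R where "R = max R0 1"
  have far: "norm (f u) \<le> K * 2 powr \<beta> * ?i u" if "norm u \<ge> R" for u
  proof -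
    have "norm (f u) \<le> K * norm u powr (- \<beta>)" using R0 that by (simp add: R_def)
    also have "norm u powr (- \<beta>) \<le> ((1 + norm u) / 2) powr (- \<beta>)"
      using that \<beta> by (intro powr_mono2') (auto simp: R_def)
    also have "((1 + norm u) / 2) powr (- \<beta>) = 2 powr \<beta> * ?i u"
      by (subst powr_divide) (auto simp: powr_minus field_simps)
    finally show ?thesis using K by (simp add: mult.assoc)
  qed
  have "compact (cball 0 R - (\<Union>s\<in>S. ball s (r s)))"
    by (intro compact_diff compact_cball open_UN ballI open_ball)
  moreover have "continuous_on (cball 0 R - (\<Union>s\<in>S. ball s (r s))) f"
    using Cr(2) by (intro continuous_on_subset[OF cont]) auto
  ultimately have "bounded (f ` (cball 0 R - (\<Union>s\<in>S. ball s (r s))))"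
    by (intro compact_imp_bounded compact_continuous_image)
  then obtain M where M: "M > 0" "\<And>u. u \<in> cball 0 R - (\<Union>s\<in>S. ball s (r s)) \<Longrightarrow> norm (f u) \<le> M"
    unfolding bounded_pos by blast
  have mid: "norm (f u) \<le> M * (1 + R) powr \<beta> * ?i u"
    if "u \<in> cball 0 R - (\<Union>s\<in>S. ball s (r s))" for u
  proof -
    have "norm (f u) * 1 \<le> M * ((1 + R) powr \<beta> * ?i u)"
    proof (intro mult_mono M that)
      have "(1 + R) powr (- \<beta>) \<le> ?i u"
        using that \<beta> by (intro powr_mono2') (auto simp: add_pos_nonneg)
      moreover have "1 + R > 0" by (simp add: R_def)
      ultimately show "1 \<le> (1 + R) powr \<beta> * ?i u"
        by (simp add: powr_minus field_simps)
    qed (use M in auto)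
    then show ?thesis by (simp add: mult.assoc)
  qed
  define A where "A = max (K * 2 powr \<beta>) (M * (1 + R) powr \<beta>)"
  let ?g = "\<lambda>u. A * ?i u + (\<Sum>s\<in>S. C s * ?n (u - s))"
  have A: "A \<ge> 0" using K M by (auto simp: A_def max_def)
  show ?thesis
  proof (rule Bochner_Integration.integrable_bound)
    show "integrable lborel ?g"
      by (intro Bochner_Integration.integrable_add Bochner_Integration.integrable_sum
          integrable_mult_right integrable_norm_powr_at_infinity \<beta>
          integrable_lborel_shift(1)[OF integrable_norm_powr_near_0[OF \<alpha>]])
    show "f \<in> borel_measurable lborel"
      using borel_measurable_continuous_countable_exceptions[OF countable_finite[OF fin] cont] by simp
    have "AE u in lborel. u \<notin> S"
      using fin by (intro AE_not_in) (auto intro: countable_imp_null_set_lborel countable_finite)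
    then show "AE u in lborel. norm (f u) \<le> norm (?g u)"
    proof eventually_elim
      case (elim u)
      have pos: "0 \<le> C s * ?n (u - s)" if "s \<in> S" for s using Cr that by simp
      then have sum0: "0 \<le> (\<Sum>s\<in>S. C s * ?n (u - s))" by (rule sum_nonneg)
      have "norm (f u) \<le> ?g u"
      proof (cases "\<exists>s\<in>S. dist u s < r s")
        case True
        then obtain s where s: "s \<in> S" "dist u s < r s" by auto
        then have "norm (f u) \<le> C s * ?n (u - s)" using elim by (intro Cr) auto
        also have "\<dots> \<le> (\<Sum>s\<in>S. C s * ?n (u - s))"
          using pos s fin by (intro member_le_sum) auto
        finally show ?thesis using A by (simp add: add_increasing)
      next
        case False
        have "norm (f u) \<le> A * ?i u"
        proof (cases "norm u \<ge> R")
          case True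
          have "K * 2 powr \<beta> * ?i u \<le> A * ?i u" by (intro mult_right_mono) (auto simp: A_def)
          with far[OF True] show ?thesis by linarith
        next
          case F: False
          then have "u \<in> cball 0 R - (\<Union>s\<in>S. ball s (r s))"
            using False by (auto simp: dist_commute)
          moreover have "M * (1 + R) powr \<beta> * ?i u \<le> A * ?i u"
            by (intro mult_right_mono) (auto simp: A_def)
          ultimately show ?thesis using mid by fastforce
        qed
        with sum0 show ?thesis by linarith
      qed
      then show ?case by simp
    qed
  qed
qed

section \<open>Integrals of derivatives of functions that vanish at infinity\<close>

lemma integral_derivative_vanishing_at_infinity:
  fixes g g' :: "real \<Rightarrow> 'b::euclidean_space"
  assumes der: "\<And>x. (g has_vector_derivative g' x) (at x)"
    and cont: "continuous_on UNIV g'" and int: "integrable lborel g'"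
    and lim: "(g \<longlongrightarrow> 0) at_top" "(g \<longlongrightarrow> 0) at_bot"
  shows "integral\<^sup>L lborel g' = 0"
proof -
  have "(LBINT x=-\<infinity>..\<infinity>. g' x) = 0 - 0"
  proof (rule interval_integral_FTC_integrable)
    show "((g \<circ> real_of_ereal) \<longlongrightarrow> 0) (at_right (-\<infinity>))" "((g \<circ> real_of_ereal) \<longlongrightarrow> 0) (at_left \<infinity>)"
      using lim by (simp_all add: ereal_tendsto_simps)
    show "isCont g' x" for x using cont by (simp add: continuous_on_eq_continuous_at)
    show "set_integrable lborel (einterval (-\<infinity>) \<infinity>) g'"
      using int by (simp add: set_integrable_def)
  qed (use der in auto)
  then show ?thesis
    by (simp add: interval_lebesgue_integral_def set_lebesgue_integral_def)
qed

text \<open>Fubini reduces the claim to lines parallel to an axis. Almost every such line misses the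
  finite set S, so an integrable singularity contributes no boundary term.\<close>

lemma integral_partials_vanishing_at_infinity:
  fixes G :: "complex \<Rightarrow> complex"
  assumes fin: "finite S"
    and der: "\<And>u. u \<notin> S \<Longrightarrow> (G has_derivative G' u) (at u)"
    and lim: "(G \<longlongrightarrow> 0) at_infinity"
  shows "continuous_on (- S) (\<lambda>u. G' u 1) \<Longrightarrow> integrable lborel (\<lambda>u. G' u 1)
           \<Longrightarrow> (\<integral>u. G' u 1 \<partial>lborel) = 0"
    and "continuous_on (- S) (\<lambda>u. G' u \<i>) \<Longrightarrow> integrable lborel (\<lambda>u. G' u \<i>)
           \<Longrightarrow> (\<integral>u. G' u \<i> \<partial>lborel) = 0"
proof -
  have tail: "filterlim (\<lambda>x. Complex x y) at_infinity at_top" "filterlim (\<lambda>x. Complex x y) at_infinity at_bot"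
    "filterlim (\<lambda>x. Complex y x) at_infinity at_top" "filterlim (\<lambda>x. Complex y x) at_infinity at_bot" for y
  proof -
    have *: "norm x \<le> norm (Complex x y)" "norm x \<le> norm (Complex y x)" for x
      using abs_Re_le_cmod[of "Complex x y"] abs_Im_le_cmod[of "Complex y x"] by simp_all
    have abs: "filterlim (\<lambda>x::real. norm x) at_top at_top" "filterlim (\<lambda>x::real. norm x) at_top at_bot"
      by (simp_all add: filterlim_abs_real filterlim_at_bot_mirror)
    show "filterlim (\<lambda>x. Complex x y) at_infinity at_top" "filterlim (\<lambda>x. Complex x y) at_infinity at_bot"
      "filterlim (\<lambda>x. Complex y x) at_infinity at_top" "filterlim (\<lambda>x. Complex y x) at_infinity at_bot"
      unfolding filterlim_at_infinity_conv_norm_at_top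
      by (rule filterlim_at_top_mono[OF _ always_eventually], rule abs, rule allI, rule *)+
  qed
  have lim': "((\<lambda>x. G (Complex x y)) \<longlongrightarrow> 0) at_top" "((\<lambda>x. G (Complex x y)) \<longlongrightarrow> 0) at_bot"
      "((\<lambda>x. G (Complex y x)) \<longlongrightarrow> 0) at_top" "((\<lambda>x. G (Complex y x)) \<longlongrightarrow> 0) at_bot" for y
    by (rule filterlim_compose[OF lim], rule tail)+
  have notin: "AE y in lborel. y \<notin> f ` S" for f :: "complex \<Rightarrow> real"
    using fin by (intro AE_not_in) (auto intro: countable_imp_null_set_lborel countable_finite)
  {
    assume c: "continuous_on (- S) (\<lambda>u. G' u 1)" and i: "integrable lborel (\<lambda>u. G' u 1)"
    have m: "(\<lambda>u. G' u 1) \<in> borel_measurable borel"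
      using i by (auto dest: borel_measurable_integrable)
    have i2: "integrable (lborel \<Otimes>\<^sub>M lborel) (\<lambda>(x, y). G' (Complex x y) 1)"
      using i integrable_complex_iff[OF m] by simp
    have "AE y in lborel. (\<integral>x. G' (Complex x y) 1 \<partial>lborel) = 0"
      using notin[of Im] lborel_pair.AE_integrable_snd[OF i2]
    proof eventually_elim
      case (elim y)
      have S: "Complex x y \<notin> S" for x using elim(1) by force
      show ?case
      proof (rule integral_derivative_vanishing_at_infinity)
        show "((\<lambda>x. G (Complex x y)) has_vector_derivative G' (Complex x y) 1) (at x)" for x
        proof -
          have "((\<lambda>x. Complex x y) has_derivative complex_of_real) (at x)"
            unfolding Complex_eq by (auto intro!: derivative_eq_intros)
          from diff_chain_at[OF this der[OF S]]
          have "((\<lambda>x. G (Complex x y)) has_derivative (\<lambda>h. G' (Complex x y) (of_real h))) (at x)"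
            by (simp add: o_def)
          moreover have "G' (Complex x y) (of_real h) = h *\<^sub>R G' (Complex x y) 1" for h
            using linear_cmul[OF has_derivative_linear[OF der[OF S[of x]]], of h 1] by (simp add: scaleR_conv_of_real)
          ultimately show ?thesis by (simp add: has_vector_derivative_def)
        qed
        show "continuous_on UNIV (\<lambda>x. G' (Complex x y) 1)"
          using S by (intro continuous_on_compose2[OF c]) (auto simp: Complex_eq intro!: continuous_intros)
      qed (use elim(2) lim' in auto)
    qed
    then show "(\<integral>u. G' u 1 \<partial>lborel) = 0"
      unfolding integral_complex_eq[OF m] lborel_pair.integral_snd[OF i2, symmetric]
      by (rule integral_eq_zero_AE)
  }
  {
    assume c: "continuous_on (- S) (\<lambda>u. G' u \<i>)" and i: "integrable lborel (\<lambda>u. G' u \<i>)"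
    have m: "(\<lambda>u. G' u \<i>) \<in> borel_measurable borel"
      using i by (auto dest: borel_measurable_integrable)
    have i2: "integrable (lborel \<Otimes>\<^sub>M lborel) (\<lambda>(x, y). G' (Complex x y) \<i>)"
      using i integrable_complex_iff[OF m] by simp
    have "AE x in lborel. (\<integral>y. G' (Complex x y) \<i> \<partial>lborel) = 0"
      using notin[of Re] lborel_pair.AE_integrable_fst[OF i2]
    proof eventually_elim
      case (elim x)
      have S: "Complex x y \<notin> S" for y using elim(1) by force
      show ?case
      proof (rule integral_derivative_vanishing_at_infinity)
        show "((\<lambda>y. G (Complex x y)) has_vector_derivative G' (Complex x y) \<i>) (at y)" for y
        proof -
          have "((\<lambda>y. Complex x y) has_derivative (\<lambda>h. \<i> * of_real h)) (at y)"
            unfolding Complex_eq by (auto intro!: derivative_eq_intros)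
          from diff_chain_at[OF this der[OF S]]
          have "((\<lambda>y. G (Complex x y)) has_derivative (\<lambda>h. G' (Complex x y) (\<i> * of_real h))) (at y)"
            by (simp add: o_def)
          moreover have "G' (Complex x y) (\<i> * of_real h) = h *\<^sub>R G' (Complex x y) \<i>" for h
            using linear_cmul[OF has_derivative_linear[OF der[OF S[of y]]], of h \<i>]
            by (simp add: scaleR_conv_of_real mult.commute)
          ultimately show ?thesis by (simp add: has_vector_derivative_def)
        qed
        show "continuous_on UNIV (\<lambda>y. G' (Complex x y) \<i>)"
          using S by (intro continuous_on_compose2[OF c]) (auto simp: Complex_eq intro!: continuous_intros)
      qed (use elim(2) lim' in auto)
    qed
    then show "(\<integral>u. G' u \<i> \<partial>lborel) = 0"
      unfolding integral_complex_eq[OF m] lborel_pair.integral_fst[OF i2, symmetric]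
      by (rule integral_eq_zero_AE)
  }
qed

section \<open>A Cauchy-Pompeiu formula\<close>

text \<open>All orders of growth are recorded as real powers of a distance: products become sums of
  exponents, and slack in the exponents absorbs logarithms.\<close>

lemma bigo_powr_mult:
  fixes f g r :: "'a \<Rightarrow> real"
  assumes "f \<in> O[F](\<lambda>u. r u powr x)" "g \<in> O[F](\<lambda>u. r u powr y)"
  shows "(\<lambda>u. f u * g u) \<in> O[F](\<lambda>u. r u powr (x + y))"
  using landau_o.big.mult[OF assms] by (simp add: powr_add)

lemma bigo_powr_at_mono:
  fixes p :: "'a::real_normed_vector"
  assumes "f \<in> O[at p](\<lambda>u. norm (u - p) powr x)" "y \<le> x"
  shows "f \<in> O[at p](\<lambda>u. norm (u - p) powr y)"
proof (rule landau_o.big_trans[OF assms(1)], rule bigoI[where c = 1])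
  have "\<forall>\<^sub>F u in at p. u \<in> ball p 1 \<and> u \<noteq> p"
    using eventually_at_ball[of 1 p UNIV] eventually_neq_at_within[of p p UNIV] by (auto elim: eventually_elim2)
  then show "\<forall>\<^sub>F u in at p. norm (norm (u - p) powr x) \<le> 1 * norm (norm (u - p) powr y)"
  proof eventually_elim
    case (elim u)
    then have "0 < norm (u - p)" "norm (u - p) \<le> 1"
      by (auto simp: dist_norm norm_minus_commute)
    from powr_mono'[OF assms(2) less_imp_le[OF this(1)] this(2)] show ?case by simp
  qed
qed

lemma bigo_powr_at_infinity_mono:
  assumes "f \<in> O[at_infinity](\<lambda>u::'a::real_normed_vector. norm u powr x)" "x \<le> y"
  shows "f \<in> O[at_infinity](\<lambda>u::'a. norm u powr y)"
proof (rule landau_o.big_trans[OF assms(1)], rule bigoI[where c = 1])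
  show "\<forall>\<^sub>F u::'a in at_infinity. norm (norm u powr x) \<le> 1 * norm (norm u powr y)"
    unfolding eventually_at_infinity
    by (rule exI[of _ 1]) (auto intro: powr_mono assms(2))
qed

lemma bigo_powr_0:
  fixes f :: "'a::real_normed_vector \<Rightarrow> real"
  shows "(f \<longlongrightarrow> c) (at p) \<Longrightarrow> f \<in> O[at p](\<lambda>u. norm (u - p) powr 0)"
    and "(f \<longlongrightarrow> c) at_infinity \<Longrightarrow> f \<in> O[at_infinity](\<lambda>u. norm u powr 0)"
proof -
  assume a: "(f \<longlongrightarrow> c) (at p)"
  have e: "\<forall>\<^sub>F u in at p. norm (u - p) powr 0 = 1"
    using eventually_neq_at_within[of p p UNIV] by eventually_elim simp
  have "((\<lambda>u. f u / norm (u - p) powr 0) \<longlongrightarrow> c) (at p)"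
    by (rule Lim_transform_eventually[OF a], rule eventually_mono[OF e]) simp
  then show "f \<in> O[at p](\<lambda>u. norm (u - p) powr 0)"
    by (rule bigoI_tendsto) (rule eventually_mono[OF e], simp)
next
  assume a: "(f \<longlongrightarrow> c) at_infinity"
  have e: "\<forall>\<^sub>F u::'a in at_infinity. norm u powr 0 = 1"
    unfolding eventually_at_infinity by (rule exI[of _ 1]) auto
  have "((\<lambda>u. f u / norm u powr 0) \<longlongrightarrow> c) at_infinity"
    by (rule Lim_transform_eventually[OF a], rule eventually_mono[OF e]) simp
  then show "f \<in> O[at_infinity](\<lambda>u. norm u powr 0)"
    by (rule bigoI_tendsto) (rule eventually_mono[OF e], simp)
qed

lemma norm_diff_bigo_at_infinity:
  fixes p :: "'a::real_normed_vector"
  shows "(\<lambda>u. norm (u - p)) \<in> O[at_infinity](\<lambda>u. norm u powr 1)"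
    and "(\<lambda>u. inverse (norm (u - p))) \<in> O[at_infinity](\<lambda>u. norm u powr (- 1))"
proof -
  have b: "\<forall>\<^sub>F u in at_infinity. 2 * norm p + 1 \<le> norm u"
    unfolding eventually_at_infinity by auto
  show "(\<lambda>u. norm (u - p)) \<in> O[at_infinity](\<lambda>u. norm u powr 1)"
  proof (rule bigoI[where c = 2], use b in eventually_elim)
    case (elim u)
    then have "norm u \<noteq> 0" "norm (u - p) \<le> 2 * norm u"
      using norm_ge_zero[of p] norm_triangle_ineq4[of u p] by linarith+
    then show ?case by simp
  qed
  show "(\<lambda>u. inverse (norm (u - p))) \<in> O[at_infinity](\<lambda>u. norm u powr (- 1))"
  proof (rule bigoI[where c = 2], use b in eventually_elim)
    case (elim u)
    then have u: "norm u > 0" using norm_ge_zero[of p] by linarith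
    have "norm u / 2 \<le> norm (u - p)" using elim norm_triangle_ineq2[of u p] by linarith
    then have "inverse (norm (u - p)) \<le> inverse (norm u / 2)" using u by (intro le_imp_inverse_le) auto
    then show ?case using u by (simp add: powr_minus inverse_eq_divide)
  qed
qed

text \<open>Supplies the first-order zero of F at a pole of the kernel, which offsets one order of
  the double pole in the kernel's derivative.\<close>

lemma has_derivative_bigo:
  fixes f :: "'a::real_normed_vector \<Rightarrow> 'b::real_normed_vector"
  assumes "(f has_derivative f') (at p)"
  shows "(\<lambda>u. norm (f u - f p)) \<in> O[at p](\<lambda>u. norm (u - p) powr 1)"
proof -
  obtain K where K: "\<And>h. norm (f' h) \<le> norm h * K"
    using bounded_linear.bounded[OF has_derivative_bounded_linear[OF assms]] by auto
  have "((\<lambda>u. norm (f u - f p - f' (u - p)) / norm (u - p)) \<longlongrightarrow> 0) (at p)"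
    using assms by (simp add: has_derivative_iff_norm)
  then have "\<forall>\<^sub>F u in at p. norm (f u - f p - f' (u - p)) / norm (u - p) < 1"
    by (rule order_tendstoD) simp
  then have "\<forall>\<^sub>F u in at p. norm (f u - f p - f' (u - p)) / norm (u - p) < 1 \<and> u \<noteq> p"
    using eventually_neq_at_within[of p p UNIV] by (rule eventually_conj)
  then show ?thesis
  proof (intro bigoI[where c = "1 + K"], eventually_elim)
    case (elim u)
    then have pos: "norm (u - p) > 0" by simp
    have "norm (f u - f p - f' (u - p)) < norm (u - p)"
      using elim unfolding pos_divide_less_eq[OF pos] by simp
    moreover have "norm (f u - f p) \<le> norm (f u - f p - f' (u - p)) + norm (f' (u - p))"
      by (metis diff_add_cancel norm_triangle_ineq)
    ultimately show ?case using K[of "u - p"] elim by (simp add: algebra_simps)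
  qed
qed

lemma bigo_tendsto_0:
  fixes f g :: "'a \<Rightarrow> real"
  assumes "f \<in> O[F](g)" "(g \<longlongrightarrow> 0) F"
  shows "(f \<longlongrightarrow> 0) F"
proof -
  obtain c where "\<forall>\<^sub>F x in F. norm (f x) \<le> c * norm (g x)" using landau_o.bigE[OF assms(1)] by auto
  moreover have "((\<lambda>x. c * norm (g x)) \<longlongrightarrow> 0) F"
    using tendsto_mult_right_zero[OF tendsto_norm_zero[OF assms(2)]] by simp
  ultimately show ?thesis by (rule Lim_null_comparison)
qed

text \<open>The partial derivatives of G, the product of F and the kernel, are integrable: the zeros
  of F reduce the double poles at p and q to simple ones, and the decay of order -2 of the kernel
  beats the growth of F. Both integrals over the plane then vanish, and the kernel is holomorphic,
  so it passes through the d-bar operator.\<close>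

lemma Cauchy_Pompeiu_zero:
  fixes F :: "complex \<Rightarrow> complex"
  assumes fin: "finite S" and pq: "p \<noteq> q" "p \<notin> S" "q \<notin> S"
    and der: "\<And>u. u \<notin> S \<Longrightarrow> (F has_derivative F' u) (at u)"
    and cont: "\<And>h. continuous_on (- S) (\<lambda>u. F' u h)"
    and near: "\<And>s. s \<in> S \<Longrightarrow> (\<lambda>u. norm (F u)) \<in> O[at s](\<lambda>u. norm (u - s) powr (-1/2))"
      "\<And>s h. s \<in> S \<Longrightarrow> (\<lambda>u. norm (F' u h)) \<in> O[at s](\<lambda>u. norm (u - s) powr (-3/2))"
    and inf: "(\<lambda>u. norm (F u)) \<in> O[at_infinity](\<lambda>u. norm u powr (1/2))"
      "\<And>h. (\<lambda>u. norm (F' u h)) \<in> O[at_infinity](\<lambda>u. norm u powr (-1/2))"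
    and zero: "F p = 0" "F q = 0"
  shows "has_bochner_integral lborel (\<lambda>u. (F' u 1 + \<i> * F' u \<i>) * (1 / (u - p) - 1 / (u - q))) 0"
proof -
  define \<kappa> where "\<kappa> u = 1 / (u - p) - 1 / (u - q)" for u
  define \<kappa>' where "\<kappa>' u = - 1 / (u - p)^2 + 1 / (u - q)^2" for u
  define G where "G u = F u * \<kappa> u" for u
  define G' where "G' u h = F u * (\<kappa>' u * h) + F' u h * \<kappa> u" for u h
  define T where "T = insert p (insert q S)"
  define a where "a u = inverse (norm (u - p))" for u
  define b where "b u = inverse (norm (u - q))" for u
  have nk: "norm (\<kappa> u) = norm (p - q) * (a u * b u)" if "u \<notin> T" for u
  proof -
    have "\<kappa> u = (p - q) / ((u - p) * (u - q))" using that by (simp add: T_def \<kappa>_def divide_simps)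
    then show ?thesis by (simp add: a_def b_def norm_divide norm_mult inverse_eq_divide)
  qed
  \<comment> \<open>Combining the two double poles exhibits decay of order -3 at infinity; bounded
    separately, each has only order -2.\<close>
  have nk': "norm (\<kappa>' u) \<le> norm (p - q) * ((a u * b u) * b u + (a u * b u) * a u)" if "u \<notin> T" for u
  proof -
    have "\<kappa>' u = - (p - q) * (1 / ((u - p) * (u - q) * (u - q)) + 1 / ((u - p) * (u - q) * (u - p)))"
      using that by (simp add: T_def \<kappa>'_def divide_simps power2_eq_square) (simp add: algebra_simps)
    then have "norm (\<kappa>' u) = norm (p - q) * norm (1 / ((u - p) * (u - q) * (u - q)) + 1 / ((u - p) * (u - q) * (u - p)))"
      by (simp add: norm_mult norm_minus_commute)
    also have "\<dots> \<le> norm (p - q) * (norm (1 / ((u - p) * (u - q) * (u - q))) + norm (1 / ((u - p) * (u - q) * (u - p))))"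
      by (intro mult_left_mono norm_triangle_ineq) auto
    finally show ?thesis by (simp add: a_def b_def norm_divide norm_mult inverse_eq_divide)
  qed
  \<comment> \<open>A majorant of |G'| built from |F|, |F'|, \<open>a\<close> and \<open>b\<close>
    alone, so that its order at any point can be read off their exponents.\<close>
  define m where "m h u = (norm (p - q) * norm h) * (norm (F u) * ((a u * b u) * b u) + norm (F u) * ((a u * b u) * a u))
      + norm (p - q) * (norm (F' u h) * (a u * b u))" for h u
  have ab0: "a u \<ge> 0" "b u \<ge> 0" for u by (auto simp: a_def b_def)
  then have m0: "m h u \<ge> 0" for h u by (simp add: m_def)
  have G'm: "norm (G' u h) \<le> m h u" if "u \<notin> T" for u h
  proof -
    have "norm (G' u h) \<le> norm (F u) * (norm (\<kappa>' u) * norm h) + norm (F' u h) * norm (\<kappa> u)"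
      unfolding G'_def by (rule order_trans[OF norm_triangle_ineq]) (simp add: norm_mult)
    also have "\<dots> \<le> norm (F u) * ((norm (p - q) * ((a u * b u) * b u + (a u * b u) * a u)) * norm h)
        + norm (F' u h) * norm (\<kappa> u)"
      using nk'[OF that] by (intro add_mono mult_left_mono mult_right_mono) auto
    also have "\<dots> = m h u" by (simp add: m_def nk[OF that] algebra_simps)
    finally show ?thesis .
  qed
  have dG: "(G has_derivative G' u) (at u)" if "u \<notin> T" for u
  proof -
    have "(\<kappa> has_field_derivative \<kappa>' u) (at u)"
      using that unfolding \<kappa>_def \<kappa>'_def T_def
      by (auto intro!: derivative_eq_intros simp: power2_eq_square)
    then have "(\<kappa> has_derivative (\<lambda>h. \<kappa>' u * h)) (at u)"
      by (simp add: has_field_derivative_def)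
    from has_derivative_mult[OF der this] that show ?thesis
      by (simp add: G_def[abs_def] G'_def[abs_def] T_def)
  qed
  have cG: "continuous_on (- T) (\<lambda>u. G' u h)" for h
  proof -
    have "continuous_on (- T) F"
      by (rule continuous_at_imp_continuous_on) (use der has_derivative_continuous in \<open>fastforce simp: T_def\<close>)
    moreover have "continuous_on (- T) (\<lambda>u. F' u h)"
      by (rule continuous_on_subset[OF cont]) (auto simp: T_def)
    ultimately show ?thesis
      unfolding G'_def \<kappa>_def \<kappa>'_def by (intro continuous_intros) (auto simp: T_def)
  qed
  have finT: "finite T" using fin by (simp add: T_def)
  have abI: "a \<in> O[at_infinity](\<lambda>u. norm u powr (-1))" "b \<in> O[at_infinity](\<lambda>u. norm u powr (-1))"
    unfolding a_def b_def by (rule norm_diff_bigo_at_infinity)+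
  have ab_near: "a \<in> O[at s](\<lambda>u. norm (u - s) powr 0)" if "s \<noteq> p" for s
    using that unfolding a_def by (intro bigo_powr_0(1)[where c = "inverse (norm (s - p))"] tendsto_intros) auto
  have b_near: "b \<in> O[at s](\<lambda>u. norm (u - s) powr 0)" if "s \<noteq> q" for s
    using that unfolding b_def by (intro bigo_powr_0(1)[where c = "inverse (norm (s - q))"] tendsto_intros) auto
  have a_p: "a \<in> O[at p](\<lambda>u. norm (u - p) powr (-1))"
    unfolding a_def by (rule bigoI[where c = 1]) (simp add: powr_minus)
  have b_q: "b \<in> O[at q](\<lambda>u. norm (u - q) powr (-1))"
    unfolding b_def by (rule bigoI[where c = 1]) (simp add: powr_minus)
  have m_inf: "m h \<in> O[at_infinity](\<lambda>u. norm u powr (-5/2))" for h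
  proof -
    have ab: "(\<lambda>u. a u * b u) \<in> O[at_infinity](\<lambda>u. norm u powr (-2))"
      using bigo_powr_mult[OF abI] by simp
    have o: "(\<lambda>u. norm (F u) * ((a u * b u) * b u)) \<in> O[at_infinity](\<lambda>u. norm u powr (-5/2))"
      "(\<lambda>u. norm (F u) * ((a u * b u) * a u)) \<in> O[at_infinity](\<lambda>u. norm u powr (-5/2))"
      "(\<lambda>u. norm (F' u h) * (a u * b u)) \<in> O[at_infinity](\<lambda>u. norm u powr (-5/2))"
      using bigo_powr_mult[OF inf(1) bigo_powr_mult[OF ab abI(2)]]
        bigo_powr_mult[OF inf(1) bigo_powr_mult[OF ab abI(1)]]
        bigo_powr_mult[OF inf(2)[of h] ab] by simp_all
    from sum_in_bigo(1)[OF o(1,2)] o(3) show ?thesis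
      unfolding m_def by (intro sum_in_bigo(1)) simp_all
  qed
  \<comment> \<open>At p and q the exponents are x = 1, y = 0, with one of \<open>a\<close>,
    \<open>b\<close> of order -1 and the other of order 0. At points of S they are x = -1/2, y =
    -3/2, with both of order 0. The worst sum is -3/2.\<close>
  have m_near: "m h \<in> O[at s](\<lambda>u. norm (u - s) powr (-3/2))"
    if f: "(\<lambda>u. norm (F u)) \<in> O[at s](\<lambda>u. norm (u - s) powr x)"
      "(\<lambda>u. norm (F' u h)) \<in> O[at s](\<lambda>u. norm (u - s) powr y)"
      and ab: "a \<in> O[at s](\<lambda>u. norm (u - s) powr \<alpha>)" "b \<in> O[at s](\<lambda>u. norm (u - s) powr \<beta>)"
      and le: "-3/2 \<le> x + (\<alpha> + \<beta> + \<beta>)" "-3/2 \<le> x + (\<alpha> + \<beta> + \<alpha>)" "-3/2 \<le> y + (\<alpha> + \<beta>)" for s h x y \<alpha> \<beta>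
  proof -
    note ab' = bigo_powr_mult[OF ab]
    have o: "(\<lambda>u. norm (F u) * ((a u * b u) * b u)) \<in> O[at s](\<lambda>u. norm (u - s) powr (-3/2))"
      "(\<lambda>u. norm (F u) * ((a u * b u) * a u)) \<in> O[at s](\<lambda>u. norm (u - s) powr (-3/2))"
      "(\<lambda>u. norm (F' u h) * (a u * b u)) \<in> O[at s](\<lambda>u. norm (u - s) powr (-3/2))"
      using bigo_powr_at_mono[OF bigo_powr_mult[OF f(1) bigo_powr_mult[OF ab' ab(2)]] le(1)]
        bigo_powr_at_mono[OF bigo_powr_mult[OF f(1) bigo_powr_mult[OF ab' ab(1)]] le(2)]
        bigo_powr_at_mono[OF bigo_powr_mult[OF f(2) ab'] le(3)] by simp_all
    from sum_in_bigo(1)[OF o(1,2)] o(3) show ?thesis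
      unfolding m_def by (intro sum_in_bigo(1)) simp_all
  qed
  have F'_near: "(\<lambda>u. norm (F' u h)) \<in> O[at s](\<lambda>u. norm (u - s) powr 0)" if "s \<notin> S" for s h
  proof -
    have "isCont (\<lambda>u. F' u h) s"
      using cont fin that by (intro continuous_on_interior[OF cont]) (simp add: finite_imp_closed open_Compl interior_open)
    then show ?thesis by (intro bigo_powr_0(1)[OF tendsto_norm]) (auto simp: isCont_def)
  qed
  have m_T: "m h \<in> O[at s](\<lambda>u. norm (u - s) powr (-3/2))" if sT: "s \<in> T" for s h
  proof -
    consider "s = p" | "s = q" | "s \<in> S" "s \<noteq> p" "s \<noteq> q" using sT pq by (auto simp: T_def)
    then show ?thesis
    proof cases
      case 1
      have "(\<lambda>u. norm (F u)) \<in> O[at p](\<lambda>u. norm (u - p) powr 1)"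
        using has_derivative_bigo[OF der[OF pq(2)]] zero by simp
      from m_near[OF this F'_near[OF pq(2)] a_p b_near[OF pq(1)], of h] show ?thesis by (simp add: 1)
    next
      case 2
      have "(\<lambda>u. norm (F u)) \<in> O[at q](\<lambda>u. norm (u - q) powr 1)"
        using has_derivative_bigo[OF der[OF pq(3)]] zero by simp
      from m_near[OF this F'_near[OF pq(3)] ab_near[OF pq(1)[symmetric]] b_q, of h] show ?thesis by (simp add: 2)
    next
      case 3
      from m_near[OF near(1) near(2) ab_near[OF 3(2)] b_near[OF 3(3)], OF 3(1) 3(1), of h]
      show ?thesis by simp
    qed
  qed
  have evT: "\<forall>\<^sub>F u in at s. u \<notin> T" for s
  proof -
    have "open (- (T - {s}))" using finT by (intro open_Compl finite_imp_closed finite_Diff)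
    then show ?thesis unfolding eventually_at_topological by (intro exI[of _ "- (T - {s})"]) auto
  qed
  have evT_inf: "\<forall>\<^sub>F u in at_infinity. u \<notin> T"
  proof -
    obtain K where "\<And>u. u \<in> T \<Longrightarrow> norm u \<le> K" using finite_imp_bounded[OF finT] by (auto simp: bounded_iff)
    then show ?thesis unfolding eventually_at_infinity by (intro exI[of _ "K + 1"]) force
  qed
  have G'_bigo: "(\<lambda>u. norm (G' u h)) \<in> O[A](\<lambda>u. m h u)" if "\<forall>\<^sub>F u in A. u \<notin> T" for A h
    by (rule bigoI[where c = 1], rule eventually_mono[OF that]) (use G'm m0 in auto)
  have intG: "integrable lborel (\<lambda>u. G' u h)" for h
  proof (rule integrable_complex_singularities[OF finT cG, where \<alpha> = "3/2" and \<beta> = "5/2"])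
    show "(\<lambda>u. norm (G' u h)) \<in> O[at s](\<lambda>u. norm (u - s) powr - (3/2))" if "s \<in> T" for s
      using landau_o.big_trans[OF G'_bigo[OF evT] m_T[OF that]] by simp
    show "(\<lambda>u. norm (G' u h)) \<in> O[at_infinity](\<lambda>u. norm u powr - (5/2))"
      using landau_o.big_trans[OF G'_bigo[OF evT_inf] m_inf] by simp
  qed auto
  have "(\<lambda>u. norm (G u)) \<in> O[at_infinity](\<lambda>u. norm u powr (-3/2))"
  proof -
    have "(\<lambda>u. norm (G u)) \<in> O[at_infinity](\<lambda>u. norm (F u) * (a u * b u))"
      by (rule bigoI[where c = "norm (p - q)"], rule eventually_mono[OF evT_inf])
        (use ab0 in \<open>simp add: G_def norm_mult nk abs_mult\<close>)
    also have "(\<lambda>u. norm (F u) * (a u * b u)) \<in> O[at_infinity](\<lambda>u. norm u powr (-3/2))"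
      using bigo_powr_mult[OF inf(1) bigo_powr_mult[OF abI]] by simp
    finally show ?thesis .
  qed
  moreover have "((\<lambda>u::complex. norm u powr (-3/2)) \<longlongrightarrow> 0) at_infinity"
    by (rule tendsto_neg_powr[OF _ filterlim_norm_at_top]) simp
  ultimately have "((\<lambda>u. norm (G u)) \<longlongrightarrow> 0) at_infinity"
    by (rule bigo_tendsto_0)
  then have limG: "(G \<longlongrightarrow> 0) at_infinity" by (simp add: tendsto_norm_zero_iff)
  have "(\<integral>u. G' u 1 \<partial>lborel) = 0" "(\<integral>u. G' u \<i> \<partial>lborel) = 0"
    using integral_partials_vanishing_at_infinity[OF finT dG limG] cG intG by simp_all
  then have "has_bochner_integral lborel (\<lambda>u. G' u 1 + \<i> * G' u \<i>) (0 + \<i> * 0)"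
    using intG by (intro has_bochner_integral_add has_bochner_integral_mult_right)
      (auto simp: has_bochner_integral_iff)
  \<comment> \<open>The terms with \<open>\<kappa>'\<close> drop out: they are complex linear in the
    direction, and 1 + i * i = 0.\<close>
  moreover have "G' u 1 + \<i> * G' u \<i> = (F' u 1 + \<i> * F' u \<i>) * (1 / (u - p) - 1 / (u - q))" for u
    by (simp add: G'_def \<kappa>_def algebra_simps)
  ultimately show ?thesis by simp
qed
lemma has_bochner_integral_gaussian_complex:
  "has_bochner_integral lborel (\<lambda>u::complex. exp (- (norm (u - p))\<^sup>2)) pi"
proof -
  have "has_bochner_integral lborel (\<lambda>x::real. exp (- x\<^sup>2)) (sqrt pi)"
    using has_bochner_integral_even_function[OF gaussian_moment_0] by simp
  then have I: "integrable lborel (\<lambda>x::real. exp (- x\<^sup>2))" and "(\<integral>x. exp (- x\<^sup>2) \<partial>(lborel::real measure)) = sqrt pi"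
    by (auto simp: has_bochner_integral_iff)
  with has_bochner_integral_complex_prod[OF I I]
  have *: "has_bochner_integral lborel (\<lambda>u::complex. exp (- (norm u)\<^sup>2)) pi"
    by (simp add: cmod_power2 exp_add[symmetric] algebra_simps)
  show ?thesis
    using integrable_lborel_shift[of "\<lambda>u::complex. exp (- (norm u)\<^sup>2)" p] *
    by (simp add: has_bochner_integral_iff)
qed

text \<open>Subtracting from \<open>F\<close> a constant and a multiple of
  \<open>h(u) = exp(-|u - p|\<^sup>2)(u - q)/(p - q)\<close> makes it vanish at \<open>p\<close> and \<open>q\<close>, and the product of
  \<open>\<partial>h/\<partial>u\<close>-bar with the kernel is the Gaussian \<open>-exp(-|u - p|\<^sup>2)\<close>.\<close>

lemma Cauchy_Pompeiu_difference:
  fixes F :: "complex \<Rightarrow> complex"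
  assumes fin: "finite S" and pq: "p \<noteq> q" "p \<notin> S" "q \<notin> S"
    and der: "\<And>u. u \<notin> S \<Longrightarrow> (F has_derivative F' u) (at u)"
    and cont: "\<And>h. continuous_on (- S) (\<lambda>u. F' u h)"
    and near: "\<And>s. s \<in> S \<Longrightarrow> (\<lambda>u. norm (F u)) \<in> O[at s](\<lambda>u. norm (u - s) powr (-1/2))"
      "\<And>s h. s \<in> S \<Longrightarrow> (\<lambda>u. norm (F' u h)) \<in> O[at s](\<lambda>u. norm (u - s) powr (-3/2))"
    and inf: "(\<lambda>u. norm (F u)) \<in> O[at_infinity](\<lambda>u. norm u powr (1/2))"
      "\<And>h. (\<lambda>u. norm (F' u h)) \<in> O[at_infinity](\<lambda>u. norm u powr (-1/2))"
  shows "has_bochner_integral lborel (\<lambda>u. (F' u 1 + \<i> * F' u \<i>) * (1 / (u - p) - 1 / (u - q)))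
           (2 * complex_of_real pi * (F q - F p))"
proof -
  define e where "e u = exp (- (norm (u - p))\<^sup>2)" for u
  define c where "c = (F p - F q) / (p - q)"
  define H where "H u = c * (of_real (e u) * (u - q))" for u
  define H' where "H' u h = c * (of_real (e u) * h + of_real (e u * (- (2 * ((u - p) \<bullet> h)))) * (u - q))" for u h
  let ?K = "\<lambda>u. 1 / (u - p) - 1 / (u - q)"
  have dH: "(H has_derivative H' u) (at u)" for u
    unfolding H_def[abs_def] H'_def[abs_def] e_def
    by (auto intro!: derivative_eq_intros simp: power2_norm_eq_inner inner_commute algebra_simps)
  have cH: "continuous_on A (\<lambda>u. H' u h)" for A h
    unfolding H'_def e_def by (intro continuous_intros)
  have pow: "(\<lambda>u. norm (u - p)) \<in> O[at_infinity](\<lambda>u. norm u powr 1)"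
    "(\<lambda>u. norm (u - q)) \<in> O[at_infinity](\<lambda>u. norm u powr 1)" by (rule norm_diff_bigo_at_infinity)+
  \<comment> \<open>The exponent -3 leaves order -1 after the two linear factors in
    \<open>H'\<close>, within the required -1/2.\<close>
  have eO: "e \<in> O[at_infinity](\<lambda>u. norm u powr (-3))"
  proof -
    let ?i = "\<lambda>u. inverse (norm (u - p))"
    have "e \<in> O[at_infinity](\<lambda>u. ?i u * (?i u * ?i u))"
    proof (rule landau_o.big.compose[of "\<lambda>t::real. exp (- t\<^sup>2)" at_top "\<lambda>t. inverse t * (inverse t * inverse t)" "\<lambda>u. norm (u - p)", folded e_def])
      show "(\<lambda>t::real. exp (- t\<^sup>2)) \<in> O(\<lambda>t. inverse t * (inverse t * inverse t))" by real_asymp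
      have "filterlim (\<lambda>u. u - p) at_infinity at_infinity"
        using tendsto_add_filterlim_at_infinity'[OF filterlim_ident tendsto_const[of "- p"]] by simp
      then show "filterlim (\<lambda>u. norm (u - p)) at_top at_infinity"
        by (simp add: filterlim_at_infinity_conv_norm_at_top)
    qed
    also have "(\<lambda>u. ?i u * (?i u * ?i u)) \<in> O[at_infinity](\<lambda>u. norm u powr (-3))"
      using bigo_powr_mult[OF norm_diff_bigo_at_infinity(2) bigo_powr_mult[OF norm_diff_bigo_at_infinity(2) norm_diff_bigo_at_infinity(2)]]
      by simp
    finally show ?thesis .
  qed
  have H_inf: "(\<lambda>u. norm (H u)) \<in> O[at_infinity](\<lambda>u. norm u powr (1/2))"
  proof -
    have "(\<lambda>u. e u * norm (u - q)) \<in> O[at_infinity](\<lambda>u. norm u powr (1/2))"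
      by (rule bigo_powr_at_infinity_mono[OF bigo_powr_mult[OF eO pow(2)]]) simp
    then show ?thesis by (simp add: H_def norm_mult e_def)
  qed
  have H'_inf: "(\<lambda>u. norm (H' u h)) \<in> O[at_infinity](\<lambda>u. norm u powr (-1/2))" for h
  proof -
    have e0: "e u \<ge> 0" for u by (simp add: e_def)
    have "(\<lambda>u. norm (H' u h)) \<in> O[at_infinity](\<lambda>u. e u + e u * (norm (u - p) * norm (u - q)))"
    proof (rule bigoI[where c = "norm c * (norm h * 2)"], rule always_eventually, rule allI)
      fix u
      have "\<bar>(u - p) \<bullet> h\<bar> * norm (u - q) \<le> norm (u - p) * norm h * norm (u - q)"
        by (intro mult_right_mono Cauchy_Schwarz_ineq2) simp
      from mult_left_mono[OF this e0[of u]]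
      have "norm (of_real (e u) * h + of_real (e u * (- (2 * ((u - p) \<bullet> h)))) * (u - q))
          \<le> e u * norm h + e u * (2 * (norm (u - p) * norm h)) * norm (u - q)"
        using e0[of u] by (intro order_trans[OF norm_triangle_ineq] add_mono)
          (auto simp: norm_mult abs_mult mult_ac)
      also have "\<dots> \<le> (norm h * 2) * (e u + e u * (norm (u - p) * norm (u - q)))"
        using e0[of u] by (simp add: algebra_simps)
      finally have "norm (H' u h) \<le> norm c * ((norm h * 2) * (e u + e u * (norm (u - p) * norm (u - q))))"
        unfolding H'_def norm_mult[of c] by (rule mult_left_mono) simp
      then show "norm (norm (H' u h)) \<le> norm c * (norm h * 2) * norm (e u + e u * (norm (u - p) * norm (u - q)))"
        using e0[of u] by (simp add: mult.assoc)
    qed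
    also have "(\<lambda>u. e u + e u * (norm (u - p) * norm (u - q))) \<in> O[at_infinity](\<lambda>u. norm u powr (-1/2))"
      using bigo_powr_at_infinity_mono[OF eO, of "-1/2"]
        bigo_powr_at_infinity_mono[OF bigo_powr_mult[OF eO bigo_powr_mult[OF pow]], of "-1/2"]
      by (intro sum_in_bigo(1)) simp_all
    finally show ?thesis .
  qed
  have reg: "(\<lambda>u. norm (f u)) \<in> O[at s](\<lambda>u. norm (u - s) powr x)"
    if "isCont f s" "x \<le> 0" for f :: "complex \<Rightarrow> complex" and s x
    using that by (intro bigo_powr_at_mono[OF bigo_powr_0(1)[OF tendsto_norm]]) (auto simp: isCont_def)
  have sub: "(\<lambda>u. norm (f u - g u)) \<in> O[A](k)"
    if "(\<lambda>u. norm (f u)) \<in> O[A](k)" "(\<lambda>u. norm (g u)) \<in> O[A](k)"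
    for f g :: "complex \<Rightarrow> complex" and k A
    by (rule landau_o.big_trans[OF _ sum_in_bigo(1)[OF that]])
      (auto intro!: bigoI[where c = 1] always_eventually norm_triangle_ineq4)
  have "has_bochner_integral lborel (\<lambda>u. ((F' u 1 - H' u 1) + \<i> * (F' u \<i> - H' u \<i>)) * ?K u) 0"
  proof (rule Cauchy_Pompeiu_zero[OF fin pq, where F = "\<lambda>u. F u - F q - H u" and F' = "\<lambda>u h. F' u h - H' u h"])
    show "((\<lambda>u. F u - F q - H u) has_derivative (\<lambda>h. F' u h - H' u h)) (at u)" if "u \<notin> S" for u
      using has_derivative_diff[OF has_derivative_diff[OF der[OF that] has_derivative_const] dH] by simp
    show "continuous_on (- S) (\<lambda>u. F' u h - H' u h)" for h
      by (intro continuous_intros cont cH)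
    show "(\<lambda>u. norm (F u - F q - H u)) \<in> O[at s](\<lambda>u. norm (u - s) powr (-1/2))" if "s \<in> S" for s
      by (intro sub near(1) that reg has_derivative_continuous[OF dH]) auto
    show "(\<lambda>u. norm (F' u h - H' u h)) \<in> O[at s](\<lambda>u. norm (u - s) powr (-3/2))" if "s \<in> S" for s h
      using cH[of UNIV h] by (intro sub near(2) that reg) (auto simp: continuous_on_eq_continuous_at)
    show "(\<lambda>u. norm (F u - F q - H u)) \<in> O[at_infinity](\<lambda>u. norm u powr (1/2))"
      by (intro sub inf(1) H_inf bigo_powr_at_infinity_mono[OF bigo_powr_0(2)[OF tendsto_const]]) auto
    show "(\<lambda>u. norm (F' u h - H' u h)) \<in> O[at_infinity](\<lambda>u. norm u powr (-1/2))" for h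
      by (intro sub inf(2) H'_inf)
    show "F p - F q - H p = 0" "F q - F q - H q = 0"
      using pq by (auto simp: H_def c_def e_def)
  qed
  moreover have "has_bochner_integral lborel (\<lambda>u. (H' u 1 + \<i> * H' u \<i>) * ?K u) (- (2 * (F p - F q)) * of_real pi)"
  proof -
    have "has_bochner_integral lborel (\<lambda>u. - (2 * (F p - F q)) * of_real (e u)) (- (2 * (F p - F q)) * of_real pi)"
      using has_bochner_integral_gaussian_complex[of p]
      by (intro has_bochner_integral_mult_right has_bochner_integral_of_real) (auto simp: e_def[abs_def])
    \<comment> \<open>At p and q themselves the factors u - p and u - q do not cancel against the
      poles, so the equality holds almost everywhere only.\<close>
    moreover have "AE u in lborel. - (2 * (F p - F q)) * of_real (e u) = (H' u 1 + \<i> * H' u \<i>) * ?K u"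
    proof -
      have "AE u in lborel. u \<notin> {p, q}"
        by (intro AE_not_in) (auto intro: countable_imp_null_set_lborel)
      then show ?thesis
      proof eventually_elim
        case (elim u)
        have "H' u 1 + \<i> * H' u \<i> = - 2 * c * of_real (e u) * (u - q) * (of_real (Re (u - p)) + \<i> * of_real (Im (u - p)))"
          by (simp add: H'_def inner_complex_def algebra_simps)
        also have "of_real (Re (u - p)) + \<i> * of_real (Im (u - p)) = u - p"
          by (rule complex_eq[symmetric])
        finally have "H' u 1 + \<i> * H' u \<i> = - 2 * c * of_real (e u) * (u - q) * (u - p)" .
        then show ?case using elim pq by (simp add: c_def divide_simps)
      qed
    qed
    ultimately show ?thesis
      by (subst (asm) has_bochner_integral_cong_AE) (auto simp: H'_def e_def)
  qed
  ultimately have "has_bochner_integral lborel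
      (\<lambda>u. ((F' u 1 - H' u 1) + \<i> * (F' u \<i> - H' u \<i>)) * ?K u + (H' u 1 + \<i> * H' u \<i>) * ?K u)
      (0 + - (2 * (F p - F q)) * of_real pi)"
    by (rule has_bochner_integral_add)
  then show ?thesis by (simp add: algebra_simps)
qed

section \<open>The Bloch-Wigner dilogarithm\<close>

lemma has_derivative_ln_norm:
  fixes z :: complex
  assumes "z \<noteq> 0"
  shows "((\<lambda>w. ln (norm w)) has_derivative (\<lambda>h. Re (h / z))) (at z)"
proof -
  have "((\<lambda>w. ln (norm w)) has_derivative (\<lambda>h. (h \<bullet> sgn z) / norm z)) (at z)"
    using assms by (auto intro!: derivative_eq_intros has_derivative_norm simp: divide_inverse mult.commute)
  moreover have "(h \<bullet> sgn z) / norm z = Re (h / z)" for h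
  proof -
    have n: "Re z * Re z + Im z * Im z = norm z * norm z"
      using cmod_power2[of z] by (simp add: power2_eq_square)
    show ?thesis
      using assms by (simp add: sgn_div_norm inner_complex_def Re_divide power2_eq_square n divide_simps)
  qed
  ultimately show ?thesis by simp
qed

definition slit :: "complex set" where "slit = {z. 1 - z \<notin> \<real>\<^sub>\<le>\<^sub>0}"

lemma slit_iff: "z \<in> slit \<longleftrightarrow> Im z \<noteq> 0 \<or> Re z < 1"
  by (auto simp: slit_def complex_nonpos_Reals_iff)

lemma open_slit: "open slit"
proof -
  have eq: "slit = {z. Im z \<noteq> 0} \<union> {z. Re z < 1}" by (auto simp: slit_iff)
  show ?thesis
    unfolding eq by (intro open_Un open_Collect_neq open_Collect_less continuous_intros)
qed

lemma scale_in_slit: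
  assumes "z \<in> slit" "0 \<le> t" "t \<le> 1"
  shows "of_real t * z \<in> slit"
proof (cases "Im z = 0")
  case True
  then have "Re z < 1" using assms by (simp add: slit_iff)
  then have "t * Re z < 1"
  proof (cases "Re z \<le> 0")
    case True
    then show ?thesis using assms by (smt (verit) mult_nonneg_nonpos)
  next
    case False
    then have "t * Re z \<le> 1 * Re z" using assms by (intro mult_right_mono) auto
    then show ?thesis using \<open>Re z < 1\<close> by simp
  qed
  then show ?thesis by (simp add: slit_iff)
qed (use assms in \<open>auto simp: slit_iff\<close>)

text \<open>\<open>f\<close> is -Ln(1 - z)/z with its removable singularity at 0 filled in. The slit
  plane is star-shaped about 0, so \<open>f\<close> has a primitive P there, and the integral along
  the segment that defines \<open>Li2\<close> equals P z - P 0.\<close>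

lemma Li2_on_slit:
  defines "f \<equiv> \<lambda>z. if z = 0 then 1 else - Ln (1 - z) / z"
  assumes z: "z \<in> slit"
  shows Li2_has_field_derivative: "(Li2 has_field_derivative f z) (at z)"
    and Li2_integrable: "(\<lambda>t. Ln (1 - of_real t * z) / of_real t) integrable_on {0..1}"
proof -
  let ?g = "\<lambda>z. - Ln (1 - z)"
  have "?g holomorphic_on slit"
    by (intro holomorphic_intros) (auto simp: slit_def)
  moreover have 0: "0 \<in> slit" by (simp add: slit_iff)
  ultimately have "(\<lambda>z. if z = 0 then deriv ?g 0 else (?g z - ?g 0) / (z - 0)) holomorphic_on slit"
    by (intro pole_lemma) (simp_all add: open_slit interior_open)
  moreover have "(?g has_field_derivative 1) (at 0)"
    by (auto intro!: derivative_eq_intros)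
  then have "deriv ?g 0 = 1" by (rule DERIV_imp_deriv)
  ultimately have hol: "f holomorphic_on slit" by (simp add: f_def if_distrib cong: if_cong)
  have star: "starlike slit"
    unfolding starlike_def
  proof (intro bexI[OF _ 0] ballI subsetI)
    fix x y assume "x \<in> slit" "y \<in> closed_segment 0 x"
    then show "y \<in> slit"
      by (auto simp: closed_segment_def scaleR_conv_of_real intro: scale_in_slit)
  qed
  have "\<exists>g. \<forall>x \<in> slit. (g has_field_derivative f x) (at x)"
    using hol open_slit
    by (intro holomorphic_starlike_primitive[OF _ star open_slit finite.emptyI])
      (auto intro: holomorphic_on_imp_continuous_on holomorphic_on_imp_differentiable_at)
  then obtain P where P: "\<And>x. x \<in> slit \<Longrightarrow> (P has_field_derivative f x) (at x)" by blast
  have I: "((\<lambda>t. Ln (1 - of_real t * z) / of_real t) has_integral - (P z - P 0)) {0..1}" if z: "z \<in> slit" for z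
  proof -
    have "((\<lambda>t. z * f (of_real t * z)) has_integral P (of_real 1 * z) - P (of_real 0 * z)) {0..1}"
    proof (rule fundamental_theorem_of_calculus)
      show "((\<lambda>t. P (of_real t * z)) has_vector_derivative z * f (of_real t * z)) (at t within {0..1})"
        if "t \<in> {0..1}" for t
      proof -
        have "((\<lambda>t. of_real t * z) has_vector_derivative z) (at t within {0..1})"
          by (auto intro!: derivative_eq_intros simp: has_vector_derivative_def scaleR_conv_of_real)
        from field_vector_diff_chain_within[OF this has_field_derivative_at_within[OF P]]
        show ?thesis using that scale_in_slit[OF z] by (simp add: o_def)
      qed
    qed simp
    from has_integral_neg[OF this]
    have "((\<lambda>t. - (z * f (of_real t * z))) has_integral - (P z - P 0)) {0..1}" by simp
    \<comment> \<open>At t = 0 the integrand of \<open>Li2\<close> is 0 by division by zero instead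
      of its limit; hence the exceptional point.\<close>
    then show ?thesis
      by (rule has_integral_spike_finite[of "{0}", rotated 2]) (auto simp: f_def)
  qed
  have L: "Li2 w = P w - P 0" if "w \<in> slit" for w
    using integral_unique[OF I[OF that]] by (simp add: Li2_def)
  have "((\<lambda>w. P w - P 0) has_field_derivative f z) (at z)"
    using P[OF z] by (auto intro!: derivative_eq_intros)
  then show "(Li2 has_field_derivative f z) (at z)"
    using DERIV_cong_ev[OF refl, of Li2 "\<lambda>w. P w - P 0" z "f z" "f z"] eventually_nhds_in_open[OF open_slit z] L
    by (metis (mono_tags, lifting) eventually_mono)
  show "(\<lambda>t. Ln (1 - of_real t * z) / of_real t) integrable_on {0..1}"
    using I[OF z] by blast
qed

lemma Im_integral:
  "f integrable_on S \<Longrightarrow> Im (integral S f) = integral S (\<lambda>t. Im (f t))"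
  using integral_linear[OF _ bounded_linear_Im, of f S] by (simp add: o_def)

lemma Im_Li2_real_less_1:
  assumes "x < 1" shows "Im (Li2 (of_real x)) = 0"
proof -
  have "of_real x \<in> slit" using assms by (simp add: slit_iff)
  have "Im (Ln (1 - of_real t * of_real x) / of_real t) = 0" if t: "t \<in> {0..1}" for t
  proof -
    have "of_real t * of_real x \<in> slit"
      using scale_in_slit[of "of_real x" t] t assms by (simp add: slit_iff)
    then have "t * x < 1" by (simp add: slit_iff)
    then have "Ln (1 - of_real t * of_real x) = of_real (ln (1 - t * x))"
      using Ln_of_real[of "1 - t * x"] by simp
    then show ?thesis by simp
  qed
  then have "integral {0..1} (\<lambda>t. Im (Ln (1 - of_real t * of_real x) / of_real t)) = 0"
    by (subst integral_cong[where g = "\<lambda>_. 0"]) auto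
  then show ?thesis
    using Im_integral[OF Li2_integrable[OF \<open>of_real x \<in> slit\<close>]] by (simp add: Li2_def)
qed

lemma abs_ln_le_powr:
  fixes y :: real
  assumes "0 < y" "y \<le> 1" shows "\<bar>ln y\<bar> \<le> 2 * y powr (-1/2)"
proof -
  have "ln (y powr (-1/2)) \<le> y powr (-1/2)"
    using ln_le_minus_one[of "y powr (-1/2)"] assms by simp
  then show ?thesis using assms by (simp add: ln_powr)
qed

text \<open>Here the segment passes through the branch point at t = s = 1/x and continues along the
  cut. The singularity at s is logarithmic and is dominated by |t - s|^(-1/2). Integrability is what
  allows \<open>Im\<close> to be taken under the integral.\<close>

lemma Li2_integrable_greater_1:
  assumes x: "x > 1"
  shows "(\<lambda>t. Ln (1 - of_real t * of_real x) / of_real t) integrable_on {0..1}"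
proof -
  define s where "s = 1 / x"
  let ?f = "\<lambda>t::real. Ln (1 - of_real t * of_real x) / of_real t"
  define A where "A = 2 * x + 2 * x * (pi + \<bar>ln x\<bar>)"
  let ?k = "\<lambda>t. indicat_real {..1} \<bar>t - s\<bar> * \<bar>t - s\<bar> powr (- (1/2))"
  have s: "0 < s" "s < 1" using x by (auto simp: s_def)
  have bound: "norm (?f t) \<le> A + 4 * x * ?k t" if t: "t \<in> {0..1}" "t \<noteq> 0" "t \<noteq> s" for t
  proof -
    have t0: "t > 0" and ts: "0 < \<bar>t - s\<bar>" "\<bar>t - s\<bar> \<le> 1" using t s by auto
    have e: "1 - t * x = x * (s - t)" using x by (simp add: s_def field_simps)
    have k0: "0 \<le> ?k t" by simp
    have A0: "2 * x \<le> A" "2 * x * (pi + \<bar>ln x\<bar>) \<le> A" using x by (auto simp: A_def)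
    \<comment> \<open>For t x \<le> 1/2 the zero of the logarithm at t = 0 compensates 1/t; beyond
      that 1/t is at most 2 x and only the singularity at s matters.\<close>
    show ?thesis
    proof (cases "t * x \<le> 1/2")
      case True
      have "\<bar>ln (1 - t * x)\<bar> \<le> 2 * (t * x)"
      proof -
        have "t * x \<ge> 0" using t0 x by simp
        then have "- ln (1 - t * x) \<le> t * x / (1 - t * x)"
          using ln_le_minus_one[of "1 / (1 - t * x)"] True by (simp add: ln_div divide_simps)
        also have "\<dots> \<le> 2 * (t * x)"
          using True \<open>t * x \<ge> 0\<close> mult_left_mono[of "1/2" "1 - t * x" "2 * (t * x)"] by (simp add: divide_simps)
        finally show ?thesis using \<open>t * x \<ge> 0\<close> True by (auto simp: abs_if)
      qed
      moreover have "Ln (1 - of_real t * of_real x) = of_real (ln (1 - t * x))"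
        using Ln_of_real[of "1 - t * x"] True by simp
      ultimately have "norm (?f t) \<le> 2 * x"
        using t0 by (simp add: norm_divide divide_simps mult_ac)
      with A0 k0 x show ?thesis by (smt (verit) mult_nonneg_nonneg)
    next
      case False
      have nz: "1 - t * x \<noteq> 0" using e x ts by auto
      then have nz': "1 - of_real t * of_real x \<noteq> (0::complex)"
        by (metis of_real_1 of_real_diff of_real_eq_0_iff of_real_mult)
      have "norm (Ln (1 - of_real t * of_real x)) \<le> \<bar>Re (Ln (1 - of_real t * of_real x))\<bar> + \<bar>Im (Ln (1 - of_real t * of_real x))\<bar>"
        by (rule cmod_le)
      also have "\<bar>Im (Ln (1 - of_real t * of_real x))\<bar> \<le> pi"
        using mpi_less_Im_Ln[OF nz'] Im_Ln_le_pi[OF nz'] by linarith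
      also have "Re (Ln (1 - of_real t * of_real x)) = ln \<bar>1 - t * x\<bar>"
        using Re_Ln[OF nz'] by (metis norm_of_real of_real_1 of_real_diff of_real_mult)
      also have "ln \<bar>1 - t * x\<bar> = ln x + ln \<bar>t - s\<bar>"
        using x ts by (simp add: e abs_mult ln_mult abs_minus_commute)
      also have "\<bar>ln x + ln \<bar>t - s\<bar>\<bar> \<le> \<bar>ln x\<bar> + 2 * ?k t"
      proof -
        have "?k t = \<bar>t - s\<bar> powr (-1/2)" using ts by simp
        then show ?thesis
          using abs_ln_le_powr[OF ts] abs_triangle_ineq[of "ln x" "ln \<bar>t - s\<bar>"] by linarith
      qed
      finally have "norm (Ln (1 - of_real t * of_real x)) \<le> (pi + \<bar>ln x\<bar>) + 2 * ?k t" by simp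
      moreover have "1 / t \<le> 2 * x" using False t0 x by (simp add: field_simps)
      ultimately have "1 / t * norm (Ln (1 - of_real t * of_real x)) \<le> 2 * x * ((pi + \<bar>ln x\<bar>) + 2 * ?k t)"
        using x by (intro mult_mono) auto
      then have "norm (?f t) \<le> 2 * x * (pi + \<bar>ln x\<bar>) + 4 * x * ?k t"
        using t0 by (simp add: norm_divide algebra_simps)
      with A0 show ?thesis by simp
    qed
  qed
  have "set_integrable lborel {0..1} ?f"
    unfolding set_integrable_def
  proof (rule Bochner_Integration.integrable_bound)
    show "integrable lborel (\<lambda>t. indicat_real {0..1} t * A + 4 * x * ?k t)"
      using integrable_lborel_shift(1)[OF integrable_abs_powr_near_0[of "1/2"], of s]
      by (intro Bochner_Integration.integrable_add integrable_mult_right integrable_mult_left) auto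
    have "AE t in lborel. t \<notin> {0, s}"
      by (intro AE_not_in) (auto intro: countable_imp_null_set_lborel)
    then show "AE t in lborel. norm (indicat_real {0..1} t *\<^sub>R ?f t) \<le> norm (indicat_real {0..1} t * A + 4 * x * ?k t)"
    proof eventually_elim
      case (elim t)
      then show ?case using bound[of t] x by (auto simp: indicator_def split: if_splits)
    qed
  qed simp
  then show ?thesis by (rule set_borel_integral_eq_integral(1))
qed

text \<open>Beyond s = 1/x the principal logarithm of a negative real contributes the imaginary part
  pi, and the integral of pi/t over [s, 1] is pi ln x.\<close>

lemma Im_Li2_real_greater_1:
  assumes x: "x > 1" shows "Im (Li2 (of_real x)) = - pi * ln x"
proof -
  define s where "s = 1 / x"
  have s: "0 < s" "s < 1" using x by (auto simp: s_def)
  have "((\<lambda>t. pi / t) has_integral pi * ln 1 - pi * ln s) {s..1}"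
    using s by (intro fundamental_theorem_of_calculus)
      (auto intro!: derivative_eq_intros simp: has_real_derivative_iff_has_vector_derivative[symmetric])
  then have "((\<lambda>t. pi / t) has_integral pi * ln x) {s..1}"
    using x by (simp add: s_def ln_div)
  then have "((\<lambda>t. if t \<in> {s..1} then pi / t else 0) has_integral pi * ln x) {0..1}"
    using s by (subst has_integral_restrict) auto
  then have "((\<lambda>t. Im (Ln (1 - of_real t * of_real x) / of_real t)) has_integral pi * ln x) {0..1}"
  proof (rule has_integral_spike_finite[of "{s}", rotated 2])
    fix t assume t: "t \<in> {0..1} - {s}"
    have e: "1 - t * x = x * (s - t)" using x by (simp add: s_def field_simps)
    have L: "Ln (1 - of_real t * of_real x) = Ln (of_real (1 - t * x))" by simp
    show "Im (Ln (1 - of_real t * of_real x) / of_real t) = (if t \<in> {s..1} then pi / t else 0)"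
    proof (cases "t < s")
      case True
      then have "1 - t * x > 0" using e x by simp
      then show ?thesis unfolding L using True by (simp add: Ln_of_real del: of_real_diff of_real_mult)
    next
      case False
      then have "1 - t * x < 0" using e x t by (simp add: mult_less_0_iff)
      then have "Im (Ln (of_real (1 - t * x))) = pi"
        by (subst Im_Ln_eq_pi) (auto simp del: of_real_diff of_real_mult)
      then show ?thesis unfolding L using False t by (simp del: of_real_diff of_real_mult)
    qed
  qed auto
  then show ?thesis
    using Im_integral[OF Li2_integrable_greater_1[OF x]] by (simp add: Li2_def integral_unique)
qed

text \<open>On the cut the value -pi ln x of Im Li2 cancels against Arg(1 - x) ln x. The real points
  serve below as base points that fix the constants in the symmetries.\<close>

lemma bloch_wigner_real:
  assumes "x \<noteq> 1" shows "bloch_wigner (of_real x) = 0"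
proof (cases "x < 1")
  case True
  then have "Arg (of_real (1 - x)) = 0" by (subst Arg_of_real) simp
  then show ?thesis using True by (simp add: bloch_wigner_def Im_Li2_real_less_1)
next
  case False
  then have "Arg (of_real (1 - x)) = pi" using assms by (subst Arg_of_real) simp
  then show ?thesis using False assms by (simp add: bloch_wigner_def Im_Li2_real_greater_1)
qed
text \<open>Im(h/z) is d arg z in the direction h. No branch enters this form, so it also makes
  sense on the cut.\<close>

definition bw_deriv :: "complex \<Rightarrow> complex \<Rightarrow> real" where
  "bw_deriv z h = ln (norm z) * Im (- h / (1 - z)) - ln (norm (1 - z)) * Im (h / z)"

text \<open>The branch-dependent terms cancel: d Im Li2 contributes -Im Ln(1 - z) d log|z|, and the
  product rule applied to the second summand of D contributes the opposite.\<close>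

lemma has_derivative_bloch_wigner_slit:
  assumes z: "z \<in> slit" "z \<noteq> 0"
  shows "(bloch_wigner has_derivative bw_deriv z) (at z)"
proof -
  have z1: "1 - z \<notin> \<real>\<^sub>\<le>\<^sub>0" using z by (simp add: slit_def)
  then have nz: "1 - z \<noteq> 0" by auto
  have L: "(Li2 has_derivative (\<lambda>h. - Ln (1 - z) / z * h)) (at z)"
    using Li2_has_field_derivative[OF z(1)] z(2) by (simp only: has_field_derivative_def if_False)
  have A: "((\<lambda>w. Ln (1 - w)) has_derivative (\<lambda>h. - inverse (1 - z) * h)) (at z)"
  proof -
    have "((\<lambda>w. Ln (1 - w)) has_field_derivative - inverse (1 - z)) (at z)"
      using z1 by (auto intro!: derivative_eq_intros simp: inverse_eq_divide)
    then show ?thesis by (simp only: has_field_derivative_def)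
  qed
  have 1: "((\<lambda>w. Im (Li2 w) + Im (Ln (1 - w)) * ln (norm w)) has_derivative
      (\<lambda>h. Im (- Ln (1 - z) / z * h) + (Im (Ln (1 - z)) * Re (h / z) + Im (- inverse (1 - z) * h) * ln (norm z)))) (at z)"
    by (intro has_derivative_add has_derivative_mult has_derivative_ln_norm z
        has_derivative_compose[OF L bounded_linear_imp_has_derivative[OF bounded_linear_Im]]
        has_derivative_compose[OF A bounded_linear_imp_has_derivative[OF bounded_linear_Im]])
  have 2: "Im (- Ln (1 - z) / z * h) + (Im (Ln (1 - z)) * Re (h / z) + Im (- inverse (1 - z) * h) * ln (norm z))
      = bw_deriv z h" for h
  proof -
    have "Im (- Ln (1 - z) / z * h) = - Im (Ln (1 - z) * (h / z))" by simp
    also have "\<dots> = - (ln (norm (1 - z)) * Im (h / z) + Im (Ln (1 - z)) * Re (h / z))"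
      by (simp only: times_complex.sel Re_Ln[OF nz])
    finally show ?thesis
      by (simp add: bw_deriv_def divide_inverse mult.commute)
  qed
  have "((\<lambda>w. Im (Li2 w) + Im (Ln (1 - w)) * ln (norm w)) has_derivative bw_deriv z) (at z)"
    by (rule has_derivative_eq_rhs[OF 1 ext[OF 2]])
  then show ?thesis
  proof (rule has_derivative_transform_within_open[OF _ open_slit z(1)])
    fix w assume "w \<in> slit"
    then have "1 - w \<noteq> 0" by (auto simp: slit_def)
    then show "Im (Li2 w) + Im (Ln (1 - w)) * ln (norm w) = bloch_wigner w"
      by (simp add: bloch_wigner_def Arg_eq_Im_Ln)
  qed
qed

section \<open>Symmetries of the Bloch-Wigner function and its derivative on the cut\<close>

lemma bw_deriv_inverse:
  assumes "z \<noteq> 0" "z \<noteq> 1"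
  shows "bw_deriv (1 / z) (- h / z\<^sup>2) = - bw_deriv z h"
proof -
  have n: "norm (1 - 1 / z) = norm (1 - z) / norm z"
  proof -
    have "1 - 1 / z = - ((1 - z) / z)" using assms by (simp add: divide_simps)
    then show ?thesis by (simp only: norm_minus_cancel norm_divide)
  qed
  have "- (- h / z\<^sup>2) / (1 - 1 / z) = - h / (1 - z) - h / z"
    using assms by (simp add: divide_simps power2_eq_square) (simp add: algebra_simps)
  moreover have "(- h / z\<^sup>2) / (1 / z) = - (h / z)"
    using assms by (simp add: divide_simps power2_eq_square)
  ultimately have "bw_deriv (1 / z) (- h / z\<^sup>2)
      = ln (norm (1 / z)) * Im (- h / (1 - z) - h / z) - ln (norm (1 - 1 / z)) * Im (- (h / z))"
    by (simp only: bw_deriv_def)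
  then show ?thesis
    using assms by (simp add: bw_deriv_def n ln_div norm_divide algebra_simps)
qed

lemma has_derivative_bloch_wigner_inverse:
  assumes z: "z \<noteq> 0" "z \<noteq> 1" and "(bloch_wigner has_derivative bw_deriv (1 / z)) (at (1 / z))"
  shows "((\<lambda>w. - bloch_wigner (1 / w)) has_derivative bw_deriv z) (at z)"
proof -
  have "((\<lambda>w. 1 / w) has_derivative (\<lambda>h. - h / z\<^sup>2)) (at z)"
    using z by (auto intro!: derivative_eq_intros simp: power2_eq_square divide_simps)
  from has_derivative_minus[OF has_derivative_compose[OF this assms(3)]]
  show ?thesis using bw_deriv_inverse[OF z] by simp
qed

lemma inverse_in_slit:
  assumes "z \<notin> \<real> \<or> Re z < 0 \<or> Re z > 1"
  shows "1 / z \<in> slit"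
proof (cases "z \<in> \<real>")
  case True
  then obtain x where x: "z = of_real x" by (auto simp: Reals_def)
  then have "1 / x < 1" using assms True by (auto simp: divide_simps)
  moreover have "1 / z = of_real (1 / x)" by (simp add: x)
  ultimately show ?thesis by (simp only: slit_iff) simp
next
  case False
  then have "1 / z \<notin> \<real>" by (metis Reals_1 Reals_divide divide_divide_eq_right div_by_1 mult_1)
  then show ?thesis by (auto simp: slit_iff complex_is_Real_iff)
qed

text \<open>At this stage D is known to be differentiable only off the cut. Both z and 1/z avoid it
  on the complement of [0, \<infinity>), which is star-shaped about -1, and D(-1) = 0 fixes the
  constant. For real z both sides vanish.\<close>

lemma bloch_wigner_inverse:
  assumes z: "z \<noteq> 0" "z \<noteq> 1"
  shows "bloch_wigner (1 / z) = - bloch_wigner z"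
proof (cases "z \<in> \<real>")
  case True
  then obtain x where x: "z = of_real x" by (auto simp: Reals_def)
  show ?thesis
    using bloch_wigner_real[of x] bloch_wigner_real[of "1 / x"] z by (simp add: x)
next
  case False
  let ?U = "{z::complex. - z \<notin> \<real>\<^sub>\<le>\<^sub>0}"
  have U: "w \<in> ?U \<longleftrightarrow> w \<notin> \<real> \<or> Re w < 0" for w
    by (auto simp: complex_nonpos_Reals_iff complex_is_Real_iff)
  have o: "open ?U"
  proof -
    have eq: "?U = {z. Im z \<noteq> 0} \<union> {z. Re z < 0}" by (auto simp: complex_nonpos_Reals_iff)
    show ?thesis
      unfolding eq by (intro open_Un open_Collect_neq open_Collect_less continuous_intros)
  qed
  have "starlike ?U"
    unfolding starlike_def
  proof (intro bexI[of _ "-1"] ballI subsetI)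
    fix x y assume x: "x \<in> ?U" and y: "y \<in> closed_segment (-1) x"
    then obtain t where t: "0 \<le> t" "t \<le> 1" "y = (1 - t) *\<^sub>R (-1) + t *\<^sub>R x"
      by (auto simp: closed_segment_def)
    show "y \<in> ?U"
    proof (cases "Im x = 0")
      case True
      then have "Re x < 0" using x by (auto simp: complex_nonpos_Reals_iff)
      then have "Re y < 0"
        using t mult_pos_neg[of t "Re x"] by (cases "t = 0") auto
      then show ?thesis by (auto simp: complex_nonpos_Reals_iff)
    next
      case False
      then show ?thesis using t by (cases "t = 0") (auto simp: complex_nonpos_Reals_iff)
    qed
  qed auto
  then have conn: "connected ?U" by (rule starlike_imp_connected)
  have "bloch_wigner z - (- bloch_wigner (1 / z)) = bloch_wigner (-1) - (- bloch_wigner (1 / (-1)))"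
  proof (rule has_derivative_zero_unique_connected[OF o conn, where f = "\<lambda>w. bloch_wigner w - (- bloch_wigner (1 / w))"])
    fix w assume "w \<in> ?U"
    then have w: "w \<notin> \<real> \<or> Re w < 0" by (simp only: U)
    then have "w \<in> slit" "w \<noteq> 0" "w \<noteq> 1" "1 / w \<in> slit"
      using inverse_in_slit[of w] by (auto simp: slit_iff complex_is_Real_iff)
    from has_derivative_diff[OF has_derivative_bloch_wigner_slit[OF this(1,2)]
        has_derivative_bloch_wigner_inverse[OF this(2,3) has_derivative_bloch_wigner_slit[OF this(4)]]] \<open>w \<noteq> 0\<close>
    show "((\<lambda>w. bloch_wigner w - (- bloch_wigner (1 / w))) has_derivative (\<lambda>h. 0)) (at w)" by simp
  next
    show "z \<in> ?U" using False by (simp only: U) simp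
  qed auto
  then show ?thesis using bloch_wigner_real[of "-1"] by simp
qed

text \<open>Across the cut \<open>z > 1\<close> the function is continued by \<open>-D(1/z)\<close>.\<close>

lemma has_derivative_bloch_wigner:
  assumes z: "z \<noteq> 0" "z \<noteq> 1"
  shows "(bloch_wigner has_derivative bw_deriv z) (at z)"
proof (cases "z \<in> slit")
  case True
  then show ?thesis using z by (intro has_derivative_bloch_wigner_slit)
next
  case False
  then have "Im z = 0" "Re z \<ge> 1" by (auto simp: slit_iff)
  moreover then have "Re z \<noteq> 1" using z(2) by (metis complex_eq_iff one_complex.sel)
  ultimately have "1 / z \<in> slit" by (intro inverse_in_slit) simp
  from has_derivative_bloch_wigner_inverse[OF z has_derivative_bloch_wigner_slit[OF this]] z
  have "((\<lambda>w. - bloch_wigner (1 / w)) has_derivative bw_deriv z) (at z)" by simp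
  then show ?thesis
    by (rule has_derivative_transform_within_open[of _ _ _ _ "- {0, 1}"])
      (use z bloch_wigner_inverse in \<open>auto intro: open_Compl finite_imp_closed\<close>)
qed

text \<open>The form \<open>bw_deriv\<close> changes sign under z -> 1 - z, the plane without 0 and
  1 is connected, and the fixed point 1/2 is a real zero of D.\<close>

lemma bloch_wigner_one_minus:
  assumes z: "z \<noteq> 0" "z \<noteq> 1"
  shows "bloch_wigner (1 - z) = - bloch_wigner z"
proof -
  have o: "open (- {0, 1} :: complex set)" by (intro open_Compl finite_imp_closed) auto
  have c: "connected (- {0, 1} :: complex set)"
    using connected_open_delete_finite[of UNIV "{0, 1} :: complex set"] connected_UNIV by (simp add: Compl_eq_Diff_UNIV)
  have "bloch_wigner z + bloch_wigner (1 - z) = bloch_wigner (1/2) + bloch_wigner (1 - 1/2)"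
  proof (rule has_derivative_zero_unique_connected[OF o c, where f = "\<lambda>w. bloch_wigner w + bloch_wigner (1 - w)"])
    fix w :: complex assume "w \<in> - {0, 1}"
    then have w: "w \<noteq> 0" "w \<noteq> 1" "1 - w \<noteq> 0" "1 - w \<noteq> 1" by auto
    have "((\<lambda>w. 1 - w) has_derivative uminus) (at w)" by (auto intro!: derivative_eq_intros)
    from has_derivative_add[OF has_derivative_bloch_wigner[OF w(1,2)]
        has_derivative_compose[OF this has_derivative_bloch_wigner[OF w(3,4)]]]
    show "((\<lambda>w. bloch_wigner w + bloch_wigner (1 - w)) has_derivative (\<lambda>h. 0)) (at w)"
      by (simp add: bw_deriv_def)
  qed (use z in auto)
  then show ?thesis using bloch_wigner_real[of "1/2"] by simp
qed

text \<open>A logarithmic bound is within the growth that Cauchy-Pompeiu admits; the two symmetries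
  transport it to 1 and to infinity.\<close>

lemma bloch_wigner_near_0:
  obtains K where "\<And>z. z \<noteq> 0 \<Longrightarrow> norm z \<le> 1/2 \<Longrightarrow> \<bar>bloch_wigner z\<bar> \<le> K + pi * \<bar>ln (norm z)\<bar>"
proof -
  have sub: "cball 0 (1/2) \<subseteq> slit"
  proof
    fix z :: complex assume "z \<in> cball 0 (1/2)"
    then show "z \<in> slit" using complex_Re_le_cmod[of z] by (simp add: slit_iff)
  qed
  have "continuous_on (cball 0 (1/2)) Li2"
    using Li2_has_field_derivative sub
    by (intro continuous_at_imp_continuous_on) (auto intro: DERIV_isCont)
  then have "bounded (Li2 ` cball 0 (1/2))"
    by (intro compact_imp_bounded compact_continuous_image) auto
  then obtain K where "\<forall>y\<in>Li2 ` cball 0 (1/2). norm y \<le> K"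
    unfolding bounded_iff by blast
  then have K: "norm (Li2 z) \<le> K" if "norm z \<le> 1/2" for z
    using that by auto
  have "\<bar>bloch_wigner z\<bar> \<le> K + pi * \<bar>ln (norm z)\<bar>" if "norm z \<le> 1/2" for z
  proof -
    have "\<bar>bloch_wigner z\<bar> \<le> \<bar>Im (Li2 z)\<bar> + \<bar>Arg (1 - z)\<bar> * \<bar>ln (norm z)\<bar>"
      unfolding bloch_wigner_def by (rule order_trans[OF abs_triangle_ineq]) (simp add: abs_mult)
    also have "\<dots> \<le> K + pi * \<bar>ln (norm z)\<bar>"
      using K[OF that] abs_Im_le_cmod[of "Li2 z"] mpi_less_Arg[of "1 - z"] Arg_le_pi[of "1 - z"]
      by (intro add_mono mult_right_mono) auto
    finally show ?thesis .
  qed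
  then show ?thesis using that by blast
qed

section \<open>The tree integral\<close>

lemma ln_norm_bigo:
  fixes s :: complex
  assumes c: "c > 0"
  shows ln_norm_bigo_at: "(\<lambda>u. ln (norm (u - s) / c)) \<in> O[at s](\<lambda>u. norm (u - s) powr (-1/4))"
    and ln_norm_bigo_at_infinity: "(\<lambda>u. ln (norm (u - s) / c)) \<in> O[at_infinity](\<lambda>u. norm u powr (1/4))"
proof -
  have "((\<lambda>u. norm (u - s)) \<longlongrightarrow> norm (s - s)) (at s)" by (intro tendsto_intros)
  then have "filterlim (\<lambda>u. norm (u - s)) (at_right 0) (at s)"
    unfolding filterlim_at using eventually_neq_at_within[of s s UNIV] by (auto elim: eventually_mono)
  moreover have "(\<lambda>r. ln (r / c)) \<in> O[at_right 0](\<lambda>r. r powr (-1/4))"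
  proof -
    have "(\<lambda>r::real. ln r) \<in> O[at_right 0](\<lambda>r. r powr (-1/4))"
      "(\<lambda>r::real. 1) \<in> O[at_right 0](\<lambda>r. r powr (-1/4))" by real_asymp+
    then have "(\<lambda>r. ln r - ln c * 1) \<in> O[at_right 0](\<lambda>r. r powr (-1/4))"
      by (intro sum_in_bigo(2)) (simp_all only: cmult_in_bigo_iff simp_thms)
    moreover have "\<forall>\<^sub>F r in at_right 0. ln r - ln c * 1 = ln (r / c)"
      using c by (auto simp: eventually_at_right_field ln_div intro: exI[of _ 1])
    ultimately show ?thesis by (subst (asm) landau_o.big.in_cong)
  qed
  ultimately show "(\<lambda>u. ln (norm (u - s) / c)) \<in> O[at s](\<lambda>u. norm (u - s) powr (-1/4))"
    by (rule landau_o.big.compose[rotated])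
  have "filterlim (\<lambda>u. u - s) at_infinity at_infinity"
    using tendsto_add_filterlim_at_infinity'[OF filterlim_ident tendsto_const[of "- s"]] by simp
  then have "filterlim (\<lambda>u. norm (u - s)) at_top at_infinity"
    by (simp add: filterlim_at_infinity_conv_norm_at_top)
  moreover have "(\<lambda>r. ln (r / c)) \<in> O(\<lambda>r. r powr (1/4))"
  proof -
    have "(\<lambda>r::real. ln r) \<in> O(\<lambda>r. r powr (1/4))" "(\<lambda>r::real. 1) \<in> O(\<lambda>r. r powr (1/4))"
      by real_asymp+
    then have "(\<lambda>r. ln r - ln c * 1) \<in> O(\<lambda>r. r powr (1/4))"
      by (intro sum_in_bigo(2)) (simp_all only: cmult_in_bigo_iff simp_thms)
    moreover have "\<forall>\<^sub>F r in at_top. ln r - ln c * 1 = ln (r / c)"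
      by (rule eventually_mono[OF eventually_gt_at_top[of 0]]) (use c in \<open>simp add: ln_div\<close>)
    ultimately show ?thesis by (subst (asm) landau_o.big.in_cong)
  qed
  ultimately have "(\<lambda>u. ln (norm (u - s) / c)) \<in> O[at_infinity](\<lambda>u. norm (u - s) powr (1/4))"
    by (rule landau_o.big.compose[rotated])
  also have "(\<lambda>u. norm (u - s) powr (1/4)) \<in> O[at_infinity](\<lambda>u. norm u powr (1/4))"
  proof -
    obtain K where K: "K > 0" "\<forall>\<^sub>F u in at_infinity. norm (norm (u - s)) \<le> K * norm (norm u powr 1)"
      using landau_o.bigE[OF norm_diff_bigo_at_infinity(1)] by blast
    show ?thesis
    proof (rule bigoI[where c = "K powr (1/4)"], use K(2) in eventually_elim)
      case (elim u)
      then have "norm (u - s) powr (1/4) \<le> (K * norm u) powr (1/4)" by (intro powr_mono2) auto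
      then show ?case using K(1) by (simp add: powr_mult)
    qed
  qed
  finally show "(\<lambda>u. ln (norm (u - s) / c)) \<in> O[at_infinity](\<lambda>u. norm u powr (1/4))" .
qed

lemma ln_norm_bigo_at_other:
  fixes s :: complex
  assumes c: "c > 0" and "s \<noteq> t"
  shows "(\<lambda>u. ln (norm (u - s) / c)) \<in> O[at t](\<lambda>u. norm (u - t) powr 0)"
  using assms by (intro bigo_powr_0(1)[where c = "ln (norm (t - s) / c)"] tendsto_intros) auto

lemma inverse_norm_bigo:
  fixes s :: "'a::real_normed_vector"
  shows "(\<lambda>u. inverse (norm (u - s))) \<in> O[at s](\<lambda>u. norm (u - s) powr (-1))"
    and "s \<noteq> t \<Longrightarrow> (\<lambda>u. inverse (norm (u - s))) \<in> O[at t](\<lambda>u. norm (u - t) powr 0)"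
  by (rule bigoI[where c = 1], simp add: powr_minus,
      intro bigo_powr_0(1)[where c = "inverse (norm (t - s))"] tendsto_intros, auto)

lemma integral_ln_kernel:
  fixes a p q :: complex
  assumes "p \<noteq> q" "p \<noteq> a" "q \<noteq> a"
  shows "has_bochner_integral lborel (\<lambda>u. 1 / (u - a) * (1 / (cnj u - cnj p) - 1 / (cnj u - cnj q)))
           (2 * pi * (ln (norm (q - a)) - ln (norm (p - a))))"
proof -
  define F' where "F' u h = complex_of_real (Re (h / (u - a)))" for u h
  have "has_bochner_integral lborel (\<lambda>u. (F' u 1 + \<i> * F' u \<i>) * (1 / (u - p) - 1 / (u - q)))
      (2 * complex_of_real pi * (complex_of_real (ln (norm (q - a))) - complex_of_real (ln (norm (p - a)))))"
  proof (rule Cauchy_Pompeiu_difference[where S = "{a}" and F' = F' and F = "\<lambda>u. complex_of_real (ln (norm (u - a)))"])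
    show "((\<lambda>u. complex_of_real (ln (norm (u - a)))) has_derivative F' u) (at u)" if "u \<notin> {a}" for u
    proof -
      have "((\<lambda>u. u - a) has_derivative (\<lambda>h. h)) (at u)" by (auto intro!: derivative_eq_intros)
      from has_derivative_compose[OF this has_derivative_ln_norm] that
      have "((\<lambda>u. ln (norm (u - a))) has_derivative (\<lambda>h. Re (h / (u - a)))) (at u)" by simp
      then show ?thesis unfolding F'_def by (rule has_derivative_of_real)
    qed
    show "continuous_on (- {a}) (\<lambda>u. F' u h)" for h
      unfolding F'_def by (intro continuous_intros) auto
    have F'_le: "(\<lambda>u. norm (F' u h)) \<in> O[A](\<lambda>u. inverse (norm (u - a)))" for h A
    proof (rule bigoI[where c = "norm h"], rule always_eventually, rule allI)
      fix u
      have "norm (F' u h) \<le> norm (h / (u - a))"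
        unfolding F'_def norm_of_real by (rule abs_Re_le_cmod)
      also have "\<dots> = norm h * norm (inverse (norm (u - a)))"
        unfolding norm_divide by (simp add: divide_inverse)
      finally show "norm (norm (F' u h)) \<le> norm h * norm (inverse (norm (u - a)))" by simp
    qed
    show "(\<lambda>u. norm (complex_of_real (ln (norm (u - a))))) \<in> O[at s](\<lambda>u. norm (u - s) powr (-1/2))"
      if "s \<in> {a}" for s
      using bigo_powr_at_mono[OF ln_norm_bigo_at[of 1 a], of "-1/2"] that by simp
    show "(\<lambda>u. norm (F' u h)) \<in> O[at s](\<lambda>u. norm (u - s) powr (-3/2))" if "s \<in> {a}" for s h
      using landau_o.big_trans[OF F'_le bigo_powr_at_mono[OF inverse_norm_bigo(1)[of a], of "-3/2"]] that by simp
    show "(\<lambda>u. norm (complex_of_real (ln (norm (u - a))))) \<in> O[at_infinity](\<lambda>u. norm u powr (1/2))"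
      using bigo_powr_at_infinity_mono[OF ln_norm_bigo_at_infinity[of 1 a], of "1/2"] by simp
    show "(\<lambda>u. norm (F' u h)) \<in> O[at_infinity](\<lambda>u. norm u powr (-1/2))" for h
      using landau_o.big_trans[OF F'_le bigo_powr_at_infinity_mono[OF norm_diff_bigo_at_infinity(2)[of a], of "-1/2"]] by simp
  qed (use assms in auto)
  from has_bochner_integral_cnj[OF this]
  have *: "has_bochner_integral lborel (\<lambda>u. cnj ((F' u 1 + \<i> * F' u \<i>) * (1 / (u - p) - 1 / (u - q))))
      (2 * pi * (ln (norm (q - a)) - ln (norm (p - a))))"
    by simp
  \<comment> \<open>The operator in Cauchy-Pompeiu is twice d-bar, and d-bar of log|u - a| is half
    the conjugate of 1/(u - a). Conjugating the whole formula moves the bar onto the kernel.\<close>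
  have "F' u 1 + \<i> * F' u \<i> = cnj (1 / (u - a))" for u
  proof -
    have "F' u 1 + \<i> * F' u \<i> = of_real (Re (1 / (u - a))) + \<i> * of_real (Re (\<i> * (1 / (u - a))))"
      by (simp add: F'_def)
    also have "of_real (Re X) + \<i> * of_real (Re (\<i> * X)) = cnj X" for X
      by (simp add: complex_eq_iff)
    finally show ?thesis .
  qed
  then have "cnj ((F' u 1 + \<i> * F' u \<i>) * (1 / (u - p) - 1 / (u - q)))
      = 1 / (u - a) * (1 / (cnj u - cnj p) - 1 / (cnj u - cnj q))" for u
    by simp
  with * show ?thesis by simp
qed

text \<open>\<open>log|w| log|1 - w| + i D(w)\<close> is the single-valued \<open>\<partial>\<close>-bar primitive of \<open>log|1 - w|/w\<close>-bar,
  taken at \<open>w = (u - s)/(t - s)\<close>.\<close>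

definition bw_primitive :: "complex \<Rightarrow> complex \<Rightarrow> complex \<Rightarrow> complex" where
  "bw_primitive s t u = of_real (ln (norm (u - s) / norm (t - s)) * ln (norm (u - t) / norm (t - s)))
     + \<i> * of_real (bloch_wigner ((u - s) / (t - s)))"

text \<open>The differential of the product of logarithms supplies real parts and i dD the matching
  imaginary parts: together they form log|1 - w| times the conjugate of dw/w plus log|w| dw/(w - 1).
  The second term is complex linear and is annihilated by d-bar.\<close>

lemma integral_bw_primitive:
  assumes "s \<noteq> t" "p \<noteq> q" "p \<notin> {s, t}" "q \<notin> {s, t}"
  shows "has_bochner_integral lborel
           (\<lambda>u. 2 * of_real (ln (norm (u - t) / norm (t - s))) / (cnj u - cnj s) * (1 / (u - p) - 1 / (u - q)))
           (2 * complex_of_real pi * (bw_primitive s t q - bw_primitive s t p))"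
proof -
  define c where "c = norm (t - s)"
  have c: "c > 0" using assms by (simp add: c_def)
  define w where "w u = (u - s) / (t - s)" for u
  define F' where "F' u h = of_real (ln (norm (u - t) / c)) * cnj (h / (u - s))
      + of_real (ln (norm (u - s) / c)) * (h / (u - t))" for u h
  have w1: "1 - w u = (t - u) / (t - s)" for u using assms(1) by (simp add: w_def divide_simps)
  have nw: "norm (w u) = norm (u - s) / c" "norm (1 - w u) = norm (u - t) / c" for u
    by (simp add: w_def norm_divide c_def)
      (simp only: w1 norm_divide c_def norm_minus_commute[of t u])
  have w01: "w u \<noteq> 0" "w u \<noteq> 1" if "u \<notin> {s, t}" for u
    using that assms(1) by (auto simp: w_def)
  have der: "(bw_primitive s t has_derivative F' u) (at u)" if u: "u \<notin> {s, t}" for u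
  proof -
    have us: "u - s \<noteq> 0" "u - t \<noteq> 0" "t - s \<noteq> 0" using u assms by auto
    have wd: "(w has_derivative (\<lambda>h. h / (t - s))) (at u)"
      unfolding w_def using us by (auto intro!: derivative_eq_intros)
    have L1: "((\<lambda>u. ln (norm (w u))) has_derivative (\<lambda>h. Re (h / (u - s)))) (at u)"
      using has_derivative_compose[OF wd has_derivative_ln_norm[OF w01(1)[OF u]]] us by (simp add: w_def)
    have "((\<lambda>u. 1 - w u) has_derivative (\<lambda>h. - (h / (t - s)))) (at u)"
      using has_derivative_diff[OF has_derivative_const wd] by simp
    from has_derivative_compose[OF this has_derivative_ln_norm] w01(2)[OF u]
    have "((\<lambda>u. ln (norm (1 - w u))) has_derivative (\<lambda>h. Re (- (h / (t - s)) / (1 - w u)))) (at u)" by simp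
    moreover have e2: "- (h / (t - s)) / (1 - w u) = h / (u - t)" for h
      unfolding w1 using us by (simp add: divide_simps) (simp add: algebra_simps)
    ultimately have L2: "((\<lambda>u. ln (norm (1 - w u))) has_derivative (\<lambda>h. Re (h / (u - t)))) (at u)"
      by (simp only:)
    have e1: "h / (t - s) / w u = h / (u - s)" for h using us by (simp add: w_def)
    have "((\<lambda>u. bloch_wigner (w u)) has_derivative (\<lambda>h. bw_deriv (w u) (h / (t - s)))) (at u)"
      by (rule has_derivative_compose[OF wd has_derivative_bloch_wigner[OF w01[OF u]]])
    then have B: "((\<lambda>u. bloch_wigner (w u)) has_derivative
        (\<lambda>h. ln (norm (w u)) * Im (h / (u - t)) - ln (norm (1 - w u)) * Im (h / (u - s)))) (at u)"
      unfolding bw_deriv_def e1 e2 .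
    have "((\<lambda>u. of_real (ln (norm (w u)) * ln (norm (1 - w u))) + \<i> * of_real (bloch_wigner (w u))) has_derivative
      (\<lambda>h. of_real (ln (norm (w u)) * Re (h / (u - t)) + Re (h / (u - s)) * ln (norm (1 - w u)))
        + \<i> * of_real (ln (norm (w u)) * Im (h / (u - t)) - ln (norm (1 - w u)) * Im (h / (u - s))))) (at u)"
      by (intro has_derivative_add has_derivative_mult_right has_derivative_of_real has_derivative_mult L1 L2 B)
    moreover have "of_real (ln (norm (w u)) * Re (h / (u - t)) + Re (h / (u - s)) * ln (norm (1 - w u)))
        + \<i> * of_real (ln (norm (w u)) * Im (h / (u - t)) - ln (norm (1 - w u)) * Im (h / (u - s))) = F' u h" for h
    proof -
      have "of_real (A * Re Y + Re X * B) + \<i> * of_real (A * Im Y - B * Im X) = of_real B * cnj X + of_real A * Y" for A B X Y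
        by (simp add: complex_eq_iff algebra_simps)
      then show ?thesis unfolding F'_def nw .
    qed
    ultimately show ?thesis
      unfolding bw_primitive_def[abs_def] nw w_def[symmetric] c_def[symmetric] by simp
  qed
  have cont: "continuous_on (- {s, t}) (\<lambda>u. F' u h)" for h
    unfolding F'_def using c by (intro continuous_intros) auto
  define ls lt where "ls u = ln (norm (u - s) / c)" and "lt u = ln (norm (u - t) / c)" for u
  define ms mt where "ms u = inverse (norm (u - s))" and "mt u = inverse (norm (u - t))" for u
  have F'_le: "(\<lambda>u. norm (F' u h)) \<in> O[A](g)"
    if g: "(\<lambda>u. lt u * ms u) \<in> O[A](g)" "(\<lambda>u. ls u * mt u) \<in> O[A](g)" for h A g
  proof (rule landau_o.big_trans)
    show "(\<lambda>u. norm (F' u h)) \<in> O[A](\<lambda>u. norm (lt u * ms u) + norm (ls u * mt u))"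
    proof (rule bigoI[where c = "norm h"], rule always_eventually, rule allI)
      fix u
      have "norm (F' u h) \<le> norm (of_real (lt u) * cnj (h / (u - s))) + norm (of_real (ls u) * (h / (u - t)))"
        unfolding F'_def ls_def lt_def by (rule norm_triangle_ineq)
      also have "\<dots> = norm h * (norm (lt u * ms u) + norm (ls u * mt u))"
        unfolding norm_mult complex_mod_cnj norm_divide norm_of_real
        by (simp add: ms_def mt_def divide_inverse algebra_simps)
      finally show "norm (norm (F' u h)) \<le> norm h * norm (norm (lt u * ms u) + norm (ls u * mt u))" by simp
    qed
    show "(\<lambda>u. norm (lt u * ms u) + norm (ls u * mt u)) \<in> O[A](g)"
      using g by (intro sum_in_bigo(1)) (simp_all only: real_norm_def landau_o.big.abs_in_iff)
  qed
  obtain K where K: "\<And>z. z \<noteq> 0 \<Longrightarrow> norm z \<le> 1/2 \<Longrightarrow> \<bar>bloch_wigner z\<bar> \<le> K + pi * \<bar>ln (norm z)\<bar>"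
    using bloch_wigner_near_0 by blast
  \<comment> \<open>\<open>l\<close> is the logarithm that controls D locally: \<open>ls\<close>
    near s and at infinity, \<open>lt\<close> near t.\<close>
  have F_le: "(\<lambda>u. norm (bw_primitive s t u)) \<in> O[A](g)"
    if g: "(\<lambda>u. ls u * lt u) \<in> O[A](g)" "(\<lambda>u. 1) \<in> O[A](g)" "l \<in> O[A](g)"
      and ev: "\<forall>\<^sub>F u in A. \<bar>bloch_wigner (w u)\<bar> \<le> K + pi * \<bar>l u\<bar>" for A g l
  proof (rule landau_o.big_trans)
    show "(\<lambda>u. norm (bw_primitive s t u)) \<in> O[A](\<lambda>u. norm (ls u * lt u) + (\<bar>K\<bar> * 1 + pi * norm (l u)))"
    proof (rule bigoI[where c = 1], use ev in eventually_elim)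
      case (elim u)
      have "norm (bw_primitive s t u) \<le> norm (of_real (ls u * lt u) :: complex) + norm (\<i> * of_real (bloch_wigner (w u)))"
        unfolding bw_primitive_def ls_def lt_def w_def c_def by (rule norm_triangle_ineq)
      then show ?case using elim by (simp add: norm_mult del: of_real_mult)
    qed
    have "(\<lambda>u. pi * norm (l u)) \<in> O[A](g)" using g(3) by simp
    moreover have "(\<lambda>u. \<bar>K\<bar> * 1) \<in> O[A](g)" using g(2) by (simp only: cmult_in_bigo_iff simp_thms)
    ultimately show "(\<lambda>u. norm (ls u * lt u) + (\<bar>K\<bar> * 1 + pi * norm (l u))) \<in> O[A](g)"
      using g(1) by (intro sum_in_bigo(1)) (simp_all only: real_norm_def landau_o.big.abs_in_iff)
  qed
  have w_near: "\<forall>\<^sub>F u in at x. u \<in> ball x (c / 2) \<and> u \<noteq> x" for x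
    using c eventually_at_ball[of "c / 2" x UNIV] eventually_neq_at_within[of x x UNIV]
    by (auto elim: eventually_elim2)
  have l_s: "ls \<in> O[at s](\<lambda>u. norm (u - s) powr (-1/4))" "lt \<in> O[at s](\<lambda>u. norm (u - s) powr 0)"
    "ms \<in> O[at s](\<lambda>u. norm (u - s) powr (-1))" "mt \<in> O[at s](\<lambda>u. norm (u - s) powr 0)"
    unfolding ls_def lt_def ms_def mt_def
    by (simp_all only: ln_norm_bigo_at[OF c] inverse_norm_bigo(1)
        ln_norm_bigo_at_other[OF c assms(1)] ln_norm_bigo_at_other[OF c assms(1)[symmetric]]
        inverse_norm_bigo(2)[OF assms(1)] inverse_norm_bigo(2)[OF assms(1)[symmetric]])
  have l_t: "ls \<in> O[at t](\<lambda>u. norm (u - t) powr 0)" "lt \<in> O[at t](\<lambda>u. norm (u - t) powr (-1/4))"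
    "ms \<in> O[at t](\<lambda>u. norm (u - t) powr 0)" "mt \<in> O[at t](\<lambda>u. norm (u - t) powr (-1))"
    unfolding ls_def lt_def ms_def mt_def
    by (simp_all only: ln_norm_bigo_at[OF c] inverse_norm_bigo(1)
        ln_norm_bigo_at_other[OF c assms(1)] ln_norm_bigo_at_other[OF c assms(1)[symmetric]]
        inverse_norm_bigo(2)[OF assms(1)] inverse_norm_bigo(2)[OF assms(1)[symmetric]])
  have l_i: "ls \<in> O[at_infinity](\<lambda>u. norm u powr (1/4))" "lt \<in> O[at_infinity](\<lambda>u. norm u powr (1/4))"
    "ms \<in> O[at_infinity](\<lambda>u. norm u powr (-1))" "mt \<in> O[at_infinity](\<lambda>u. norm u powr (-1))"
    unfolding ls_def lt_def ms_def mt_def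
    using ln_norm_bigo_at_infinity[OF c] norm_diff_bigo_at_infinity(2) by auto
  have one: "(\<lambda>u. 1) \<in> O[at x](\<lambda>u. norm (u - x) powr 0)" for x :: complex
    by (rule bigo_powr_0(1)[OF tendsto_const])
  have "has_bochner_integral lborel (\<lambda>u. (F' u 1 + \<i> * F' u \<i>) * (1 / (u - p) - 1 / (u - q)))
      (2 * complex_of_real pi * (bw_primitive s t q - bw_primitive s t p))"
  proof (rule Cauchy_Pompeiu_difference[OF _ assms(2,3,4) der cont])
    fix x assume "x \<in> {s, t}"
    then consider "x = s" | "x = t" by blast
    then show "(\<lambda>u. norm (bw_primitive s t u)) \<in> O[at x](\<lambda>u. norm (u - x) powr (-1/2))"
    proof cases
      case 1
      have "\<forall>\<^sub>F u in at s. \<bar>bloch_wigner (w u)\<bar> \<le> K + pi * \<bar>ls u\<bar>"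
      proof (rule eventually_mono[OF w_near])
        fix u assume "u \<in> ball s (c / 2) \<and> u \<noteq> s"
        then have "w u \<noteq> 0" "norm (w u) \<le> 1/2"
          using c assms(1) by (auto simp: nw(1) dist_norm norm_minus_commute) (simp add: w_def)
        then show "\<bar>bloch_wigner (w u)\<bar> \<le> K + pi * \<bar>ls u\<bar>" using K[of "w u"] by (simp add: ls_def nw)
      qed
      from F_le[OF _ _ _ this] show ?thesis unfolding 1
        using bigo_powr_at_mono[OF bigo_powr_mult[OF l_s(1,2)], of "-1/2"]
          bigo_powr_at_mono[OF one, of "-1/2"] bigo_powr_at_mono[OF l_s(1), of "-1/2"] by simp
    next
      case 2
      \<comment> \<open>Near t it is 1 - w that is small, so D(1 - w) = -D(w) brings in the bound at
        0.\<close>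
      have "\<forall>\<^sub>F u in at t. \<bar>bloch_wigner (w u)\<bar> \<le> K + pi * \<bar>lt u\<bar>"
      proof (rule eventually_mono[OF w_near])
        fix u assume "u \<in> ball t (c / 2) \<and> u \<noteq> t"
        then have "u \<noteq> t" and n: "norm (1 - w u) \<le> 1/2"
          using c by (auto simp: nw(2) dist_norm norm_minus_commute)
        moreover have "w u \<noteq> 0"
        proof
          assume "w u = 0"
          with n show False by simp
        qed
        moreover have "w u \<noteq> 1" using \<open>u \<noteq> t\<close> assms(1) by (simp add: w_def)
        ultimately show "\<bar>bloch_wigner (w u)\<bar> \<le> K + pi * \<bar>lt u\<bar>"
          using K[of "1 - w u"] bloch_wigner_one_minus[of "w u"] by (simp add: lt_def nw)
      qed
      from F_le[OF _ _ _ this] show ?thesis unfolding 2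
        using bigo_powr_at_mono[OF bigo_powr_mult[OF l_t(1,2)], of "-1/2"]
          bigo_powr_at_mono[OF one, of "-1/2"] bigo_powr_at_mono[OF l_t(2), of "-1/2"] by simp
    qed
  next
    fix x h assume "x \<in> {s, t}"
    then consider "x = s" | "x = t" by blast
    then show "(\<lambda>u. norm (F' u h)) \<in> O[at x](\<lambda>u. norm (u - x) powr (-3/2))"
    proof cases
      case 1
      show ?thesis unfolding 1
        using bigo_powr_at_mono[OF bigo_powr_mult[OF l_s(2,3)], of "-3/2"]
          bigo_powr_at_mono[OF bigo_powr_mult[OF l_s(1,4)], of "-3/2"] by (intro F'_le) simp_all
    next
      case 2
      show ?thesis unfolding 2
        using bigo_powr_at_mono[OF bigo_powr_mult[OF l_t(2,3)], of "-3/2"]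
          bigo_powr_at_mono[OF bigo_powr_mult[OF l_t(1,4)], of "-3/2"] by (intro F'_le) simp_all
    qed
  next
    \<comment> \<open>At infinity 1/w is small and D(1/w) = -D(w) applies.\<close>
    have "\<forall>\<^sub>F u in at_infinity. \<bar>bloch_wigner (w u)\<bar> \<le> K + pi * \<bar>ls u\<bar>"
    proof -
      have "\<forall>\<^sub>F u::complex in at_infinity. norm s + 2 * c \<le> norm u" unfolding eventually_at_infinity by auto
      then show ?thesis
      proof (rule eventually_mono)
        fix u :: complex assume "norm s + 2 * c \<le> norm u"
        then have "2 * c \<le> norm (u - s)" using norm_triangle_ineq2[of u s] by linarith
        then have n: "2 \<le> norm (w u)" using c by (simp add: nw field_simps)
        then have "w u \<noteq> 0" "w u \<noteq> 1" by auto
        moreover have "norm (1 / w u) \<le> 1/2"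
          using le_imp_inverse_le[OF n] by (simp add: norm_divide inverse_eq_divide)
        ultimately show "\<bar>bloch_wigner (w u)\<bar> \<le> K + pi * \<bar>ls u\<bar>"
          using K[of "1 / w u"] bloch_wigner_inverse[of "w u"] n
          by (simp add: norm_divide ln_div) (simp add: nw ls_def)
      qed
    qed
    from F_le[OF _ _ _ this]
    show "(\<lambda>u. norm (bw_primitive s t u)) \<in> O[at_infinity](\<lambda>u. norm u powr (1/2))"
      using bigo_powr_mult[OF l_i(1,2)] bigo_powr_at_infinity_mono[OF bigo_powr_0(2)[OF tendsto_const[of 1]], of "1/2"]
        bigo_powr_at_infinity_mono[OF l_i(1), of "1/2"] by simp
    show "(\<lambda>u. norm (F' u h)) \<in> O[at_infinity](\<lambda>u. norm u powr (-1/2))" for h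
      using bigo_powr_at_infinity_mono[OF bigo_powr_mult[OF l_i(2,3)], of "-1/2"]
        bigo_powr_at_infinity_mono[OF bigo_powr_mult[OF l_i(1,4)], of "-1/2"] by (intro F'_le) simp_all
  qed auto
  moreover have "F' u 1 + \<i> * F' u \<i> = 2 * complex_of_real (ln (norm (u - t) / norm (t - s))) / (cnj u - cnj s)" for u
    by (simp add: F'_def c_def algebra_simps)
  ultimately show ?thesis by (simp only:)
qed

lemma borel_measurable_cnj [measurable]: "cnj \<in> borel_measurable borel"
  by (intro borel_measurable_continuous_onI continuous_intros)

section \<open>Absolute integrability of the tree integrand in both vertices\<close>

lemma integrable_convolution_kernel:
  fixes f g :: "'a::euclidean_space \<Rightarrow> real"
  assumes f: "integrable lborel f" and g: "integrable lborel g"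
  shows "integrable (lborel \<Otimes>\<^sub>M lborel) (\<lambda>(u, v). f u * g (v - u))"
proof (rule lborel_pair.Fubini_integrable)
  have [measurable]: "f \<in> borel_measurable borel" "g \<in> borel_measurable borel"
    using f g by (auto dest: borel_measurable_integrable)
  show "(\<lambda>(u, v). f u * g (v - u)) \<in> borel_measurable (lborel \<Otimes>\<^sub>M lborel)" by measurable
  have "(\<integral>v. \<bar>g (v - u)\<bar> \<partial>lborel) = (\<integral>v. \<bar>g v\<bar> \<partial>lborel)" for u
    using g by (intro integrable_lborel_shift(2)[where f = "\<lambda>v. \<bar>g v\<bar>"]) simp
  then show "integrable lborel (\<lambda>u. \<integral>v. norm (case (u, v) of (u, v) \<Rightarrow> f u * g (v - u)) \<partial>lborel)"
    using f by (simp add: abs_mult)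
  show "AE u in lborel. integrable lborel (\<lambda>v. case (u, v) of (u, v) \<Rightarrow> f u * g (v - u))"
    using integrable_lborel_shift(1)[OF g] by (auto intro!: AE_I2)
qed

text \<open>The range of t comes from the critical exponent 2: t < 2 at the two poles and 2 t > 2 at
  infinity.\<close>

lemma integrable_inverse_norm_pair_powr:
  fixes p q :: complex
  assumes "p \<noteq> q" "1 < t" "t < 2"
  shows "integrable lborel (\<lambda>u. (inverse (norm (u - p)) * inverse (norm (u - q))) powr t)"
proof (rule integrable_complex_singularities[where S = "{p, q}" and \<alpha> = t and \<beta> = "t + t"])
  show "continuous_on (- {p, q}) (\<lambda>u. (inverse (norm (u - p)) * inverse (norm (u - q))) powr t)"
    by (intro continuous_intros) auto
  have pw: "(\<lambda>u. inverse (norm (u - s)) powr t) \<in> O[at s](\<lambda>u. norm (u - s) powr (- t))" for s :: complex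
    by (rule bigoI[where c = 1]) (simp add: powr_minus inverse_powr)
  have pw': "(\<lambda>u. inverse (norm (u - s)) powr t) \<in> O[at s'](\<lambda>u. norm (u - s') powr 0)" if "s \<noteq> s'" for s s' :: complex
    using that by (intro bigo_powr_0(1)[where c = "inverse (norm (s' - s)) powr t"] tendsto_intros) auto
  have pwi: "(\<lambda>u. inverse (norm (u - s)) powr t) \<in> O[at_infinity](\<lambda>u. norm u powr (- t))" for s :: complex
  proof -
    obtain K where K: "K > 0" "\<forall>\<^sub>F u in at_infinity. norm (inverse (norm (u - s))) \<le> K * norm (norm u powr (- 1))"
      using landau_o.bigE[OF norm_diff_bigo_at_infinity(2)] by blast
    show ?thesis
    proof (rule bigoI[where c = "K powr t"], use K(2) in eventually_elim)
      case (elim u)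
      then have "inverse (norm (u - s)) powr t \<le> (K * inverse (norm u)) powr t"
        using assms by (intro powr_mono2) (auto simp: powr_minus)
      then show ?case using K(1) by (simp add: powr_mult powr_minus inverse_powr)
    qed
  qed
  show "(\<lambda>u. norm ((inverse (norm (u - p)) * inverse (norm (u - q))) powr t)) \<in> O[at s](\<lambda>u. norm (u - s) powr - t)"
    if "s \<in> {p, q}" for s
    using that bigo_powr_mult[OF pw pw'[OF assms(1)[symmetric]]] bigo_powr_mult[OF pw'[OF assms(1)] pw]
    by (auto simp: powr_mult)
  show "(\<lambda>u. norm ((inverse (norm (u - p)) * inverse (norm (u - q))) powr t)) \<in> O[at_infinity](\<lambda>u. norm u powr - (t + t))"
    using bigo_powr_mult[OF pwi[of p] pwi[of q]] by (simp add: powr_mult)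
qed (use assms in auto)

text \<open>Each bound replaces both factors by their maximum, in the second case after writing
  b^(3/4) as c^2 with c = b^(3/8). The resulting exponents 7/4 and 9/8 of b lie between 1 and 2; for
  k = 1/|v| the power 7/4 is integrable near 0 and the power 3 near infinity.\<close>

lemma powr_young_max:
  fixes b k :: real
  assumes "0 \<le> b" "0 \<le> k"
  shows "b powr (3/4) * k \<le> b powr (7/4) + k powr (7/4)"
    and "b powr (3/4) * k \<le> b powr (9/8) + k powr 3"
proof -
  have 1: "b powr (3/4) * k \<le> m powr (3/4) * m powr 1" if "b \<le> m" "k \<le> m" for m
    using that assms by (intro mult_mono powr_mono2) auto
  have "b powr (3/4) * k \<le> max b k powr (7/4)"
  proof -
    have "max b k powr (3/4) * max b k powr 1 = max b k powr (7/4)"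
      by (simp only: powr_add[symmetric]) simp
    then show ?thesis using 1[of "max b k"] by simp
  qed
  also have "\<dots> \<le> b powr (7/4) + k powr (7/4)" by (auto simp: max_def)
  finally show "b powr (3/4) * k \<le> b powr (7/4) + k powr (7/4)" .
  define c where "c = b powr (3/8)"
  have c: "c powr 2 = b powr (3/4)" "c powr 3 = b powr (9/8)" by (simp_all add: c_def powr_powr)
  have "c powr 2 * k \<le> max c k powr 2 * max c k powr 1"
    using assms by (intro mult_mono powr_mono2) (auto simp: c_def)
  also have "\<dots> = max c k powr 3" by (simp only: powr_add[symmetric]) simp
  also have "\<dots> \<le> c powr 3 + k powr 3" by (auto simp: max_def)
  finally show "b powr (3/4) * k \<le> b powr (9/8) + k powr 3" by (simp only: c)
qed

text \<open>The tree whose vertex u is joined to z1 and z2 and whose vertex v is joined to z3 and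
  z4; the remaining factor is the internal line between u and v.\<close>

definition tree_kernel :: "complex \<Rightarrow> complex \<Rightarrow> complex \<Rightarrow> complex \<Rightarrow> complex \<Rightarrow> complex \<Rightarrow> complex" where
  "tree_kernel z1 z2 z3 z4 u v =
     1 / ((z1 - u) * (u - z2)) * (1 / ((cnj u - cnj v) * (v - z4) * (cnj v - cnj z3)))"

text \<open>With \<open>a\<close>, \<open>b\<close> the outer factors and \<open>k\<close> the inner propagator,
  \<open>abk \<le> a\<^sup>5\<^sup>/\<^sup>4 (b\<^sup>3\<^sup>/\<^sup>4 k) + (a\<^sup>3\<^sup>/\<^sup>4 k) b\<^sup>5\<^sup>/\<^sup>4\<close>; the powers above 1 are integrable and the bracketed
  factors have bounded integrals by Young's inequality.\<close>

lemma integrable_tree_kernel: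
  assumes "z1 \<noteq> z2" "z3 \<noteq> z4"
  shows "integrable (lborel \<Otimes>\<^sub>M lborel) (\<lambda>(u, v). tree_kernel z1 z2 z3 z4 u v)"
proof -
  define a where "a u = inverse (norm (u - z1)) * inverse (norm (u - z2))" for u
  define b where "b v = inverse (norm (v - z3)) * inverse (norm (v - z4))" for v
  define k :: "complex \<Rightarrow> real" where "k v = inverse (norm v)" for v
  \<comment> \<open>The minimum selects the power 7/4 near 0 and the power 3 at infinity, so it is
    integrable on the whole plane although neither power is.\<close>
  define m where "m v = min (k v powr (7/4)) (k v powr 3)" for v
  define A where "A u = a u powr (7/4) + a u powr (9/8)" for u
  define B where "B v = b v powr (7/4) + b v powr (9/8)" for v
  have pos: "a u \<ge> 0" "b u \<ge> 0" "k u \<ge> 0" "m u \<ge> 0" for u by (auto simp: a_def b_def k_def m_def)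
  have ia: "integrable lborel (\<lambda>u. a u powr t)" "integrable lborel (\<lambda>u. b u powr t)" if "1 < t" "t < 2" for t
    unfolding a_def b_def using integrable_inverse_norm_pair_powr assms that by auto
  have [measurable]: "a \<in> borel_measurable borel" "b \<in> borel_measurable borel" "k \<in> borel_measurable borel"
    unfolding a_def b_def k_def by measurable
  have im: "integrable lborel m"
  proof (rule integrable_complex_singularities[where S = "{0}" and \<alpha> = "7/4" and \<beta> = 3])
    show "continuous_on (- {0}) m" unfolding m_def k_def by (intro continuous_intros) auto
    show "(\<lambda>u. norm (m u)) \<in> O[at s](\<lambda>u. norm (u - s) powr - (7 / 4))" if "s \<in> {0}" for s
      using that pos by (intro bigoI[where c = 1]) (auto simp: m_def k_def powr_minus inverse_powr)
    show "(\<lambda>u. norm (m u)) \<in> O[at_infinity](\<lambda>u. norm u powr - 3)"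
      using pos by (intro bigoI[where c = 1]) (auto simp: m_def k_def powr_minus inverse_powr)
  qed auto
  have iAB: "integrable lborel A" "integrable lborel B"
    unfolding A_def B_def by (auto intro!: ia)
  have mneg: "m (- v) = m v" for v by (simp add: m_def k_def)
  have ksym: "k (u - v) = k (v - u)" for u v by (simp add: k_def norm_minus_commute)
  have bk: "b v powr (3/4) * k (u - v) \<le> B v + m (v - u)" for u v
    unfolding B_def m_def min_def ksym[of u v]
    using powr_young_max[OF pos(2,3), of v "v - u"] powr_ge_zero[of "b v" "7/4"] powr_ge_zero[of "b v" "9/8"]
    by (split if_split) linarith
  have ak: "a u powr (3/4) * k (u - v) \<le> A u + m (v - u)" for u v
    unfolding A_def m_def min_def ksym[of u v]
    using powr_young_max[OF pos(1,3), of u "v - u"] powr_ge_zero[of "a u" "7/4"] powr_ge_zero[of "a u" "9/8"]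
    by (split if_split) linarith
  have le: "a u * k (u - v) * b v \<le> a u powr (5/4) * (B v + m (v - u)) + (A u + m (v - u)) * b v powr (5/4)" for u v
  proof -
    \<comment> \<open>A quarter power of the smaller factor is replaced by the same power of the
      larger one.\<close>
    have amgm: "x * y \<le> x powr (5/4) * y powr (3/4) + x powr (3/4) * y powr (5/4)" if "x \<ge> 0" "y \<ge> 0" for x y :: real
    proof (cases "x \<le> y")
      case True
      have "x * y = x powr (3/4) * x powr (1/4) * y"
        using that by (simp flip: powr_add)
      also have "\<dots> \<le> x powr (3/4) * y powr (1/4) * y"
        using True that by (intro mult_left_mono mult_right_mono powr_mono2) auto
      also have "\<dots> = x powr (3/4) * (y powr (1/4) * y powr 1)" using that by simp
      also have "y powr (1/4) * y powr 1 = y powr (5/4)" by (simp only: powr_add[symmetric]) simp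
      finally show ?thesis using powr_ge_zero[of x "5/4"] powr_ge_zero[of y "3/4"] by (simp add: add_increasing)
    next
      case False
      have "x * y = x * (y powr (1/4) * y powr (3/4))"
        using that by (simp flip: powr_add)
      also have "\<dots> \<le> x * (x powr (1/4) * y powr (3/4))"
        using False that by (intro mult_left_mono mult_right_mono powr_mono2) auto
      also have "\<dots> = (x powr 1 * x powr (1/4)) * y powr (3/4)" using that by simp
      also have "x powr 1 * x powr (1/4) = x powr (5/4)" by (simp only: powr_add[symmetric]) simp
      finally show ?thesis by (simp add: add_increasing2)
    qed
    have "(a u * b v) * k (u - v) \<le> (a u powr (5/4) * b v powr (3/4) + a u powr (3/4) * b v powr (5/4)) * k (u - v)"
      using amgm pos by (intro mult_right_mono) auto
    also have "\<dots> = a u powr (5/4) * (b v powr (3/4) * k (u - v)) + (a u powr (3/4) * k (u - v)) * b v powr (5/4)"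
      by (simp add: algebra_simps)
    also have "\<dots> \<le> a u powr (5/4) * (B v + m (v - u)) + (A u + m (v - u)) * b v powr (5/4)"
      by (intro add_mono mult_left_mono mult_right_mono bk ak) auto
    finally show ?thesis by (simp add: mult_ac)
  qed
  show ?thesis
  proof (rule Bochner_Integration.integrable_bound)
    have prod: "integrable (lborel \<Otimes>\<^sub>M lborel) (\<lambda>(u::complex, v::complex). f u * g v)"
      if "integrable lborel f" "integrable lborel g" for f g :: "complex \<Rightarrow> real"
    proof (rule lborel_pair.Fubini_integrable)
      have [measurable]: "f \<in> borel_measurable borel" "g \<in> borel_measurable borel"
        using that by (auto dest: borel_measurable_integrable)
      show "(\<lambda>(u, v). f u * g v) \<in> borel_measurable (lborel \<Otimes>\<^sub>M lborel)" by measurable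
      show "integrable lborel (\<lambda>u. \<integral>v. norm (case (u, v) of (u, v) \<Rightarrow> f u * g v) \<partial>lborel)"
        using that by (simp add: abs_mult)
    qed (use that in \<open>auto intro!: AE_I2\<close>)
    have m2: "integrable (lborel \<Otimes>\<^sub>M lborel) (\<lambda>(u, v). b v powr (5/4) * m (v - u))"
      using lborel_pair.integrable_product_swap[OF integrable_convolution_kernel[OF ia(2)[of "5/4"] im]]
        mneg[of "_ - _"] by (simp add: case_prod_unfold)
    show "integrable (lborel \<Otimes>\<^sub>M lborel) (\<lambda>(u, v). a u powr (5/4) * (B v + m (v - u)) + (A u + m (v - u)) * b v powr (5/4))"
      using Bochner_Integration.integrable_add[OF Bochner_Integration.integrable_add[OF prod[OF ia(1)[of "5/4"] iAB(2)] integrable_convolution_kernel[OF ia(1)[of "5/4"] im]]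
          Bochner_Integration.integrable_add[OF prod[OF iAB(1) ia(2)[of "5/4"]] m2]]
      by (simp add: case_prod_unfold algebra_simps)
    show "(\<lambda>(u, v). tree_kernel z1 z2 z3 z4 u v) \<in> borel_measurable (lborel \<Otimes>\<^sub>M lborel)"
      unfolding tree_kernel_def by measurable
    have n: "norm (tree_kernel z1 z2 z3 z4 u v) = a u * k (u - v) * b v" for u v
    proof -
      have "norm (cnj u - cnj v) = norm (u - v)" "norm (cnj v - cnj z3) = norm (v - z3)"
        by (simp_all flip: complex_cnj_diff)
      then show ?thesis
        by (simp add: tree_kernel_def a_def b_def k_def norm_mult norm_divide inverse_eq_divide
            norm_minus_commute[of z1 u])
    qed
    show "AE x in lborel \<Otimes>\<^sub>M lborel. norm (case x of (u, v) \<Rightarrow> tree_kernel z1 z2 z3 z4 u v)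
       \<le> norm (case x of (u, v) \<Rightarrow> a u powr (5/4) * (B v + m (v - u)) + (A u + m (v - u)) * b v powr (5/4))"
      using le n by (auto intro!: AE_I2 intro: order_trans[OF _ abs_ge_self])
  qed
qed

lemma integral_tree_kernel:
  assumes d: "distinct [z1, z2, z3, z4]"
  shows "(\<integral>(u, v). tree_kernel z1 z2 z3 z4 u v \<partial>(lborel \<Otimes>\<^sub>M lborel))
    = 2 * (of_real pi)\<^sup>2 * (bw_primitive z3 z4 z1 - bw_primitive z3 z4 z2) / (z1 - z2)"
proof -
  let ?l = "\<lambda>u. complex_of_real (ln (norm (u - z4) / norm (z4 - z3)))"
  have inner: "(\<integral>v. tree_kernel z1 z2 z3 z4 u v \<partial>lborel)
      = of_real pi / (z1 - z2) * (2 * ?l u / (cnj u - cnj z3) * (1 / (u - z2) - 1 / (u - z1)))"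
    if u: "u \<notin> {z1, z2, z3, z4}" for u
  proof -
    have "AE v in lborel. v \<notin> {u, z3, z4}"
      by (intro AE_not_in) (auto intro: countable_imp_null_set_lborel)
    then have "AE v in lborel. 1 / ((cnj u - cnj v) * (v - z4) * (cnj v - cnj z3))
        = 1 / (v - z4) * (1 / (cnj v - cnj z3) - 1 / (cnj v - cnj u)) * (1 / (cnj u - cnj z3))"
    proof eventually_elim
      case (elim v)
      have nz: "cnj u - cnj v \<noteq> 0" "v - z4 \<noteq> 0" "cnj v - cnj z3 \<noteq> 0" "cnj u - cnj z3 \<noteq> 0" "cnj v - cnj u \<noteq> 0"
        using elim u by auto
      \<comment> \<open>Partial fractions in the conjugate of v produce a difference kernel with
        poles z3 and u, leaving a factor that does not depend on v.\<close>
      have "1 / (cnj v - cnj z3) - 1 / (cnj v - cnj u) = (cnj u - cnj z3) / ((cnj u - cnj v) * (cnj v - cnj z3))"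
        using nz by (simp add: divide_simps) (simp add: algebra_simps)
      then show ?case using nz by simp
    qed
    then have "(\<integral>v. 1 / ((cnj u - cnj v) * (v - z4) * (cnj v - cnj z3)) \<partial>lborel)
        = (\<integral>v. 1 / (v - z4) * (1 / (cnj v - cnj z3) - 1 / (cnj v - cnj u)) * (1 / (cnj u - cnj z3)) \<partial>lborel)"
      by (intro integral_cong_AE) measurable
    also have "\<dots> = of_real (2 * pi * (ln (norm (u - z4)) - ln (norm (z3 - z4)))) * (1 / (cnj u - cnj z3))"
      by (rule has_bochner_integral_integral_eq, rule has_bochner_integral_mult_left,
          rule integral_ln_kernel) (use u d in auto)
    also have "ln (norm (u - z4)) - ln (norm (z3 - z4)) = ln (norm (u - z4) / norm (z4 - z3))"
      using u d by (auto simp: ln_div norm_minus_commute)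
    finally have I: "(\<integral>v. 1 / ((cnj u - cnj v) * (v - z4) * (cnj v - cnj z3)) \<partial>lborel) = 2 * of_real pi * ?l u / (cnj u - cnj z3)"
      by simp
    have "z1 - u \<noteq> 0" "u - z1 \<noteq> 0" "u - z2 \<noteq> 0" "z1 - z2 \<noteq> 0" using u d by auto
    \<comment> \<open>The outer factor is a difference kernel as well, with p = z2 and q = z1; this
      fixes the sign of the final difference of primitives.\<close>
    then have "1 / ((z1 - u) * (u - z2)) = (1 / (u - z2) - 1 / (u - z1)) / (z1 - z2)"
      by (simp add: divide_simps) (simp add: algebra_simps)
    then show ?thesis unfolding tree_kernel_def integral_mult_right_zero I by simp
  qed
  have "(\<integral>(u, v). tree_kernel z1 z2 z3 z4 u v \<partial>(lborel \<Otimes>\<^sub>M lborel)) = (\<integral>u. \<integral>v. tree_kernel z1 z2 z3 z4 u v \<partial>lborel \<partial>lborel)"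
    using lborel_pair.integral_fst'[OF integrable_tree_kernel[of z1 z2 z3 z4]] d by simp
  also have "\<dots> = (\<integral>u. of_real pi / (z1 - z2) * (2 * ?l u / (cnj u - cnj z3) * (1 / (u - z2) - 1 / (u - z1))) \<partial>lborel)"
  proof (rule integral_cong_AE)
    have "AE u in lborel. u \<notin> {z1, z2, z3, z4}"
      by (intro AE_not_in) (auto intro: countable_imp_null_set_lborel)
    then show "AE u in lborel. (\<integral>v. tree_kernel z1 z2 z3 z4 u v \<partial>lborel)
        = of_real pi / (z1 - z2) * (2 * ?l u / (cnj u - cnj z3) * (1 / (u - z2) - 1 / (u - z1)))"
      by eventually_elim (rule inner)
    show "(\<lambda>u. \<integral>v. tree_kernel z1 z2 z3 z4 u v \<partial>lborel) \<in> borel_measurable lborel"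
      unfolding tree_kernel_def by measurable
  qed measurable
  also have "\<dots> = of_real pi / (z1 - z2) * (2 * complex_of_real pi * (bw_primitive z3 z4 z1 - bw_primitive z3 z4 z2))"
    unfolding integral_mult_right_zero
    by (subst has_bochner_integral_integral_eq[OF integral_bw_primitive]) (use d in auto)
  finally show ?thesis by (simp add: power2_eq_square)
qed

text \<open>D is invariant under w -> 1/(1 - w), a composition of two sign-reversing symmetries, and
  this map sends (u - z3)/(z4 - z3) to (z3 - z4)/(u - z4). The logarithmic terms agree after
  expanding the logarithms of quotients.\<close>

lemma bw_primitive_difference:
  assumes d: "distinct [z1, z2, z3, z4]"
  shows "(bw_primitive z3 z4 z1 - bw_primitive z3 z4 z2) / (2 * (z1 - z2)) = BF_I z1 z2 z3 z4"
proof -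
  have D: "bloch_wigner ((u - z3) / (z4 - z3)) = bloch_wigner ((z3 - z4) / (u - z4))" if "u \<noteq> z3" "u \<noteq> z4" for u
  proof -
    let ?w = "(u - z3) / (z4 - z3)"
    have nz: "z4 \<noteq> z3" "u - z4 \<noteq> 0" "z4 - z3 \<noteq> 0" using that d by auto
    then have w: "?w \<noteq> 0" "?w \<noteq> 1" "1 - ?w \<noteq> 0" "1 - ?w \<noteq> 1" using that d by auto
    have e: "1 / (1 - ?w) = (z3 - z4) / (u - z4)"
      using that nz by (simp add: divide_simps) (simp add: algebra_simps)
    have "bloch_wigner (1 / (1 - ?w)) = bloch_wigner ?w"
      using bloch_wigner_inverse[OF w(3,4)] bloch_wigner_one_minus[OF w(1,2)] by simp
    then show ?thesis by (simp only: e)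
  qed
  have n: "norm (z1 - z3) > 0" "norm (z1 - z4) > 0" "norm (z2 - z3) > 0" "norm (z2 - z4) > 0" "norm (z3 - z4) > 0"
    using d by auto
  have "bw_primitive z3 z4 z1 - bw_primitive z3 z4 z2
     = \<i> * of_real (bloch_wigner ((z3 - z4) / (z1 - z4))) - \<i> * of_real (bloch_wigner ((z3 - z4) / (z2 - z4)))
        + of_real (ln (cmod ((z3 - z4) / (z1 - z4))) * ln (cmod ((z2 - z3) / (z1 - z3))))
        + of_real (ln (cmod ((z1 - z4) / (z2 - z4))) * ln (cmod ((z2 - z3) / (z3 - z4))))"
    using d D[of z1] D[of z2] n
    by (simp add: bw_primitive_def norm_divide ln_div norm_minus_commute[of z4 z3] algebra_simps)
  then show ?thesis by (simp add: BF_I_def)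
qed

section \<open>Wick contractions\<close>

text \<open>The predicate behind \<open>SOME\<close> is then constantly false, so the default value
  depends neither on the function nor on the point.\<close>

lemma frechet_derivative_not_differentiable:
  "\<not> f differentiable F \<Longrightarrow> frechet_derivative f F = (SOME f'. False)"
  by (simp add: frechet_derivative_def differentiable_def)

lemma wirtinger_const: "wirtinger (\<lambda>_. c) = (\<lambda>_. 0)" "wirtinger_bar (\<lambda>_. c) = (\<lambda>_. 0)"
  by (auto simp: wirtinger_def wirtinger_bar_def)

lemma not_differentiable_ln_norm:
  fixes a C p :: complex
  assumes "a \<noteq> 0"
  shows "\<not> (\<lambda>z. a * (complex_of_real (2 * ln (cmod (z - p))) + C)) differentiable (at p)"
proof
  let ?f = "\<lambda>z. a * (complex_of_real (2 * ln (cmod (z - p))) + C)"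
  assume "?f differentiable (at p)"
  from differentiable_imp_continuous_within[OF this] have "(?f \<longlongrightarrow> ?f p) (at p)"
    unfolding isCont_def .
  from tendsto_Re[OF tendsto_diff[OF tendsto_divide[OF this tendsto_const assms] tendsto_const[of C]]]
  have l: "((\<lambda>z. 2 * ln (cmod (z - p))) \<longlongrightarrow> Re (?f p / a - C)) (at p)"
    using assms by simp
  have "((\<lambda>z. cmod (z - p)) \<longlongrightarrow> cmod (p - p)) (at p)" by (intro tendsto_intros)
  then have "filterlim (\<lambda>z. cmod (z - p)) (at_right 0) (at p)"
    unfolding filterlim_at using eventually_neq_at_within[of p p UNIV] by (auto elim: eventually_mono)
  from filterlim_compose[OF ln_at_0 this]
  have "filterlim (\<lambda>z. ln (cmod (z - p))) at_bot (at p)" .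
  then have "filterlim (\<lambda>z. 2 * ln (cmod (z - p))) at_bot (at p)"
    using filterlim_tendsto_pos_mult_at_bot[OF tendsto_const[of 2]] by simp
  with l show False
    using not_tendsto_and_filterlim_at_infinity[OF _ l] filterlim_mono[OF _ at_bot_le_at_infinity order_refl] by auto
qed

lemma wirtinger_ln_norm:
  fixes a C :: complex
  obtains K K' where
    "\<And>z p. wirtinger (\<lambda>z. a * (complex_of_real (2 * ln (cmod (z - p))) + C)) z = (if z = p then K else a / (z - p))"
    "\<And>z p. wirtinger_bar (\<lambda>z. a * (complex_of_real (2 * ln (cmod (z - p))) + C)) z = (if z = p then K' else a / (cnj z - cnj p))"
proof -
  let ?f = "\<lambda>p z. a * (complex_of_real (2 * ln (cmod (z - p))) + C)"
  \<comment> \<open>For a = 0 the function is identically zero and has a genuine derivative at p,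
    hence the case distinction. In either case the value at p does not involve p.\<close>
  let ?D = "if a = 0 then (\<lambda>_. 0) else (SOME f' :: complex \<Rightarrow> complex. False)"
  have at: "frechet_derivative (?f p) (at p) = ?D" for p
    using frechet_derivative_not_differentiable[OF not_differentiable_ln_norm] by auto
  have off: "frechet_derivative (?f p) (at z) = (\<lambda>h. a * complex_of_real (2 * Re (h / (z - p))))" if "z \<noteq> p" for z p
  proof -
    have "((\<lambda>z. z - p) has_derivative (\<lambda>h. h)) (at z)" by (auto intro!: derivative_eq_intros)
    from has_derivative_compose[OF this has_derivative_ln_norm] that
    have "((\<lambda>z. ln (cmod (z - p))) has_derivative (\<lambda>h. Re (h / (z - p)))) (at z)" by simp
    then have "(?f p has_derivative (\<lambda>h. a * complex_of_real (2 * Re (h / (z - p))))) (at z)"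
      by (intro has_derivative_mult_right has_derivative_add_const has_derivative_of_real)
    then show ?thesis by (rule frechet_derivative_at[symmetric])
  qed
  have X: "of_real (2 * Re X) - \<i> * of_real (2 * Re (\<i> * X)) = 2 * X"
    "of_real (2 * Re X) + \<i> * of_real (2 * Re (\<i> * X)) = 2 * cnj X" for X
    by (auto simp: complex_eq_iff)
  show ?thesis
  proof (rule that[of "(?D 1 - \<i> * ?D \<i>) / 2" "(?D 1 + \<i> * ?D \<i>) / 2"])
    fix z p
    have "a * complex_of_real (2 * Re (1 / (z - p))) - \<i> * (a * complex_of_real (2 * Re (\<i> / (z - p)))) = 2 * (a / (z - p))"
      using arg_cong[OF X(1)[of "1 / (z - p)"], of "(*) a"] by (simp add: algebra_simps)
    then show "wirtinger (?f p) z = (if z = p then (?D 1 - \<i> * ?D \<i>) / 2 else a / (z - p))"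
      using at[of p] off[of z p] by (simp add: wirtinger_def)
    have "a * complex_of_real (2 * Re (1 / (z - p))) + \<i> * (a * complex_of_real (2 * Re (\<i> / (z - p)))) = 2 * (a / (cnj z - cnj p))"
      using arg_cong[OF X(2)[of "1 / (z - p)"], of "(*) a"] by (simp add: algebra_simps)
    then show "wirtinger_bar (?f p) z = (if z = p then (?D 1 + \<i> * ?D \<i>) / 2 else a / (cnj z - cnj p))"
      using at[of p] off[of z p] by (simp add: wirtinger_bar_def)
  qed
qed

text \<open>The combination \<open>(#a - #\<gamma>) + x(#a\<bar> - #\<gamma>\<bar>) + x\<^sup>2(#c - #b)\<close> of the conserved charges,
  with a parameter \<open>x\<close> that separates them.\<close>

fun charge :: "int \<Rightarrow> ('k, 'g) derfield \<Rightarrow> int" where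
  "charge x (Der m n (Fa \<theta>)) = 1"
| "charge x (Der m n (Fgamma X)) = - 1"
| "charge x (Der m n (Fabar \<theta>)) = x"
| "charge x (Der m n (Fgammabar X)) = - x"
| "charge x (Der m n (Fc \<theta>)) = x * x"
| "charge x (Der m n (Fb X)) = - (x * x)"

context bf_theory
begin

lemma contraction_eq_0:
  assumes "charge x (fst X) + charge x (fst Y) \<noteq> 0"
  shows "contraction X Y = 0"
proof -
  obtain m n \<phi> w l m' n' \<psi> z l' where XY: "X = (Der m n \<phi>, w, l)" "Y = (Der m' n' \<psi>, z, l')"
    by (metis derfield.exhaust prod.exhaust)
  have "propagator \<phi> \<psi> w = (\<lambda>_. 0)" for w
    using assms unfolding XY by (intro ext) (cases \<phi>; cases \<psi>; auto)
  moreover have "(wirtinger ^^ m) (\<lambda>_. 0) = (\<lambda>_. 0)" "(wirtinger_bar ^^ m) (\<lambda>_. 0) = (\<lambda>_. 0)" for m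
    by (induction m) (auto simp: wirtinger_const)
  ultimately show ?thesis by (simp add: XY)
qed

text \<open>A nonzero contraction removes two fields of opposite charge, so every step of the
  recursion preserves the total charge, which is zero for the empty list.\<close>

lemma wick_eq_0:
  assumes "(\<Sum>X\<leftarrow>xs. charge x (fst X)) \<noteq> 0"
  shows "wick xs = 0"
  using assms
proof (induction xs rule: wick.induct)
  case 1
  then show ?case by simp
next
  case (2 X xs)
  have "contraction X (xs ! j) * wick (take j xs @ drop (Suc j) xs) = 0" if j: "j < length xs" for j
  proof (cases "charge x (fst X) + charge x (fst (xs ! j)) = 0")
    case True
    have "(\<Sum>X\<leftarrow>xs. charge x (fst X)) = (\<Sum>X\<leftarrow>take j xs @ xs ! j # drop (Suc j) xs. charge x (fst X))"
      using j by (simp flip: id_take_nth_drop)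
    then have "(\<Sum>X\<leftarrow>take j xs @ drop (Suc j) xs. charge x (fst X)) \<noteq> 0"
      using 2(2) True by simp
    then have "wick (take j xs @ drop (Suc j) xs) = 0" using 2(1) j by auto
    then show ?thesis by simp
  qed (simp add: contraction_eq_0)
  then show ?case by (auto intro!: sum.neutral simp: mult.assoc)
qed

text \<open>At x = 2 the charges have absolute values 1, 2 and 4, so two of them add up to zero
  exactly for conjugate fields. This makes the vanishing of a contraction a decidable test on
  constructors and labels.\<close>

definition compatible :: "('k, 'g) insertion \<Rightarrow> ('k, 'g) insertion \<Rightarrow> bool" where
  "compatible X Y \<longleftrightarrow> charge 2 (fst X) + charge 2 (fst Y) = 0 \<and> snd (snd X) \<noteq> snd (snd Y)"

lemma contraction_incompatible: "\<not> compatible X Y \<Longrightarrow> contraction X Y = 0"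
proof (cases "snd (snd X) = snd (snd Y)")
  case True
  obtain m n \<phi> w l m' n' \<psi> z l' where "X = (Der m n \<phi>, w, l)" "Y = (Der m' n' \<psi>, z, l')"
    by (metis derfield.exhaust prod.exhaust)
  with True show ?thesis by simp
qed (auto simp: compatible_def intro: contraction_eq_0)

text \<open>The Wick expansion as a recursion along the list, with \<open>ys\<close> collecting the
  factors already passed. Incompatible pairs are dropped before the remaining product is expanded,
  which keeps the evaluation of ten fields small.\<close>

fun wick_row :: "('k, 'g) insertion \<Rightarrow> ('k, 'g) insertion list \<Rightarrow> ('k, 'g) insertion list \<Rightarrow> complex" where
  "wick_row X ys [] = 0"
| "wick_row X ys (z # zs) =
     (if compatible X z
      then (if odd_field (fst z) then (- 1) ^ length (filter (\<lambda>y. odd_field (fst y)) ys) else 1)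
        * contraction X z * wick (ys @ zs) else 0)
     + wick_row X (ys @ [z]) zs"

lemma wick_Cons: "wick (X # xs) = wick_row X [] xs"
proof -
  have "wick_row X ys zs = (\<Sum>j<length zs.
        (if odd_field (fst (zs ! j))
         then (- 1) ^ length (filter (\<lambda>y. odd_field (fst y)) (ys @ take j zs)) else 1)
        * contraction X (zs ! j) * wick (ys @ take j zs @ drop (Suc j) zs))" for ys zs
  proof (induction zs arbitrary: ys)
    case (Cons z zs)
    show ?case
      by (simp only: length_Cons sum.lessThan_Suc_shift) (use Cons[of "ys @ [z]"] contraction_incompatible in \<open>auto cong: if_cong\<close>)
  qed simp
  from this[of "[]"] show ?thesis by (simp only: wick.simps append_Nil)
qed

text \<open>At coinciding points the logarithm is not differentiable and its Wirtinger derivative is the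
  junk value of \<open>SOME\<close> on an empty predicate. Being the same at all points, it does not spoil the
  measurability of the free correlator.\<close>

lemma contraction_db_c:
  assumes "l \<noteq> l'"
  obtains K where "\<And>u v. contraction (Der 1 0 (Fb X), u, l) (Fund (Fc \<theta>), v, l')
    = (if u = v then K else - emb (\<theta> X) / (u - v))"
proof -
  obtain K K' where "\<And>z p. wirtinger (\<lambda>z. - emb (\<theta> X) * (complex_of_real (2 * ln (cmod (z - p))) + log_const)) z
      = (if z = p then K else - emb (\<theta> X) / (z - p))" using wirtinger_ln_norm by metis
  then show ?thesis using assms by (intro that[of K]) (simp add: norm_minus_commute)
qed

lemma contraction_c_db:
  assumes "l \<noteq> l'"
  obtains K where "\<And>u v. contraction (Fund (Fc \<theta>), u, l) (Der 1 0 (Fb X), v, l')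
    = (if u = v then K else emb (\<theta> X) / (v - u))"
proof -
  obtain K K' where "\<And>z p. wirtinger (\<lambda>z. emb (\<theta> X) * (complex_of_real (2 * ln (cmod (z - p))) + log_const)) z
      = (if z = p then K else emb (\<theta> X) / (z - p))" using wirtinger_ln_norm by metis
  moreover have "propagator (Fc \<theta>) (Fb X) u = (\<lambda>z. emb (\<theta> X) * (complex_of_real (2 * ln (cmod (z - u))) + log_const))" for u
    by (rule ext) (simp add: norm_minus_commute)
  ultimately show ?thesis using assms by (intro that[of K]) auto
qed

lemma contraction_dbarb_c:
  assumes "l \<noteq> l'"
  obtains K where "\<And>u v. contraction (Der 0 1 (Fb X), u, l) (Fund (Fc \<theta>), v, l')
    = (if u = v then K else - emb (\<theta> X) / (cnj u - cnj v))"
proof -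
  obtain K K' where "\<And>z p. wirtinger_bar (\<lambda>z. - emb (\<theta> X) * (complex_of_real (2 * ln (cmod (z - p))) + log_const)) z
      = (if z = p then K' else - emb (\<theta> X) / (cnj z - cnj p))" using wirtinger_ln_norm by metis
  then show ?thesis using assms by (intro that[of K']) (simp add: norm_minus_commute)
qed

lemma contraction_c_dbarb:
  assumes "l \<noteq> l'"
  obtains K where "\<And>u v. contraction (Fund (Fc \<theta>), u, l) (Der 0 1 (Fb X), v, l')
    = (if u = v then K else emb (\<theta> X) / (cnj v - cnj u))"
proof -
  obtain K K' where "\<And>z p. wirtinger_bar (\<lambda>z. emb (\<theta> X) * (complex_of_real (2 * ln (cmod (z - p))) + log_const)) z
      = (if z = p then K' else emb (\<theta> X) / (cnj z - cnj p))" using wirtinger_ln_norm by metis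
  moreover have "propagator (Fc \<theta>) (Fb X) u = (\<lambda>z. emb (\<theta> X) * (complex_of_real (2 * ln (cmod (z - u))) + log_const))" for u
    by (rule ext) (simp add: norm_minus_commute)
  ultimately show ?thesis using assms by (intro that[of K']) auto
qed

section \<open>The embedding of the ground field and sums over structure constants\<close>

lemma emb_0 [simp]: "emb 0 = 0"
  using emb_add[of 0 0] by simp

lemma emb_minus [simp]: "emb (- x) = - emb x"
  using emb_add[of x "- x"] by (simp add: eq_neg_iff_add_eq_0 add.commute)

lemma emb_sum: "emb (sum f A) = (\<Sum>x\<in>A. emb (f x))"
  by (induction A rule: infinite_finite_induct) (simp_all add: emb_add)

text \<open>Completeness of the basis: this is how the index carried by a propagator is summed
  away.\<close>

lemma sum_emb_coord:
  assumes "Vector_Spaces.linear scale (*) \<mu>"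
  shows "(\<Sum>e\<in>Basis. emb (coord e X) * emb (\<mu> e)) = emb (\<mu> X)"
proof -
  interpret l: Vector_Spaces.linear scale "(*)" \<mu> by fact
  have "\<mu> X = \<mu> (\<Sum>e\<in>Basis. scale (coord e X) e)"
    unfolding coord_def
    by (subst sum_representation_eq) (auto simp: independent_Basis span_Basis finite_Basis)
  also have "\<dots> = (\<Sum>e\<in>Basis. coord e X * \<mu> e)"
    by (simp add: l.sum l.scale)
  finally show ?thesis by (simp add: emb_sum emb_mult)
qed

lemma linear_coord: "Vector_Spaces.linear scale (*) (coord e)"
  unfolding Vector_Spaces.linear_iff coord_def
  using independent_Basis span_Basis vector_space_axioms
  by (auto simp: representation_add representation_scale vector_space_def algebra_simps)

lemma linear_comp_bracket:
  assumes "Vector_Spaces.linear scale (*) \<mu>"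
  shows "Vector_Spaces.linear scale (*) (\<lambda>y. \<mu> (bracket x y))"
    and "Vector_Spaces.linear scale (*) (\<lambda>y. \<mu> (bracket y x))"
  using assms bracket_linear_left[of x] bracket_linear_right[of x]
  by (auto simp: Vector_Spaces.linear_iff)

lemma bracket_anti: "bracket x y = - bracket y x"
proof -
  interpret l: Vector_Spaces.linear scale scale "\<lambda>x. bracket x z" for z by (rule bracket_linear_left)
  interpret r: Vector_Spaces.linear scale scale "bracket z" for z by (rule bracket_linear_right)
  have "bracket x x + bracket y x + (bracket x y + bracket y y) = 0"
    using bracket_alternating[of "x + y"] by (simp only: l.add r.add)
  then have "bracket x y + bracket y x = 0" by (simp add: bracket_alternating add.commute)
  then show ?thesis by (rule eq_neg_iff_add_eq_0[THEN iffD2])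
qed

lemma vertex_charge:
  assumes "I \<in> vertex_indices"
  shows "(\<Sum>X\<leftarrow>vertex_insertions I u l. charge x (fst X)) = (if fst I \<in> {V_gamma, V_db} then x else 1)"
  using assms by (auto simp: vertex_indices_def vertex_insertions_def)

lemma contraction_bosonic:
  assumes "l \<noteq> l'"
  shows "contraction (Fund (Fa \<theta>), w, l) (Fund (Fgamma X), z, l') = emb (\<theta> X) / (w - z)"
    "contraction (Fund (Fgamma X), w, l) (Fund (Fa \<theta>), z, l') = emb (\<theta> X) / (z - w)"
    "contraction (Fund (Fabar \<theta>), w, l) (Fund (Fgammabar X), z, l') = emb (\<theta> X) / (cnj w - cnj z)"
    "contraction (Fund (Fgammabar X), w, l) (Fund (Fabar \<theta>), z, l') = emb (\<theta> X) / (cnj z - cnj w)"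
  using assms by auto

lemma sum_vertex_indices:
  "(\<Sum>I\<in>vertex_indices. F I) = (\<Sum>e\<in>Basis. \<Sum>f\<in>Basis.
     F (V_gamma, e, f) + F (V_gammabar, e, f) + F (V_db, e, f) + F (V_dbarb, e, f))"
  unfolding vertex_indices_def
  by (simp add: sum.cartesian_product' sum.distrib add.assoc)

lemma sum4_tree:
  assumes "Vector_Spaces.linear scale (*) \<mu>"
  shows "(\<Sum>e\<in>Basis. \<Sum>f\<in>Basis. \<Sum>e'\<in>Basis. \<Sum>f'\<in>Basis.
      emb (coord e Y) * emb (\<mu> (bracket e f)) * emb (coord f (bracket e' f')) * emb (coord e' Y') * emb (coord f' X))
    = emb (\<mu> (bracket Y (bracket Y' X)))"
proof -
  note lin = linear_coord linear_comp_bracket linear_comp_bracket(1)[OF assms] linear_comp_bracket(2)[OF assms]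
  have "(\<Sum>e\<in>Basis. \<Sum>f\<in>Basis. \<Sum>e'\<in>Basis. \<Sum>f'\<in>Basis.
      emb (coord e Y) * emb (\<mu> (bracket e f)) * emb (coord f (bracket e' f')) * emb (coord e' Y') * emb (coord f' X))
    = (\<Sum>e\<in>Basis. emb (coord e Y) * (\<Sum>f\<in>Basis. (\<Sum>e'\<in>Basis. emb (coord e' Y') * (\<Sum>f'\<in>Basis. emb (coord f' X) * emb (coord f (bracket e' f'))))
        * emb (\<mu> (bracket e f))))"
    by (simp add: sum_distrib_left sum_distrib_right mult_ac)
  also have "\<dots> = (\<Sum>e\<in>Basis. emb (coord e Y) * (\<Sum>f\<in>Basis. emb (coord f (bracket Y' X)) * emb (\<mu> (bracket e f))))"
    by (simp only: sum_emb_coord[OF linear_comp_bracket(1)[OF linear_coord]] sum_emb_coord[OF linear_comp_bracket(2)[OF linear_coord]])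
  also have "\<dots> = emb (\<mu> (bracket Y (bracket Y' X)))"
    by (simp only: sum_emb_coord[OF linear_comp_bracket(1)[OF assms]] sum_emb_coord[OF linear_comp_bracket(2)[OF assms]])
  finally show ?thesis .
qed

text \<open>The Killing form, the trace of ad X ad Y, in matrix entries and transported by
  \<open>emb\<close>.\<close>

definition ad_trace :: "'g \<Rightarrow> 'g \<Rightarrow> complex" where
  "ad_trace X Y = (\<Sum>f\<in>Basis. \<Sum>f'\<in>Basis. emb (coord f' (bracket X f)) * emb (coord f (bracket Y f')))"

lemma sum4_ghost:
  "(\<Sum>e\<in>Basis. \<Sum>f\<in>Basis. \<Sum>e'\<in>Basis. \<Sum>f'\<in>Basis.
      emb (coord e X) * emb (coord e' Y) * emb (coord f' (bracket e f)) * emb (coord f (bracket e' f')))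
   = ad_trace X Y"
proof -
  have "(\<Sum>e\<in>Basis. \<Sum>f\<in>Basis. \<Sum>e'\<in>Basis. \<Sum>f'\<in>Basis.
      emb (coord e X) * emb (coord e' Y) * emb (coord f' (bracket e f)) * emb (coord f (bracket e' f')))
   = (\<Sum>f\<in>Basis. \<Sum>e\<in>Basis. \<Sum>f'\<in>Basis. \<Sum>e'\<in>Basis.
      emb (coord e X) * emb (coord e' Y) * emb (coord f' (bracket e f)) * emb (coord f (bracket e' f')))"
    by (subst sum.swap, rule sum.cong[OF refl], rule sum.cong[OF refl], rule sum.swap)
  also have "\<dots> = (\<Sum>f\<in>Basis. \<Sum>f'\<in>Basis. \<Sum>e\<in>Basis. \<Sum>e'\<in>Basis.
      emb (coord e X) * emb (coord e' Y) * emb (coord f' (bracket e f)) * emb (coord f (bracket e' f')))"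
    by (rule sum.cong[OF refl], rule sum.swap)
  also have "\<dots> = (\<Sum>f\<in>Basis. \<Sum>f'\<in>Basis. (\<Sum>e\<in>Basis. emb (coord e X) * emb (coord f' (bracket e f)))
      * (\<Sum>e'\<in>Basis. emb (coord e' Y) * emb (coord f (bracket e' f'))))"
    by (simp only: sum_product) (simp add: mult_ac)
  finally show ?thesis
    unfolding ad_trace_def by (simp only: sum_emb_coord[OF linear_comp_bracket(2)[OF linear_coord]])
qed

text \<open>In the gauge loop one external vector enters its bracket on the left and the other on
  the right. Turning the second bracket around gives the sign, which is absent from the ghost
  loop.\<close>

lemma sum4_loop:
  "(\<Sum>e\<in>Basis. \<Sum>f\<in>Basis. \<Sum>e'\<in>Basis. \<Sum>f'\<in>Basis.
      emb (coord e Y) * emb (coord e' (bracket e f)) * emb (coord f (bracket e' f')) * emb (coord f' X))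
   = - ad_trace X Y"
proof -
  have "(\<Sum>e\<in>Basis. \<Sum>f\<in>Basis. \<Sum>e'\<in>Basis. \<Sum>f'\<in>Basis.
      emb (coord e Y) * emb (coord e' (bracket e f)) * emb (coord f (bracket e' f')) * emb (coord f' X))
   = (\<Sum>f\<in>Basis. \<Sum>e\<in>Basis. \<Sum>e'\<in>Basis. \<Sum>f'\<in>Basis.
      emb (coord e Y) * emb (coord e' (bracket e f)) * emb (coord f (bracket e' f')) * emb (coord f' X))"
    by (rule sum.swap)
  also have "\<dots> = (\<Sum>f\<in>Basis. \<Sum>e'\<in>Basis. \<Sum>e\<in>Basis. \<Sum>f'\<in>Basis.
      emb (coord e Y) * emb (coord e' (bracket e f)) * emb (coord f (bracket e' f')) * emb (coord f' X))"
    by (rule sum.cong[OF refl], rule sum.swap)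
  also have "\<dots> = (\<Sum>f\<in>Basis. \<Sum>e'\<in>Basis. (\<Sum>e\<in>Basis. emb (coord e Y) * emb (coord e' (bracket e f)))
      * (\<Sum>f'\<in>Basis. emb (coord f' X) * emb (coord f (bracket e' f'))))"
    by (simp only: sum_product) (simp add: mult_ac)
  also have "\<dots> = (\<Sum>f\<in>Basis. \<Sum>e'\<in>Basis. emb (coord e' (bracket Y f)) * emb (coord f (bracket e' X)))"
    by (simp only: sum_emb_coord[OF linear_comp_bracket(1)[OF linear_coord]] sum_emb_coord[OF linear_comp_bracket(2)[OF linear_coord]])
  also have "\<dots> = (\<Sum>f\<in>Basis. \<Sum>e'\<in>Basis. - (emb (coord e' (bracket Y f)) * emb (coord f (bracket X e'))))"
  proof (intro sum.cong refl)
    fix f e'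
    interpret l: Vector_Spaces.linear scale "(*)" "coord f" by (rule linear_coord)
    show "emb (coord e' (bracket Y f)) * emb (coord f (bracket e' X)) = - (emb (coord e' (bracket Y f)) * emb (coord f (bracket X e')))"
      by (simp add: bracket_anti[of e' X] l.neg)
  qed
  also have "\<dots> = - (\<Sum>e'\<in>Basis. \<Sum>f\<in>Basis. emb (coord f (bracket X e')) * emb (coord e' (bracket Y f)))"
    by (subst sum.swap) (simp add: sum_negf mult.commute)
  finally show ?thesis unfolding ad_trace_def .
qed

end

section \<open>The four-point correlator\<close>

lemma sum_PiE_lessThan_2:
  assumes "finite S"
  shows "(\<Sum>I\<in>{..<2::nat} \<rightarrow>\<^sub>E S. F (I 0) (I 1)) = (\<Sum>i\<in>S. \<Sum>j\<in>S. F i j)"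
proof -
  have "(\<Sum>I\<in>{..<2::nat} \<rightarrow>\<^sub>E S. F (I 0) (I 1)) = (\<Sum>(i, j)\<in>S \<times> S. F i j)"
  proof (rule sum.reindex_bij_witness[where j = "\<lambda>I. (I 0, I 1)" and i = "\<lambda>(a, b). \<lambda>k\<in>{..<2}. if k = 0 then a else b"])
    fix I assume I: "I \<in> {..<2::nat} \<rightarrow>\<^sub>E S"
    show "(case (I 0, I 1) of (a, b) \<Rightarrow> \<lambda>k\<in>{..<2}. if k = 0 then a else b) = I"
    proof
      fix k show "(case (I 0, I 1) of (a, b) \<Rightarrow> \<lambda>k\<in>{..<2}. if k = 0 then a else b) k = I k"
        using PiE_arb[OF I, of k] by (cases "k < 2") (auto simp: less_2_cases_iff)
    qed
  qed (auto simp: PiE_iff)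
  then show ?thesis by (simp add: sum.cartesian_product)
qed

lemma distr_PiM_lessThan_2:
  "distr (Pi\<^sub>M {..<2::nat} (\<lambda>_. lborel)) (lborel \<Otimes>\<^sub>M lborel) (\<lambda>u. (u 0, u 1)) = (lborel \<Otimes>\<^sub>M lborel :: ('a::euclidean_space \<times> 'a) measure)"
proof (rule measure_eqI)
  interpret product_sigma_finite "\<lambda>_::nat. lborel :: 'a measure"
    by unfold_locales
  have e: "{..<2::nat} = {0, 1}" by auto
  have m: "(\<lambda>u. (u 0, u 1)) \<in> Pi\<^sub>M {..<2::nat} (\<lambda>_. lborel :: 'a measure) \<rightarrow>\<^sub>M lborel \<Otimes>\<^sub>M lborel"
    by measurable
  fix A :: "('a \<times> 'a) set"
  assume "A \<in> sets (distr (Pi\<^sub>M {..<2::nat} (\<lambda>_. lborel)) (lborel \<Otimes>\<^sub>M lborel) (\<lambda>u. (u 0, u 1)))"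
  then have A: "A \<in> sets (lborel \<Otimes>\<^sub>M lborel)" by simp
  have "emeasure (distr (Pi\<^sub>M {..<2::nat} (\<lambda>_. lborel)) (lborel \<Otimes>\<^sub>M lborel) (\<lambda>u. (u 0, u 1))) A
      = (\<integral>\<^sup>+u. indicator A (u 0, u 1) \<partial>Pi\<^sub>M {..<2::nat} (\<lambda>_. lborel))"
    using A m by (simp add: nn_integral_distr flip: nn_integral_indicator)
  also have "\<dots> = (\<integral>\<^sup>+z. indicator A (fst z, snd z) \<partial>(lborel \<Otimes>\<^sub>M lborel))"
    unfolding e using A by (intro product_nn_integral_pair[where f = "\<lambda>x y. indicator A (x, y)"]) auto
  finally show "emeasure (distr (Pi\<^sub>M {..<2::nat} (\<lambda>_. lborel)) (lborel \<Otimes>\<^sub>M lborel) (\<lambda>u. (u 0, u 1))) A = emeasure (lborel \<Otimes>\<^sub>M lborel) A"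
    using A by simp
qed simp

lemma PiM_lessThan_2:
  fixes H :: "'a::euclidean_space \<Rightarrow> 'a \<Rightarrow> 'b::{banach, second_countable_topology}"
  assumes "(\<lambda>(x, y). H x y) \<in> borel_measurable (lborel \<Otimes>\<^sub>M lborel)"
  shows "integrable (Pi\<^sub>M {..<2::nat} (\<lambda>_. lborel)) (\<lambda>u. H (u 0) (u 1)) \<longleftrightarrow> integrable (lborel \<Otimes>\<^sub>M lborel) (\<lambda>(x, y). H x y)"
    and "(\<integral>u. H (u 0) (u 1) \<partial>Pi\<^sub>M {..<2::nat} (\<lambda>_. lborel)) = (\<integral>(x, y). H x y \<partial>(lborel \<Otimes>\<^sub>M lborel))"
proof -
  have m: "(\<lambda>u. (u 0, u 1)) \<in> Pi\<^sub>M {..<2::nat} (\<lambda>_. lborel :: 'a measure) \<rightarrow>\<^sub>M lborel \<Otimes>\<^sub>M lborel"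
    by measurable
  show "integrable (Pi\<^sub>M {..<2::nat} (\<lambda>_. lborel)) (\<lambda>u. H (u 0) (u 1)) \<longleftrightarrow> integrable (lborel \<Otimes>\<^sub>M lborel) (\<lambda>(x, y). H x y)"
    using integrable_distr_eq[OF m assms, unfolded distr_PiM_lessThan_2] by simp
  show "(\<integral>u. H (u 0) (u 1) \<partial>Pi\<^sub>M {..<2::nat} (\<lambda>_. lborel)) = (\<integral>(x, y). H x y \<partial>(lborel \<Otimes>\<^sub>M lborel))"
    using integral_distr[OF m assms, unfolded distr_PiM_lessThan_2] by simp
qed

text \<open>Makes the default values of the ghost contractions on the diagonal invisible to the
  integral.\<close>

lemma AE_lborel_pair_neq: "AE x in lborel \<Otimes>\<^sub>M lborel. fst x \<noteq> (snd x :: 'a::euclidean_space)"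
proof (rule lborel_pair.AE_pair_measure)
  show "{x \<in> space (lborel \<Otimes>\<^sub>M lborel). fst x \<noteq> (snd x :: 'a)} \<in> sets (lborel \<Otimes>\<^sub>M lborel)"
    by measurable
  show "AE x in lborel. AE y in lborel. fst (x, y) \<noteq> (snd (x, y) :: 'a)"
  proof (rule AE_I2)
    fix x :: 'a
    have "AE y in lborel. y \<notin> {x}"
      by (intro AE_not_in) (auto intro: countable_imp_null_set_lborel)
    then show "AE y in lborel. fst (x, y) \<noteq> snd (x, y)" by eventually_elim auto
  qed
qed


lemma sum4_swap:
  fixes F :: "'a \<Rightarrow> 'a \<Rightarrow> 'a \<Rightarrow> 'a \<Rightarrow> 'b::comm_monoid_add"
  shows "(\<Sum>e\<in>B. \<Sum>f\<in>B. \<Sum>e'\<in>B. \<Sum>f'\<in>B. F e' f' e f) = (\<Sum>e\<in>B. \<Sum>f\<in>B. \<Sum>e'\<in>B. \<Sum>f'\<in>B. F e f e' f')"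
  using sum.swap[of "\<lambda>p q. F (fst q) (snd q) (fst p) (snd p)" "B \<times> B" "B \<times> B"]
  by (simp add: sum.cartesian_product' )

context bf_theory
begin

context
  fixes \<theta>1 :: "'g \<Rightarrow> 'k" and X2 X3 X4 :: 'g and z1 z2 z3 z4 :: complex
begin

definition ext_fields :: "(('k, 'g) derfield \<times> complex) list" where
  "ext_fields = [(Fund (Fa \<theta>1), z1), (Fund (Fgamma X2), z2), (Fund (Fgammabar X3), z3), (Fund (Fgamma X4), z4)]"

lemma length_ext_fields: "length ext_fields = 4" by (simp add: ext_fields_def)

lemma field_insertions_ext_fields:
  "field_insertions ext_fields = [(Fund (Fa \<theta>1), z1, 0), (Fund (Fgamma X2), z2, 1), (Fund (Fgammabar X3), z3, 2), (Fund (Fgamma X4), z4, 3)]"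
  by (simp add: ext_fields_def field_insertions_def upt_rec)

text \<open>At x = 1 the external fields have charge -2 and every vertex has charge 1.\<close>

lemma free_correlator_eq_0:
  assumes "N \<noteq> 2"
  shows "free_correlator ext_fields N u = 0"
  unfolding free_correlator_def length_ext_fields
proof (intro sum.neutral ballI)
  fix I assume I: "I \<in> {..<N} \<rightarrow>\<^sub>E vertex_indices"
  have "(\<Sum>X\<leftarrow>concat (map (\<lambda>k. vertex_insertions (I k) (u k) (4 + k)) [0..<M]). charge 1 (fst X)) = int M"
    if "M \<le> N" for M
    using that
  proof (induction M)
    case (Suc M)
    then have "I M \<in> vertex_indices" using I by (auto simp: PiE_iff)
    then show ?case using Suc by (simp add: vertex_charge split: if_splits)
  qed simp
  from this[of N] assms
  show "(\<Prod>k<N. vertex_sign (fst (I k))) *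
    wick (field_insertions ext_fields @ concat (map (\<lambda>k. vertex_insertions (I k) (u k) (4 + k)) [0..<N])) = 0"
    by (subst wick_eq_0[where x = 1]) (auto simp: field_insertions_ext_fields)
qed

section \<open>Free correlators with two vertices\<close>

definition two_vertex :: "vertex \<times> 'g \<times> 'g \<Rightarrow> vertex \<times> 'g \<times> 'g \<Rightarrow> complex \<Rightarrow> complex \<Rightarrow> complex" where
  "two_vertex I J u v = wick (field_insertions ext_fields @ vertex_insertions I u 4 @ vertex_insertions J v 5)"

text \<open>At x = 0 the external fields have charge -1 and only \<open>V_gammabar\<close> and
  \<open>V_dbarb\<close> are charged, so exactly one of the two vertices must be of this
  class.\<close>

lemma two_vertex_eq_0:
  assumes "I \<in> vertex_indices" "J \<in> vertex_indices"
    and "fst I \<in> {V_gamma, V_db} \<longleftrightarrow> fst J \<in> {V_gamma, V_db}"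
  shows "two_vertex I J u v = 0"
  unfolding two_vertex_def
  by (rule wick_eq_0[where x = 0]) (use assms in \<open>auto simp: field_insertions_ext_fields vertex_charge\<close>)

text \<open>The pairs (Y, y) and (Y', y') stand for (X2, z2) and (X4, z4) in either order, so one
  expression covers both trees.\<close>

definition tree_part where
  "tree_part Y y Y' y' e f e' f' u v = emb (coord e Y) * emb (\<theta>1 (bracket e f)) * emb (coord f (bracket e' f'))
     * emb (coord e' Y') * emb (coord f' X3) * tree_kernel z1 y z3 y' u v"

text \<open>Here a(z1) is contracted directly with the field at y; the fields at y' and z3 are
  attached to u and v, which are joined by two lines.\<close>

definition loop_part where
  "loop_part Y y Y' y' e f e' f' u v = emb (\<theta>1 Y) / (z1 - y)
     * (emb (coord e Y') * emb (coord e' (bracket e f)) * emb (coord f (bracket e' f')) * emb (coord f' X3))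
     * (1 / ((u - y') * (cnj v - cnj z3) * (v - u) * (cnj u - cnj v)))"

text \<open>Contains all but the two ghost contractions. These stay symbolic until u and v are known
  to differ, since on the diagonal they have a default value.\<close>

definition ghost_part where
  "ghost_part Y y Y' y' e e' u v = emb (\<theta>1 Y) / (z1 - y)
     * (emb (coord e X3) * emb (coord e' Y')) * (1 / ((cnj u - cnj z3) * (v - y')))"

lemmas two_vertex_eval = two_vertex_def vertex_insertions_def field_insertions_ext_fields wick_Cons contraction_bosonic compatible_def

lemma two_vertex_gamma_gammabar:
  "two_vertex (V_gamma, e, f) (V_gammabar, e', f') u v =
     tree_part X2 z2 X4 z4 e f e' f' u v + tree_part X4 z4 X2 z2 e f e' f' u v
     + (loop_part X2 z2 X4 z4 e f e' f' u v + loop_part X4 z4 X2 z2 e f e' f' u v)"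
  by (simp add: two_vertex_eval tree_part_def loop_part_def tree_kernel_def add_divide_distrib distrib_left distrib_right mult_ac
      del: wick.simps(2) contraction.simps)

lemma two_vertex_gammabar_gamma:
  "two_vertex (V_gammabar, e', f') (V_gamma, e, f) v u =
     tree_part X2 z2 X4 z4 e f e' f' u v + tree_part X4 z4 X2 z2 e f e' f' u v
     + (loop_part X2 z2 X4 z4 e f e' f' u v + loop_part X4 z4 X2 z2 e f e' f' u v)"
  by (simp add: two_vertex_eval tree_part_def loop_part_def tree_kernel_def add_divide_distrib distrib_left distrib_right mult_ac
      del: wick.simps(2) contraction.simps)

text \<open>Each ghost contraction passes an even number of odd fields, so no sign appears here; the
  sign of the closed ghost loop comes from the propagator with b to the left of c.\<close>

lemma two_vertex_db_dbarb:
  "two_vertex (V_db, e, f) (V_dbarb, e', f') u v =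
     (ghost_part X2 z2 X4 z4 e e' u v + ghost_part X4 z4 X2 z2 e e' u v)
     * contraction (Der 1 0 (Fb (bracket e f)), u, 4) (Fund (Fc (coord f')), v, 5)
     * contraction (Fund (Fc (coord f)), u, 4) (Der 0 1 (Fb (bracket e' f')), v, 5)"
  by (simp add: two_vertex_eval ghost_part_def add_divide_distrib distrib_left distrib_right mult_ac
      del: wick.simps(2) contraction.simps)

lemma two_vertex_dbarb_db:
  "two_vertex (V_dbarb, e', f') (V_db, e, f) v u =
     (ghost_part X2 z2 X4 z4 e e' u v + ghost_part X4 z4 X2 z2 e e' u v)
     * contraction (Der 0 1 (Fb (bracket e' f')), v, 4) (Fund (Fc (coord f)), u, 5)
     * contraction (Fund (Fc (coord f')), v, 4) (Der 1 0 (Fb (bracket e f)), u, 5)"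
  by (simp add: two_vertex_eval ghost_part_def add_divide_distrib distrib_left distrib_right mult_ac
      del: wick.simps(2) contraction.simps)

text \<open>The charges balance in these cases. With a single ghost vertex, however, b and c could
  be contracted only with each other, inside one local operator.\<close>

lemma two_vertex_mixed_eq_0:
  "two_vertex (V_gamma, e, f) (V_dbarb, e', f') u v = 0" "two_vertex (V_dbarb, e, f) (V_gamma, e', f') u v = 0"
  "two_vertex (V_gammabar, e, f) (V_db, e', f') u v = 0" "two_vertex (V_db, e, f) (V_gammabar, e', f') u v = 0"
  by (simp_all add: two_vertex_eval del: wick.simps(2) contraction.simps)

text \<open>When the vertices occur in the opposite order, the summation indices are exchanged too:
  e, f always belong to \<open>V_gamma\<close> or \<open>V_db\<close>. The minus signs are those of
  \<open>V_gammabar\<close>.\<close>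

definition two_vertex_sum :: "complex \<Rightarrow> complex \<Rightarrow> complex" where
  "two_vertex_sum u v = (\<Sum>e\<in>Basis. \<Sum>f\<in>Basis. \<Sum>e'\<in>Basis. \<Sum>f'\<in>Basis.
     two_vertex (V_db, e, f) (V_dbarb, e', f') u v + two_vertex (V_dbarb, e', f') (V_db, e, f) u v
     - two_vertex (V_gamma, e, f) (V_gammabar, e', f') u v - two_vertex (V_gammabar, e', f') (V_gamma, e, f) u v)"

lemma free_correlator_2: "free_correlator ext_fields 2 u = two_vertex_sum (u 0) (u 1)"
proof -
  let ?s = "\<lambda>I J. vertex_sign (fst I) * vertex_sign (fst J) * two_vertex I J (u 0) (u 1)"
  have fin: "finite vertex_indices" by (simp add: vertex_indices_def finite_Basis)
  have two: "[0..<2] = [0, 1::nat]" by (simp add: upt_rec)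
  have two': "{..<2} = {0, 1::nat}" by auto
  have "free_correlator ext_fields 2 u = (\<Sum>I\<in>{..<2::nat} \<rightarrow>\<^sub>E vertex_indices. ?s (I 0) (I 1))"
    unfolding free_correlator_def length_ext_fields two by (simp add: two_vertex_def two' mult.commute)
  also have "\<dots> = (\<Sum>I\<in>vertex_indices. \<Sum>J\<in>vertex_indices. ?s I J)"
    by (rule sum_PiE_lessThan_2[OF fin])
  also have "\<dots> = (\<Sum>e\<in>Basis. \<Sum>f\<in>Basis. \<Sum>e'\<in>Basis. \<Sum>f'\<in>Basis. two_vertex (V_db, e, f) (V_dbarb, e', f') (u 0) (u 1))
     + (\<Sum>e\<in>Basis. \<Sum>f\<in>Basis. \<Sum>e'\<in>Basis. \<Sum>f'\<in>Basis. two_vertex (V_dbarb, e, f) (V_db, e', f') (u 0) (u 1))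
     - (\<Sum>e\<in>Basis. \<Sum>f\<in>Basis. \<Sum>e'\<in>Basis. \<Sum>f'\<in>Basis. two_vertex (V_gamma, e, f) (V_gammabar, e', f') (u 0) (u 1))
     - (\<Sum>e\<in>Basis. \<Sum>f\<in>Basis. \<Sum>e'\<in>Basis. \<Sum>f'\<in>Basis. two_vertex (V_gammabar, e, f) (V_gamma, e', f') (u 0) (u 1))"
  proof -
    \<comment> \<open>Of the sixteen ordered pairs of vertex kinds, eight vanish by charge and four
      as mixed pairs; the other four are the sums in the claim.\<close>
    have "(\<Sum>I\<in>vertex_indices. \<Sum>J\<in>vertex_indices. ?s I J)
      = (\<Sum>I\<in>vertex_indices. \<Sum>J\<in>vertex_indices. if fst I \<in> {V_gamma, V_db} \<longleftrightarrow> fst J \<in> {V_gamma, V_db} then 0 else ?s I J)"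
      by (intro sum.cong refl) (simp add: two_vertex_eq_0)
    then show ?thesis
      by (simp add: sum_vertex_indices two_vertex_mixed_eq_0 sum.distrib sum_subtractf sum_negf)
  qed
  also have "\<dots> = two_vertex_sum (u 0) (u 1)"
    unfolding two_vertex_sum_def sum.distrib sum_subtractf
    by (simp only: sum4_swap[where F = "\<lambda>e f e' f'. two_vertex (V_dbarb, e, f) (V_db, e', f') (u 0) (u 1)"]
        sum4_swap[where F = "\<lambda>e f e' f'. two_vertex (V_gammabar, e, f) (V_gamma, e', f') (u 0) (u 1)"])
  finally show ?thesis .
qed

lemma two_vertex_sum_measurable: "(\<lambda>(u, v). two_vertex_sum u v) \<in> borel_measurable (lborel \<Otimes>\<^sub>M lborel)"
proof -
  have [measurable]: "(\<lambda>(u, v). tree_kernel a b c d u v) \<in> borel_measurable (lborel \<Otimes>\<^sub>M lborel)" for a b c d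
    unfolding tree_kernel_def by measurable
  have db: "(\<lambda>(u, v). two_vertex (V_db, e, f) (V_dbarb, e', f') u v) \<in> borel_measurable (lborel \<Otimes>\<^sub>M lborel)" for e f e' f'
  proof -
    obtain K where K: "\<And>u v. contraction (Der 1 0 (Fb (bracket e f)), u, 4) (Fund (Fc (coord f')), v, 5)
      = (if u = v then K else - emb (coord f' (bracket e f)) / (u - v))" using contraction_db_c[of 4 5] by auto
    obtain K' where K': "\<And>u v. contraction (Fund (Fc (coord f)), u, 4) (Der 0 1 (Fb (bracket e' f')), v, 5)
      = (if u = v then K' else emb (coord f (bracket e' f')) / (cnj v - cnj u))" using contraction_c_dbarb[of 4 5] by auto
    show ?thesis unfolding two_vertex_db_dbarb K K' ghost_part_def by measurable
  qed
  have dbarb: "(\<lambda>(u, v). two_vertex (V_dbarb, e', f') (V_db, e, f) u v) \<in> borel_measurable (lborel \<Otimes>\<^sub>M lborel)" for e f e' f'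
  proof -
    obtain K where K: "\<And>u v. contraction (Der 0 1 (Fb (bracket e' f')), u, 4) (Fund (Fc (coord f)), v, 5)
      = (if u = v then K else - emb (coord f (bracket e' f')) / (cnj u - cnj v))" using contraction_dbarb_c[of 4 5] by auto
    obtain K' where K': "\<And>u v. contraction (Fund (Fc (coord f')), u, 4) (Der 1 0 (Fb (bracket e f)), v, 5)
      = (if u = v then K' else emb (coord f' (bracket e f)) / (v - u))" using contraction_c_db[of 4 5] by auto
    show ?thesis unfolding two_vertex_dbarb_db K K' ghost_part_def by measurable
  qed
  have bos: "(\<lambda>(u, v). two_vertex (V_gamma, e, f) (V_gammabar, e', f') u v) \<in> borel_measurable (lborel \<Otimes>\<^sub>M lborel)"
    "(\<lambda>(u, v). two_vertex (V_gammabar, e', f') (V_gamma, e, f) u v) \<in> borel_measurable (lborel \<Otimes>\<^sub>M lborel)" for e f e' f'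
    unfolding two_vertex_gamma_gammabar two_vertex_gammabar_gamma tree_part_def loop_part_def tree_kernel_def by measurable
  show ?thesis
    unfolding two_vertex_sum_def split_beta
    by (intro borel_measurable_sum borel_measurable_diff borel_measurable_add
        db[unfolded split_beta] dbarb[unfolded split_beta] bos[unfolded split_beta])
qed

definition tree_sum :: "complex \<Rightarrow> complex \<Rightarrow> complex" where
  "tree_sum u v = emb (\<theta>1 (bracket X2 (bracket X3 X4))) * tree_kernel z1 z2 z3 z4 u v
     + emb (\<theta>1 (bracket X4 (bracket X3 X2))) * tree_kernel z1 z4 z3 z2 u v"

text \<open>The loops cancel because both carry the same Killing form and the same propagators:
  differentiating 2 log|u - v| by u or by its conjugate gives the gauge propagators. The ghost loop
  has the minus sign of its odd fields, while the gauge loop has two, from \<open>V_gammabar\<close>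
  and from the reversed bracket.\<close>

lemma two_vertex_sum_eq:
  assumes lin: "Vector_Spaces.linear scale (*) \<theta>1" and uv: "u \<noteq> v"
  shows "two_vertex_sum u v = tree_sum u v + tree_sum v u"
proof -
  define k where "k y' u v = 1 / ((u - y') * (cnj v - cnj z3) * (v - u) * (cnj u - cnj v))" for y' u v
  define l where "l u v = emb (\<theta>1 X2) / (z1 - z2) * ad_trace X3 X4 * k z4 u v
     + emb (\<theta>1 X4) / (z1 - z4) * ad_trace X3 X2 * k z2 u v" for u v
  define t where "t u v = emb (\<theta>1 (bracket X2 (bracket X4 X3))) * tree_kernel z1 z2 z3 z4 u v
     + emb (\<theta>1 (bracket X4 (bracket X2 X3))) * tree_kernel z1 z4 z3 z2 u v" for u v
  have tree_part: "(\<Sum>e\<in>Basis. \<Sum>f\<in>Basis. \<Sum>e'\<in>Basis. \<Sum>f'\<in>Basis. tree_part Y y Y' y' e f e' f' u v)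
     = emb (\<theta>1 (bracket Y (bracket Y' X3))) * tree_kernel z1 y z3 y' u v" for Y y Y' y' u v
    unfolding tree_part_def by (simp only: sum_distrib_right[symmetric] sum4_tree[OF lin])
  have loop_part: "(\<Sum>e\<in>Basis. \<Sum>f\<in>Basis. \<Sum>e'\<in>Basis. \<Sum>f'\<in>Basis. loop_part Y y Y' y' e f e' f' u v)
     = - (emb (\<theta>1 Y) / (z1 - y) * ad_trace X3 Y' * k y' u v)" for Y y Y' y' u v
    unfolding loop_part_def k_def by (simp only: sum_distrib_right[symmetric] sum_distrib_left[symmetric] sum4_loop) simp
  have bos: "(\<Sum>e\<in>Basis. \<Sum>f\<in>Basis. \<Sum>e'\<in>Basis. \<Sum>f'\<in>Basis. two_vertex (V_gamma, e, f) (V_gammabar, e', f') u v) = t u v - l u v"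
    "(\<Sum>e\<in>Basis. \<Sum>f\<in>Basis. \<Sum>e'\<in>Basis. \<Sum>f'\<in>Basis. two_vertex (V_gammabar, e', f') (V_gamma, e, f) v u) = t u v - l u v" for u v
    unfolding two_vertex_gamma_gammabar two_vertex_gammabar_gamma sum.distrib tree_part loop_part t_def l_def by simp_all
  \<comment> \<open>The ghost diagram attaches z3 to u, where \<open>loop_part\<close> attaches it
    to v; hence \<open>l\<close> with its arguments exchanged.\<close>
  have ghost_part: "(\<Sum>e\<in>Basis. \<Sum>f\<in>Basis. \<Sum>e'\<in>Basis. \<Sum>f'\<in>Basis.
      (ghost_part X2 z2 X4 z4 e e' u v + ghost_part X4 z4 X2 z2 e e' u v)
      * (- emb (coord f' (bracket e f)) / (u - v)) * (emb (coord f (bracket e' f')) / (cnj v - cnj u)))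
    = - l v u" for u v
  proof -
    have g: "(\<Sum>e\<in>Basis. \<Sum>f\<in>Basis. \<Sum>e'\<in>Basis. \<Sum>f'\<in>Basis.
      ghost_part Y y Y' y' e e' u v * (- emb (coord f' (bracket e f)) / (u - v)) * (emb (coord f (bracket e' f')) / (cnj v - cnj u)))
      = - (emb (\<theta>1 Y) / (z1 - y) * ad_trace X3 Y' * k y' v u)" for Y y Y' y'
    proof -
      have "ghost_part Y y Y' y' e e' u v * (- emb (coord f' (bracket e f)) / (u - v)) * (emb (coord f (bracket e' f')) / (cnj v - cnj u))
        = (emb (coord e X3) * emb (coord e' Y') * emb (coord f' (bracket e f)) * emb (coord f (bracket e' f')))
          * (- (emb (\<theta>1 Y) / (z1 - y) * k y' v u))" for e f e' f'
        by (simp add: ghost_part_def k_def mult_ac)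
      then show ?thesis by (simp only: sum_distrib_right[symmetric] sum4_ghost) (simp add: mult_ac)
    qed
    show ?thesis unfolding distrib_right sum.distrib g l_def by simp
  qed
  have db: "two_vertex (V_db, e, f) (V_dbarb, e', f') u v =
     (ghost_part X2 z2 X4 z4 e e' u v + ghost_part X4 z4 X2 z2 e e' u v)
      * (- emb (coord f' (bracket e f)) / (u - v)) * (emb (coord f (bracket e' f')) / (cnj v - cnj u))"
    if "u \<noteq> v" for e f e' f' u v
  proof -
    obtain K where K: "\<And>u v. contraction (Der 1 0 (Fb (bracket e f)), u, 4) (Fund (Fc (coord f')), v, 5)
      = (if u = v then K else - emb (coord f' (bracket e f)) / (u - v))" using contraction_db_c[of 4 5] by auto
    obtain K' where K': "\<And>u v. contraction (Fund (Fc (coord f)), u, 4) (Der 0 1 (Fb (bracket e' f')), v, 5)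
      = (if u = v then K' else emb (coord f (bracket e' f')) / (cnj v - cnj u))" using contraction_c_dbarb[of 4 5] by auto
    show ?thesis unfolding two_vertex_db_dbarb K K' using that by (simp only: if_False)
  qed
  have dbarb: "two_vertex (V_dbarb, e', f') (V_db, e, f) v u =
     (ghost_part X2 z2 X4 z4 e e' u v + ghost_part X4 z4 X2 z2 e e' u v)
      * (- emb (coord f' (bracket e f)) / (u - v)) * (emb (coord f (bracket e' f')) / (cnj v - cnj u))"
    if "u \<noteq> v" for e f e' f' u v
  proof -
    obtain K where K: "\<And>u v. contraction (Der 0 1 (Fb (bracket e' f')), u, 4) (Fund (Fc (coord f)), v, 5)
      = (if u = v then K else - emb (coord f (bracket e' f')) / (cnj u - cnj v))" using contraction_dbarb_c[of 4 5] by auto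
    obtain K' where K': "\<And>u v. contraction (Fund (Fc (coord f')), u, 4) (Der 1 0 (Fb (bracket e f)), v, 5)
      = (if u = v then K' else emb (coord f' (bracket e f)) / (v - u))" using contraction_c_db[of 4 5] by auto
    have "v \<noteq> u" using that by simp
    then show ?thesis unfolding two_vertex_dbarb_db K K' by (simp add: mult_ac)
  qed
  have gh: "(\<Sum>e\<in>Basis. \<Sum>f\<in>Basis. \<Sum>e'\<in>Basis. \<Sum>f'\<in>Basis. two_vertex (V_db, e, f) (V_dbarb, e', f') u v) = - l v u"
    "(\<Sum>e\<in>Basis. \<Sum>f\<in>Basis. \<Sum>e'\<in>Basis. \<Sum>f'\<in>Basis. two_vertex (V_dbarb, e', f') (V_db, e, f) v u) = - l v u" if "u \<noteq> v" for u v
    unfolding db[OF that] dbarb[OF that] ghost_part by (rule refl)+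
  have "two_vertex_sum u v = - l v u + - l u v - (t u v - l u v) - (t v u - l v u)"
    unfolding two_vertex_sum_def sum.distrib sum_subtractf by (simp only: bos gh[OF uv] gh[OF uv[symmetric]])
  \<comment> \<open>Reversing the inner bracket absorbs the sign of
    \<open>V_gammabar\<close>.\<close>
  moreover have "t u v = - tree_sum u v" for u v
  proof -
    interpret r: Vector_Spaces.linear scale scale "bracket x" for x by (rule bracket_linear_right)
    interpret t: Vector_Spaces.linear scale "(*)" \<theta>1 by fact
    show ?thesis
      by (simp add: t_def tree_sum_def bracket_anti[of X4 X3] bracket_anti[of X2 X3] r.neg t.neg)
  qed
  ultimately show ?thesis by simp
qed

text \<open>Each tree integrates to 4 pi^2 times \<open>BF_I\<close>, and the two assignments of u
  and v to the vertices contribute equally, which makes 8 pi^2.\<close>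

lemma two_vertex_sum_has_bochner_integral:
  assumes lin: "Vector_Spaces.linear scale (*) \<theta>1" and d: "distinct [z1, z2, z3, z4]"
  shows "has_bochner_integral (lborel \<Otimes>\<^sub>M lborel) (\<lambda>(u, v). two_vertex_sum u v)
    (8 * (complex_of_real pi)\<^sup>2 * (emb (\<theta>1 (bracket X2 (bracket X3 X4))) * BF_I z1 z2 z3 z4
       + emb (\<theta>1 (bracket X4 (bracket X3 X2))) * BF_I z1 z4 z3 z2))"
proof -
  have k: "has_bochner_integral (lborel \<Otimes>\<^sub>M lborel) (\<lambda>(u, v). tree_kernel z1 y z3 y' u v)
      (4 * (complex_of_real pi)\<^sup>2 * BF_I z1 y z3 y')" if "distinct [z1, y, z3, y']" for y y'
  proof -
    have "4 * c * (D / (2 * d)) = 2 * c * D / d" for c D d :: complex by simp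
    then show ?thesis
      using integrable_tree_kernel[of z1 y z3 y'] that
      unfolding bw_primitive_difference[OF that, symmetric]
      by (simp only: has_bochner_integral_iff integral_tree_kernel[OF that]) simp
  qed
  have "has_bochner_integral (lborel \<Otimes>\<^sub>M lborel) (\<lambda>p. emb (\<theta>1 (bracket X2 (bracket X3 X4))) * (case p of (u, v) \<Rightarrow> tree_kernel z1 z2 z3 z4 u v)
       + emb (\<theta>1 (bracket X4 (bracket X3 X2))) * (case p of (u, v) \<Rightarrow> tree_kernel z1 z4 z3 z2 u v))
      (emb (\<theta>1 (bracket X2 (bracket X3 X4))) * (4 * (complex_of_real pi)\<^sup>2 * BF_I z1 z2 z3 z4)
       + emb (\<theta>1 (bracket X4 (bracket X3 X2))) * (4 * (complex_of_real pi)\<^sup>2 * BF_I z1 z4 z3 z2))"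
    using d by (intro has_bochner_integral_add has_bochner_integral_mult_right k) auto
  then have t: "has_bochner_integral (lborel \<Otimes>\<^sub>M lborel) (\<lambda>(u, v). tree_sum u v)
      (4 * (complex_of_real pi)\<^sup>2 * (emb (\<theta>1 (bracket X2 (bracket X3 X4))) * BF_I z1 z2 z3 z4
       + emb (\<theta>1 (bracket X4 (bracket X3 X2))) * BF_I z1 z4 z3 z2))"
    by (simp add: tree_sum_def case_prod_unfold algebra_simps)
  have t': "has_bochner_integral (lborel \<Otimes>\<^sub>M lborel) (\<lambda>(u, v). tree_sum v u)
      (4 * (complex_of_real pi)\<^sup>2 * (emb (\<theta>1 (bracket X2 (bracket X3 X4))) * BF_I z1 z2 z3 z4
       + emb (\<theta>1 (bracket X4 (bracket X3 X2))) * BF_I z1 z4 z3 z2))"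
    using t lborel_pair.integrable_product_swap[of "\<lambda>(u, v). tree_sum u v"]
      lborel_pair.integral_product_swap[of "\<lambda>(u, v). tree_sum u v"]
    by (simp add: has_bochner_integral_iff borel_measurable_integrable)
  have "AE p in lborel \<Otimes>\<^sub>M lborel. (case p of (u, v) \<Rightarrow> two_vertex_sum u v) = (case p of (u, v) \<Rightarrow> tree_sum u v) + (case p of (u, v) \<Rightarrow> tree_sum v u)"
    using AE_lborel_pair_neq by eventually_elim (auto simp: two_vertex_sum_eq[OF lin])
  moreover have "has_bochner_integral (lborel \<Otimes>\<^sub>M lborel) (\<lambda>p. (case p of (u, v) \<Rightarrow> tree_sum u v) + (case p of (u, v) \<Rightarrow> tree_sum v u))
     (8 * (complex_of_real pi)\<^sup>2 * (emb (\<theta>1 (bracket X2 (bracket X3 X4))) * BF_I z1 z2 z3 z4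
       + emb (\<theta>1 (bracket X4 (bracket X3 X2))) * BF_I z1 z4 z3 z2))"
    using has_bochner_integral_add[OF t t'] by (simp add: algebra_simps)
  ultimately show ?thesis
    using two_vertex_sum_measurable
    by (subst has_bochner_integral_cong_AE) (auto simp: has_bochner_integral_iff intro: borel_measurable_integrable)
qed

lemma correlator_ext_fields:
  assumes lin: "Vector_Spaces.linear scale (*) \<theta>1" and d: "distinct [z1, z2, z3, z4]"
  shows "correlator_exists ext_fields"
    and "correlator ext_fields = coupling\<^sup>2 *
      (emb (\<theta>1 (bracket X2 (bracket X3 X4))) * BF_I z1 z2 z3 z4
       + emb (\<theta>1 (bracket X4 (bracket X3 X2))) * BF_I z1 z4 z3 z2)"
proof -
  let ?\<Phi> = "ext_fields"
  let ?R = "emb (\<theta>1 (bracket X2 (bracket X3 X4))) * BF_I z1 z2 z3 z4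
       + emb (\<theta>1 (bracket X4 (bracket X3 X2))) * BF_I z1 z4 z3 z2"
  have fc: "free_correlator ?\<Phi> 2 = (\<lambda>u. two_vertex_sum (u 0) (u 1))" by (rule ext) (rule free_correlator_2)
  have fc0: "free_correlator ?\<Phi> N = (\<lambda>u. 0)" if "N \<noteq> 2" for N
    using free_correlator_eq_0[OF that] by (intro ext)
  have int: "integrable (Pi\<^sub>M {..<N} (\<lambda>_. lborel)) (free_correlator ?\<Phi> N)" for N
    using two_vertex_sum_has_bochner_integral[OF assms] PiM_lessThan_2(1)[OF two_vertex_sum_measurable]
    by (cases "N = 2") (auto simp: fc fc0 has_bochner_integral_iff)
  have t0: "correlator_term ?\<Phi> N = 0" if "N \<notin> {2}" for N
    using that by (simp add: correlator_term_def fc0)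
  have "(\<integral>u. two_vertex_sum (u 0) (u 1) \<partial>Pi\<^sub>M {..<2::nat} (\<lambda>_. lborel)) = 8 * (complex_of_real pi)\<^sup>2 * ?R"
    using two_vertex_sum_has_bochner_integral[OF assms] PiM_lessThan_2(2)[OF two_vertex_sum_measurable]
    by (simp add: has_bochner_integral_iff)
  \<comment> \<open>The prefactor (1/2!) (g/(2 pi))^2 times 8 pi^2 is g^2.\<close>
  then have t2: "correlator_term ?\<Phi> 2 = coupling\<^sup>2 * ?R"
    by (simp add: correlator_term_def fc fact_2 power2_eq_square field_simps)
  have s: "correlator_term ?\<Phi> sums (\<Sum>N\<in>{2}. correlator_term ?\<Phi> N)"
    using t0 by (intro sums_finite) auto
  show "correlator_exists ?\<Phi>"
    using int sums_summable[OF s] by (simp add: correlator_exists_def)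
  show "correlator ?\<Phi> = coupling\<^sup>2 * ?R"
    using sums_unique[OF s] by (simp add: correlator_def t2)
qed

end

end

theorem mainTheorem3:
  fixes scale :: "'k::field \<Rightarrow> 'g::ab_group_add \<Rightarrow> 'g"
    and B :: "'g set"
    and bracket :: "'g \<Rightarrow> 'g \<Rightarrow> 'g"
    and \<iota> :: "'k \<Rightarrow> complex"
    and g C :: complex
    and \<theta>1 :: "'g \<Rightarrow> 'k"
    and X2 X3 X4 :: 'g
    and z1 z2 z3 z4 :: complex
  assumes "bf_theory scale B bracket \<iota>"
    and "fd_lie_algebra.strongly_unimodular scale B bracket"
    and "Vector_Spaces.linear scale (*) \<theta>1"
    and "distinct [z1, z2, z3, z4]"
  defines "\<Phi> \<equiv> [(Fund (Fa \<theta>1), z1), (Fund (Fgamma X2), z2),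
                 (Fund (Fgammabar X3), z3), (Fund (Fgamma X4), z4)]"
  shows "bf_theory.correlator_exists scale B bracket \<iota> g C \<Phi> \<and>
         bf_theory.correlator scale B bracket \<iota> g C \<Phi> =
           g\<^sup>2 * (\<iota> (\<theta>1 (bracket X2 (bracket X3 X4))) * BF_I z1 z2 z3 z4
                + \<iota> (\<theta>1 (bracket X4 (bracket X3 X2))) * BF_I z1 z4 z3 z2)"
proof -
  interpret bf_theory scale B bracket \<iota> g C by fact
  show ?thesis
    using correlator_ext_fields[OF assms(3,4), of X2 X3 X4] by (simp add: ext_fields_def \<Phi>_def)
qed

end
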